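(* Let $n\ge k\ge1$. Then every irreducible $S^\lambda$ occurring in $\rho_{n,k}$ has a Young diagram with exactly $k$ columns (i.e. $\lambda_1=k$).
   Context: All vector spaces are over $\mathbb C$. For $n\ge 2$, a Filippov $n$-algebra is a vector space $L$ with an $n$-linear map $[\cdot,\dots,\cdot]:L^n\to L$ satisfying $[x_1,\dots,x_n]=\mathrm{sgn}(\sigma)[x_{\sigma(1)},\dots,x_{\sigma(n)}]$ for all $\sigma\in\mathfrak S_n$, and $[[x_1,\dots,x_n],x_{n+1},\dots,x_{2n-1}]=\sum_{i=1}^n[x_1,\dots,x_{i-1},[x_i,x_{n+1},\dots,x_{2n-1}],x_{i+1},\dots,x_n]$. The free Filippov $n$-algebra on a set $X$ is generated by all $n$-ary bracketings of elements of $X$, subject only to relations following from $n$-linearity, antisymmetry and the generalized Jacobi identity. For $n\ge2$, $\rho_{n,k}$ is the multilinear component of the free Filippov $n$-algebra on $[k(n-1)+1]$ (span of $n$-bracketed words using each letter exactly once), an $\mathfrak S_{k(n-1)+1}$-module by permuting letters; by convention $\rho_{1,k}=S^1$. $S^\lambda$ denotes the Specht module indexed by $\lambda$. *)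

theory Defs
  imports
    Complex_Main
    "HOL-Algebra.Module"
    "HOL-Algebra.AbelCoset"
    "HOL-Algebra.Sym_Groups"
    "HOL-Combinatorics.Permutations"
    "HOL-Library.Poly_Mapping"
begin

section \<open>Complex vector spaces and linear representations\<close>

text \<open>
  Complex vector spaces are \<open>module\<close> records; the ring multiplication and the unit that this
  record type inherits play no role.
\<close>

record ('g, 'b) rep = "(complex, 'b) module" +
  act :: "'g \<Rightarrow> 'b \<Rightarrow> 'b"

definition intertwiners ::
  "('g, 'c) monoid_scheme \<Rightarrow> ('g, 'a) rep \<Rightarrow> ('g, 'b) rep \<Rightarrow> ('a \<Rightarrow> 'b) set" where
  "intertwiners G V W = {f \<in> carrier V \<rightarrow> carrier W.
     (\<forall>v\<in>carrier V. \<forall>w\<in>carrier V. f (v \<oplus>\<^bsub>V\<^esub> w) = f v \<oplus>\<^bsub>W\<^esub> f w) \<and>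
     (\<forall>c. \<forall>v\<in>carrier V. f (c \<odot>\<^bsub>V\<^esub> v) = c \<odot>\<^bsub>W\<^esub> f v) \<and>
     (\<forall>g\<in>carrier G. \<forall>v\<in>carrier V. f (act V g v) = act W g (f v))}"

text \<open>\<open>V\<close> is isomorphic to a subrepresentation of \<open>W\<close>, namely to the image of \<open>f\<close>.\<close>

definition occurs_in ::
  "('g, 'c) monoid_scheme \<Rightarrow> ('g, 'a) rep \<Rightarrow> ('g, 'b) rep \<Rightarrow> bool" where
  "occurs_in G V W \<longleftrightarrow> (\<exists>f \<in> intertwiners G V W. inj_on f (carrier V))"

definition subrep :: "(complex, 'b) module \<Rightarrow> 'b set \<Rightarrow> ('g \<Rightarrow> 'b \<Rightarrow> 'b) \<Rightarrow> ('g, 'b) rep" where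
  "subrep M S a = \<lparr>carrier = S, monoid.mult = monoid.mult M, one = one M, zero = \<zero>\<^bsub>M\<^esub>, add = add M,
     smult = smult M, act = a\<rparr>"

definition quot_module :: "('r, 'b) module \<Rightarrow> 'b set \<Rightarrow> ('r, 'b set) module" where
  "quot_module M H = \<lparr>carrier = a_rcosets\<^bsub>M\<^esub> H, monoid.mult = undefined, one = undefined, zero = H,
     add = set_add M, smult = (\<lambda>c C. \<Union>p\<in>C. H +>\<^bsub>M\<^esub> (c \<odot>\<^bsub>M\<^esub> p))\<rparr>"


section \<open>Free vector spaces\<close>

definition cscale :: "complex \<Rightarrow> ('b \<Rightarrow>\<^sub>0 complex) \<Rightarrow> ('b \<Rightarrow>\<^sub>0 complex)" where
  "cscale c p = Poly_Mapping.map ((*) c) p"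

lemma lookup_cscale: "Poly_Mapping.lookup (cscale c p) b = c * Poly_Mapping.lookup p b"
  unfolding cscale_def by (simp add: Poly_Mapping.map.rep_eq when_def)

interpretation cvs: vector_space cscale
  by unfold_locales (auto intro!: poly_mapping_eqI simp: lookup_cscale lookup_add algebra_simps)

definition free_module :: "'b set \<Rightarrow> (complex, 'b \<Rightarrow>\<^sub>0 complex) module" where
  "free_module S = \<lparr>carrier = {p. Poly_Mapping.keys p \<subseteq> S}, monoid.mult = undefined, one = undefined,
     zero = 0, add = (+), smult = cscale\<rparr>"

definition pushforward :: "('b \<Rightarrow> 'd) \<Rightarrow> ('b \<Rightarrow>\<^sub>0 complex) \<Rightarrow> ('d \<Rightarrow>\<^sub>0 complex)" where
  "pushforward f p = (\<Sum>b\<in>Poly_Mapping.keys p. Poly_Mapping.single (f b) (Poly_Mapping.lookup p b))"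


section \<open>The free Filippov algebra and its multilinear component\<close>

datatype 'x word = Letter 'x | Bracket "'x word list"

primrec letters :: "'x word \<Rightarrow> 'x list" where
  "letters (Letter x) = [x]"
| "letters (Bracket ws) = concat (map letters ws)"

inductive_set nwords :: "nat \<Rightarrow> 'x set \<Rightarrow> 'x word set" for n :: nat and X :: "'x set" where
  "x \<in> X \<Longrightarrow> Letter x \<in> nwords n X"
| "ws \<in> lists (nwords n X) \<Longrightarrow> length ws = n \<Longrightarrow> Bracket ws \<in> nwords n X"

text \<open>The multilinear extension of \<open>Bracket\<close> to linear combinations of words.\<close>

definition bracket :: "('x word \<Rightarrow>\<^sub>0 complex) list \<Rightarrow> ('x word \<Rightarrow>\<^sub>0 complex)" where
  "bracket ps = (\<Sum>ws\<in>listset (map Poly_Mapping.keys ps).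
     Poly_Mapping.single (Bracket ws) (\<Prod>i<length ps. Poly_Mapping.lookup (ps ! i) (ws ! i)))"

text \<open>
  The smallest subspace of the free \<open>n\<close>-ary algebra on \<open>X\<close> that contains all instances of
  antisymmetry and of the generalized Jacobi identity and that contains a bracket as soon as it
  contains one of its arguments. Arguments are indexed from 0.
\<close>

inductive_set filippov_ideal :: "nat \<Rightarrow> 'x set \<Rightarrow> ('x word \<Rightarrow>\<^sub>0 complex) set"
  for n :: nat and X :: "'x set" where
  zero: "0 \<in> filippov_ideal n X"
| add: "\<lbrakk>p \<in> filippov_ideal n X; q \<in> filippov_ideal n X\<rbrakk> \<Longrightarrow> p + q \<in> filippov_ideal n X"
| scale: "p \<in> filippov_ideal n X \<Longrightarrow> cscale c p \<in> filippov_ideal n X"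
| bracket: "\<lbrakk>ps \<in> lists (carrier (free_module (nwords n X))); length ps = n; i < n;
    ps ! i \<in> filippov_ideal n X\<rbrakk> \<Longrightarrow> bracket ps \<in> filippov_ideal n X"
| antisymmetry: "\<lbrakk>ps \<in> lists (carrier (free_module (nwords n X))); length ps = n;
    \<sigma> permutes {..<n}\<rbrakk> \<Longrightarrow>
    bracket ps - cscale (of_int (sign \<sigma>)) (bracket (permute_list \<sigma> ps)) \<in> filippov_ideal n X"
| jacobi: "\<lbrakk>ps \<in> lists (carrier (free_module (nwords n X))); length ps = n;
    qs \<in> lists (carrier (free_module (nwords n X))); length qs = n - 1\<rbrakk> \<Longrightarrow>
    bracket (bracket ps # qs) - (\<Sum>i<n. bracket (ps[i := bracket (ps ! i # qs)]))
      \<in> filippov_ideal n X"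

definition free_filippov :: "nat \<Rightarrow> 'x set \<Rightarrow> (complex, ('x word \<Rightarrow>\<^sub>0 complex) set) module" where
  "free_filippov n X = quot_module (free_module (nwords n X)) (filippov_ideal n X)"

definition multilinear_words :: "nat \<Rightarrow> nat \<Rightarrow> nat word set" where
  "multilinear_words n N =
     {w \<in> nwords n {1..N}. distinct (letters w) \<and> set (letters w) = {1..N}}"

text \<open>
  The representation \<open>\<rho>\<^sub>n\<^sub>,\<^sub>k\<close> for \<open>n \<ge> 2\<close>. A permutation acts on a coset of the ideal by relabelling
  the letters in all its elements.
\<close>

definition rho :: "nat \<Rightarrow> nat \<Rightarrow> (nat \<Rightarrow> nat, (nat word \<Rightarrow>\<^sub>0 complex) set) rep" where
  "rho n k = (let N = k * (n - 1) + 1 in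
     subrep (free_filippov n {1..N})
       {filippov_ideal n {1..N} +>\<^bsub>free_module (nwords n {1..N})\<^esub> p | p.
          Poly_Mapping.keys p \<subseteq> multilinear_words n N}
       (\<lambda>\<sigma> C. pushforward (map_word \<sigma>) ` C))"


section \<open>Specht modules\<close>

text \<open>
  Partitions are weakly decreasing lists of positive parts; rows and columns of diagrams are
  indexed from 0. Outside its diagram a tableau is an arbitrary function, which does not affect
  any of the notions below.
\<close>

definition is_partition :: "nat list \<Rightarrow> nat \<Rightarrow> bool" where
  "is_partition lam N \<longleftrightarrow> sorted_wrt (\<ge>) lam \<and> 0 \<notin> set lam \<and> sum_list lam = N"

definition diagram :: "nat list \<Rightarrow> (nat \<times> nat) set" where
  "diagram lam = {(i, j). i < length lam \<and> j < lam ! i}"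

definition tableaux :: "nat list \<Rightarrow> (nat \<times> nat \<Rightarrow> nat) set" where
  "tableaux lam = {T. bij_betw T (diagram lam) {1..sum_list lam}}"

text \<open>The tabloid of \<open>T\<close>, encoded as the list of the sets of entries of the rows of \<open>T\<close>.\<close>

definition tabloid :: "nat list \<Rightarrow> (nat \<times> nat \<Rightarrow> nat) \<Rightarrow> nat set list" where
  "tabloid lam T = map (\<lambda>i. {T (i, j) | j. j < lam ! i}) [0..<length lam]"

definition column_stabilizer :: "nat list \<Rightarrow> (nat \<times> nat \<Rightarrow> nat) \<Rightarrow> (nat \<Rightarrow> nat) set" where
  "column_stabilizer lam T = {\<sigma>. \<sigma> permutes {1..sum_list lam} \<and>
     (\<forall>(i, j)\<in>diagram lam. \<exists>i'. (i', j) \<in> diagram lam \<and> \<sigma> (T (i, j)) = T (i', j))}"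

definition polytabloid :: "nat list \<Rightarrow> (nat \<times> nat \<Rightarrow> nat) \<Rightarrow> (nat set list \<Rightarrow>\<^sub>0 complex)" where
  "polytabloid lam T =
     (\<Sum>\<sigma>\<in>column_stabilizer lam T. Poly_Mapping.single (tabloid lam (\<sigma> \<circ> T)) (of_int (sign \<sigma>)))"

definition specht :: "nat list \<Rightarrow> (nat \<Rightarrow> nat, nat set list \<Rightarrow>\<^sub>0 complex) rep" where
  "specht lam = subrep (free_module (tabloid lam ` tableaux lam))
     (cvs.span (polytabloid lam ` tableaux lam))
     (\<lambda>\<sigma>. pushforward (map ((`) \<sigma>)))"

text \<open>
  By convention \<open>\<rho>\<^sub>1\<^sub>,\<^sub>k\<close> is the Specht module of the partition (1); it is not the module
  \<open>rho 1 k\<close>, whose definition is only meaningful for \<open>n \<ge> 2\<close>.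
\<close>

definition specht_occurs_in_rho :: "nat list \<Rightarrow> nat \<Rightarrow> nat \<Rightarrow> bool" where
  "specht_occurs_in_rho lam n k \<longleftrightarrow>
     (if n = 1 then occurs_in (sym_group 1) (specht lam) (specht [1])
      else occurs_in (sym_group (k * (n - 1) + 1)) (specht lam) (rho n k))"

end

theory Submission
  imports Defs "HOL-Library.Function_Algebras"
begin

text \<open>
  By the Jacobi identity the left-normed words \<open>[\<dots>[[x, u\<^sub>0], u\<^sub>1], \<dots>, u\<^bsub>k-1\<^esub>]\<close>, in which every \<open>u\<^sub>i\<close>
  is a block of \<open>p = n - 1\<close> letters, span the multilinear component modulo the ideal. Each bracket
  is antisymmetric in its block and there are \<open>k\<close> blocks, so symmetrising over more than \<open>k\<close> letters
  gives zero; hence no diagram has more than \<open>k\<close> columns.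

  For the converse, let \<open>\<Psi>\<close> be a linear functional on words that vanishes on the ideal, and let
  \<open>g \<beta>\<close> be the signed sum of its values on those left-normed words whose letters are distributed over
  the blocks according to \<open>\<beta>\<close>. Then \<open>g\<close> is a function on the standard basis of a tensor power of
  \<open>\<complex>\<^sup>k\<close>, on which the Lie algebra of \<open>k \<times> k\<close> matrices acts; \<open>x\<close> is counted in block \<open>0\<close>, so \<open>g\<close> has weight
  \<open>(p + 1, p, \<dots>, p)\<close>. Two applications of the Jacobi identity to the blocks
  \<open>i\<close> and \<open>i + 1\<close> express the exchange of one letter between them (the product of the matrix units
  \<open>E\<^bsub>i+1,i\<^esub> E\<^bsub>i,i+1\<^esub>\<close>) by the exchange of the whole blocks, and \<open>sl\<^sub>2\<close>-theory turns this into
  \<open>E\<^bsub>i,i+1\<^esub>\<^sup>2 g = 0\<close>; in the same way \<open>E\<^sub>0\<^sub>1 g = 0\<close>. By induction on \<open>q\<close> every product of \<open>q\<close>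
  of the commuting operators \<open>E\<^sub>0\<^sub>q, \<dots>, E\<^bsub>q-1,q\<^esub>\<close> kills \<open>g\<close>. If \<open>p \<ge> k - 1\<close>, all products of \<open>p\<close> operators
  \<open>E\<^bsub>i,k-1\<^esub>\<close> kill \<open>g\<close>: moving letters out of the last block in all possible ways gives zero. If moreover the word is
  antisymmetrised over the columns of a diagram with at most \<open>k - 1\<close> columns, these relations form a
  triangular system, and \<open>g = 0\<close>.
\<close>

section \<open>Nilpotent operators from sl2 and the Heisenberg algebra\<close>

text \<open>The argument is dual throughout: one functional is fixed, and congruences modulo the
  ideal become equations between complex numbers. The signs in \<open>g\<close> absorb the
  antisymmetry inside the blocks, so all arrangements with the same \<beta> contribute the same
  number, and \<open>g = 0\<close> returns the vanishing of the functional on left-normed words. The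
  letter \<open>x\<close> is counted in block 0 because the innermost bracket is antisymmetric in
  all its \<open>p + 1\<close> arguments. The obstacle is that the Jacobi identity relates only
  neighbouring blocks, while the last block must exchange letters with all others at once. Matrix
  units with distant indices are commutators of neighbouring ones,
  \<open>[E_iq, E_q(q+1)] = E_i(q+1)\<close>, and nilpotency has to be carried along these
  commutators. The vanishing square of the neighbouring operator is just enough for the degree to
  grow by one per block, from 1 for \<open>E_01\<close> to \<open>k - 1\<close> for the last block.
  A relation that refills the last block has to move exactly \<open>p\<close> letters, so
  \<open>k - 1 \<le> p\<close> is the point at which \<open>n \<ge> k\<close> enters.\<close>

instantiation "fun" :: (type, real_vector) real_vector
begin

definition "r *\<^sub>R f = (\<lambda>x. r *\<^sub>R f x)"

instance
  by standard (simp_all add: fun_eq_iff scaleR_fun_def scaleR_add_right scaleR_add_left)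

end

lemma scaleR_fun_apply [simp]: "(r *\<^sub>R f) x = r *\<^sub>R f x"
  by (simp add: scaleR_fun_def)

lemma linear_funpow:
  fixes f :: "'v::real_vector \<Rightarrow> 'v"
  assumes "linear f"
  shows "linear (f ^^ m)"
proof (induction m)
  case 0
  show ?case by (simp add: linear_id[unfolded id_def])
next
  case (Suc m)
  show ?case using linear_compose[OF Suc assms] by (simp add: o_def)
qed

text \<open>Commuting \<open>f\<close> past the powers of \<open>e\<close> gives
  \<open>f (e^(j+1) w) = - (j+1) (\<mu>+j) e^j w\<close>, and for positive \<mu> no factor vanishes.
  So \<open>e^J w = 0\<close> can be descended to \<open>w = 0\<close>: in a finite string a lowest
  weight vector cannot have positive weight.\<close>

lemma sl2_lowering_injective:
  fixes e f h :: "'v::real_vector \<Rightarrow> 'v" and \<mu> :: real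
  assumes "linear e" "linear f" "linear h"
    and ef: "\<And>x. e (f x) = f (e x) + h x"
    and he: "\<And>x. h (e x) = e (h x) + 2 *\<^sub>R e x"
    and hw: "h w = \<mu> *\<^sub>R w" and "\<mu> > 0" and fw: "f w = 0"
    and nil: "(e ^^ J) w = 0"
  shows "w = 0"
proof -
  have h: "h ((e ^^ j) w) = (\<mu> + 2 * real j) *\<^sub>R (e ^^ j) w" for j
  proof (induction j)
    case (Suc j)
    show ?case
      by (simp add: he Suc linear_scale[OF \<open>linear e\<close>] algebra_simps flip: scaleR_add_left)
  qed (simp add: hw)
  have f: "f ((e ^^ Suc j) w) = - ((real j + 1) * (\<mu> + real j)) *\<^sub>R (e ^^ j) w" for j
  proof (induction j)
    case 0
    have "f (e w) = e (f w) - h w" by (simp add: ef)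
    then show ?case by (simp add: hw fw linear_0[OF \<open>linear e\<close>])
  next
    case (Suc j)
    have "f ((e ^^ Suc (Suc j)) w) = e (f ((e ^^ Suc j) w)) - h ((e ^^ Suc j) w)"
      by (simp add: ef)
    also have "\<dots> = - ((real (Suc j) + 1) * (\<mu> + real (Suc j))) *\<^sub>R (e ^^ Suc j) w"
      unfolding Suc h
      by (simp add: linear_scale[OF \<open>linear e\<close>] flip: scaleR_add_left scaleR_diff_left scaleR_minus_left)
         (simp add: algebra_simps)
    finally show ?case .
  qed
  show ?thesis
    using nil
  proof (induction J)
    case (Suc J)
    have "- ((real J + 1) * (\<mu> + real J)) *\<^sub>R (e ^^ J) w = 0"
      using f[of J] Suc.prems by (simp only: linear_0[OF \<open>linear f\<close>])
    moreover have "(real J + 1) * (\<mu> + real J) \<noteq> 0" using \<open>\<mu> > 0\<close> by (simp add: add_pos_nonneg) 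
    ultimately show ?case using Suc.IH by simp
  qed simp
qed

section \<open>Operators with the Heisenberg commutation relations\<close>

locale heisenberg =
  fixes a b c :: "'v::real_vector \<Rightarrow> 'v"
  assumes lin: "linear a" "linear b" "linear c"
    and ab: "a (b x) = b (a x) + c x"
    and ac: "a (c x) = c (a x)"
    and bc: "b (c x) = c (b x)"
begin

lemma bc_pow: "b ((c ^^ j) x) = (c ^^ j) (b x)"
  by (induction j) (simp_all add: bc)

lemma a_pow_b: "(a ^^ m) (b x) = b ((a ^^ m) x) + real m *\<^sub>R c ((a ^^ (m - 1)) x)"
proof (induction m)
  case (Suc m)
  show ?case
  proof (cases m)
    case (Suc m')
    then show ?thesis using Suc.IH
      by (simp add: linear_add[OF lin(1)] linear_scale[OF lin(1)] ab ac algebra_simps scaleR_2)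
  qed (simp add: ab)
qed simp

text \<open>Each commutator consumes one \<open>a\<close> and leaves one \<open>c\<close>. Wherever
  the exponents \<open>m - 1\<close> and \<open>m - 2\<close> are truncated, their coefficients
  vanish.\<close>

lemma a_pow_bb: "(a ^^ m) (b (b x)) = b (b ((a ^^ m) x)) + (2 * real m) *\<^sub>R c (b ((a ^^ (m - 1)) x))
   + (real m * (real m - 1)) *\<^sub>R c (c ((a ^^ (m - 2)) x))"
proof -
  have 1: "real (m - Suc 0) = real m - 1" if "m > 0" using that by simp
  show ?thesis
    by (cases "m = 0")
       (simp_all add: a_pow_b linear_add[OF lin(2)] linear_add[OF lin(3)] linear_diff[OF lin(3)] linear_scale[OF lin(2)]
          linear_scale[OF lin(3)] bc 1 algebra_simps numeral_2_eq_2[symmetric],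
        simp add: scaleR_2 scaleR_add_right flip: scaleR_scaleR)
qed

text \<open>
  Applying \<open>a ^^ m\<close> to \<open>b (b v) = 0\<close> gives a second-order recursion for the vectors \<open>Q i j m\<close> below, which
  preserves both \<open>i + j\<close> and \<open>j + m\<close>. In degree \<open>i + j = r + 1\<close> its two boundary conditions
  leave only the zero solution for \<open>j + m = r + 1\<close> and for \<open>j + m = r\<close>.
\<close>

lemma nilpotency:
  assumes a: "(a ^^ r) v = 0" and bb: "b (b v) = 0" and r: "r \<ge> 1"
  shows "(c ^^ Suc r) v = 0" and "b ((c ^^ r) v) = 0"
proof -
  note linp = linear_funpow[OF lin(1)] linear_funpow[OF lin(2)] linear_funpow[OF lin(3)]
  define Q where "Q i j m = (b ^^ i) ((c ^^ j) ((a ^^ m) v))" for i j m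
  have b_c: "b ((c ^^ j) x) = (c ^^ j) (b x)" for j x by (rule bc_pow)
  have b_i: "(b ^^ i) (c x) = c ((b ^^ i) x)" for i x by (induction i) (simp_all add: bc)
  have b_ic: "(b ^^ i) ((c ^^ j) x) = (c ^^ j) ((b ^^ i) x)" for i j x by (induction j) (simp_all add: b_i)
  have rec: "Q (i + 2) j m + (2 * real m) *\<^sub>R Q (i + 1) (j + 1) (m - 1)
      + (real m * (real m - 1)) *\<^sub>R Q i (j + 2) (m - 2) = 0" for i j m
  proof -
    have "0 = (b ^^ i) ((c ^^ j) ((a ^^ m) (b (b v))))"
      by (simp add: bb linear_0[OF linp(1)] linear_0[OF linp(2)] linear_0[OF linp(3)])
    also have "\<dots> = (b ^^ i) ((c ^^ j) (b (b ((a ^^ m) v)))) + (2 * real m) *\<^sub>R (b ^^ i) ((c ^^ j) (c (b ((a ^^ (m - 1)) v))))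
      + (real m * (real m - 1)) *\<^sub>R (b ^^ i) ((c ^^ j) (c (c ((a ^^ (m - 2)) v))))"
      by (simp only: a_pow_bb linear_add[OF linp(2)] linear_add[OF linp(3)] linear_scale[OF linp(2)] linear_scale[OF linp(3)])
    finally show ?thesis
      by (simp add: Q_def b_c b_ic funpow_swap1 del: funpow.simps)
        (simp add: b_i funpow_swap1 b_ic bc_pow)
  qed
  have Q0: "Q i j m = 0" if "m \<ge> r" for i j m
  proof -
    have "(a ^^ m) v = (a ^^ (m - r)) ((a ^^ r) v)"
      using that by (metis comp_apply funpow_add le_add_diff_inverse2)
    then show ?thesis
      by (simp add: Q_def a linear_0[OF linp(1)] linear_0[OF linp(2)] linear_0[OF linp(3)])
  qed
  \<comment> \<open>One chain of the recursion: \<open>i + j\<close> is fixed to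
    \<open>r + 1\<close>, \<open>w\<close> is the value of \<open>j + m\<close>, and
    \<open>j\<close> counts the factors \<open>c\<close>. The two claims are
    \<open>E (r + 1) (r + 1) = 0\<close> and \<open>E r r = 0\<close>.\<close>
  define E where "E w j = Q (r + 1 - j) j (w - j)" for w j
  have recE: "E w j + (2 * (real w - real j)) *\<^sub>R E w (j + 1)
     + ((real w - real j) * (real w - real j - 1)) *\<^sub>R E w (j + 2) = 0" if "j < r" "j \<le> w" for w j
  proof -
    have "r + 1 - j = (r - 1 - j) + 2" "r + 1 - (j + 1) = (r - 1 - j) + 1" "r + 1 - (j + 2) = r - 1 - j"
      using that by simp_all
    then show ?thesis using rec[of "r - 1 - j" j "w - j"] that by (simp add: E_def of_nat_diff)
  qed
  \<comment> \<open>Both initial values of this chain contain at least \<open>r\<close> factors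
    \<open>a\<close>, and the coefficient of \<open>E (r + 1) (j + 2)\<close> is nonzero for all
    \<open>j < r\<close>.\<close>
  have "E (r + 1) j = 0 \<and> E (r + 1) (j + 1) = 0" if "j \<le> r" for j
    using that
  proof (induction j)
    case 0
    show ?case by (simp add: E_def Q0)
  next
    case (Suc j)
    then have "((real (r + 1) - real j) * (real (r + 1) - real j - 1)) *\<^sub>R E (r + 1) (j + 2) = 0"
      using recE[of j "r + 1"] by simp
    then show ?case using Suc by simp
  qed
  from this[of r] show "(c ^^ Suc r) v = 0" by (simp add: E_def Q_def)
  \<comment> \<open>On this chain only \<open>E r 0\<close> vanishes at the start, so the solutions
    form a one-parameter family. Its closed form is \<open>(-1)^(j+1) j (r-j)! / (r-1)!\<close>
    times \<open>E r 1\<close>; the denominator is cleared.\<close>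
  have step: "fact (r - 1) *\<^sub>R E r j = ((-1) ^ (j + 1) * real j * fact (r - j)) *\<^sub>R E r 1 \<and>
     fact (r - 1) *\<^sub>R E r (j + 1) = ((-1) ^ j * real (j + 1) * fact (r - (j + 1))) *\<^sub>R E r 1" if "j + 1 \<le> r" for j
    using that
  proof (induction j)
    case 0
    show ?case using r by (simp add: E_def Q0)
  next
    case (Suc j)
    let ?m = "real r - real j"
    have f1: "fact (r - j) = ?m * (?m - 1) * (fact (r - (j + 2)) :: real)"
    proof -
      have "r - j = Suc (Suc (r - (j + 2)))" using Suc.prems by simp
      then show ?thesis using Suc.prems by (simp add: of_nat_diff algebra_simps)
    qed
    have f2: "fact (r - (j + 1)) = (?m - 1) * (fact (r - (j + 2)) :: real)"
    proof -
      have "r - (j + 1) = Suc (r - (j + 2))" using Suc.prems by simp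
      then show ?thesis using Suc.prems by (simp add: of_nat_diff algebra_simps)
    qed
    have nz: "?m * (?m - 1) \<noteq> 0" using Suc.prems by auto
    have "fact (r - 1) *\<^sub>R ((?m * (?m - 1)) *\<^sub>R E r (j + 2)) =
       - (fact (r - 1) *\<^sub>R E r j) - (2 * ?m) *\<^sub>R (fact (r - 1) *\<^sub>R E r (j + 1))"
    proof -
      have "(?m * (?m - 1)) *\<^sub>R E r (j + 2) = - E r j - (2 * ?m) *\<^sub>R E r (j + 1)"
        using recE[of j r] Suc.prems by (simp add: eq_neg_iff_add_eq_0 algebra_simps)
      then show ?thesis by (simp only: scaleR_right_diff_distrib scaleR_minus_right scaleR_left_commute)
    qed
    also have "\<dots> = ((-1) ^ (j + 1) * real (j + 2) * (?m * (?m - 1) * fact (r - (j + 2)))) *\<^sub>R E r 1"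
      using Suc.IH Suc.prems unfolding f1 f2
      by (simp add: scaleR_left_diff_distrib[symmetric] scaleR_minus_left[symmetric] del: scaleR_minus_left)
         (simp add: algebra_simps)
    also have "\<dots> = (?m * (?m - 1)) *\<^sub>R (((-1) ^ (j + 1) * real (j + 2) * fact (r - (j + 2))) *\<^sub>R E r 1)"
      by (simp add: mult_ac)
    finally have "fact (r - 1) *\<^sub>R E r (j + 2) = ((-1) ^ (j + 1) * real (j + 2) * fact (r - (j + 2))) *\<^sub>R E r 1"
      using nz by (metis scaleR_left_commute scaleR_cancel_left)
    then show ?case using Suc by (simp del: fact_Suc)
  qed
  \<comment> \<open>At \<open>j = r - 1\<close> the coefficient of the last term of the recursion
    vanishes. What is left is the second boundary condition; the closed form makes it a nonzero
    multiple, by \<open>r + 1\<close> up to sign, of \<open>E r 1\<close>.\<close>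
  have 1: "E r (r - 1) + 2 *\<^sub>R E r r = 0" using recE[of "r - 1" r] r by (simp add: of_nat_diff)
  have "fact (r - 1) *\<^sub>R E r (r - 1) = ((-1) ^ r * (real r - 1)) *\<^sub>R E r 1"
       "fact (r - 1) *\<^sub>R E r r = ((-1) ^ (r - 1) * real r) *\<^sub>R E r 1"
    using step[of "r - 1"] r by (simp_all add: of_nat_diff)
  moreover have "(-1 :: real) ^ r = - ((-1) ^ (r - 1))" using r by (cases r) simp_all
  moreover have "fact (r - 1) *\<^sub>R (E r (r - 1) + 2 *\<^sub>R E r r) =
      fact (r - 1) *\<^sub>R E r (r - 1) + 2 *\<^sub>R (fact (r - 1) *\<^sub>R E r r)"
    by (simp add: scaleR_right_distrib)
  ultimately have "fact (r - 1) *\<^sub>R (E r (r - 1) + 2 *\<^sub>R E r r) =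
      (- ((-1) ^ (r - 1)) * (real r - 1) + 2 * ((-1) ^ (r - 1) * real r)) *\<^sub>R E r 1"
    by (simp only: scaleR_left_distrib scaleR_scaleR)
  also have "\<dots> = ((-1) ^ (r - 1) * (real r + 1)) *\<^sub>R E r 1"
    by (simp add: algebra_simps)
  finally have "fact (r - 1) *\<^sub>R (E r (r - 1) + 2 *\<^sub>R E r r) = \<dots>" .
  then have "E r 1 = 0" using 1 by simp
  then have "E r r = 0" using step[of "r - 1"] r by (simp)
  then show "b ((c ^^ r) v) = 0" by (simp add: E_def Q_def)
qed

text \<open>As \<open>b\<close> and \<open>c\<close> commute and \<open>b (b v) = 0\<close>, only
  two terms of the binomial expansion survive. They are the two vectors that
  \<open>nilpotency\<close> kills.\<close>

lemma add_scale_nilpotent: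
  assumes a: "(a ^^ r) v = 0" and bb: "b (b v) = 0" and r: "r \<ge> 1"
  shows "((\<lambda>x. c x + t *\<^sub>R b x) ^^ Suc r) v = 0"
proof -
  have "((\<lambda>x. c x + t *\<^sub>R b x) ^^ Suc m) v = (c ^^ Suc m) v + (real (Suc m) * t) *\<^sub>R b ((c ^^ m) v)" for m
  proof (induction m)
    case (Suc m)
    have "b (b ((c ^^ m) v)) = 0"
      by (simp add: bc_pow bb linear_0[OF linear_funpow[OF lin(3)]])
    then show ?case using Suc
      by (simp add: linear_add[OF lin(2)] linear_add[OF lin(3)] linear_scale[OF lin(2)] linear_scale[OF lin(3)] bc algebra_simps)
         (simp add: scaleR_2 scaleR_add_right flip: scaleR_scaleR)
  qed simp
  with nilpotency[OF assms] show ?thesis by (simp del: funpow.simps)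
qed

end

section \<open>The action of matrices on functions of block assignments\<close>

text \<open>
  An assignment \<open>\<beta>\<close> of blocks to the letters in \<open>S\<close> is a standard basis vector of \<open>(\<real>\<^sup>K)\<^bsup>\<otimes>S\<^esup>\<close>.
  With this order of indices \<open>gl_op S K\<close> maps commutators to commutators, without a change of sign.
\<close>

definition gl_op :: "'l set \<Rightarrow> nat \<Rightarrow> (nat \<Rightarrow> nat \<Rightarrow> real) \<Rightarrow> (('l \<Rightarrow> nat) \<Rightarrow> 'v) \<Rightarrow> ('l \<Rightarrow> nat) \<Rightarrow> 'v::real_vector" where
  "gl_op S K A g = (\<lambda>\<beta>. \<Sum>l\<in>S. \<Sum>j<K. A (\<beta> l) j *\<^sub>R g (\<beta>(l := j)))"

definition mat_unit :: "nat \<Rightarrow> nat \<Rightarrow> nat \<Rightarrow> nat \<Rightarrow> real" where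
  "mat_unit a b i j = (if i = a \<and> j = b then 1 else 0)"

lemma linear_gl_op: "linear (gl_op S K A)"
  by (rule linearI)
     (simp_all add: gl_op_def fun_eq_iff scaleR_add_right sum.distrib scaleR_sum_right mult_ac)

lemma gl_op_add: "gl_op S K (\<lambda>i j. A i j + t * B i j) g = gl_op S K A g + t *\<^sub>R gl_op S K B g"
  by (simp add: gl_op_def fun_eq_iff scaleR_add_left sum.distrib scaleR_sum_right)

text \<open>The two operators act either on the same letter, which gives the matrix product, or on
  different letters. Exchanging \<open>l\<close> and \<open>m\<close> exchanges \<open>A\<close> and
  \<open>B\<close> in the second part, so it cancels in a commutator.\<close>

lemma gl_op_gl_op:
  assumes "finite S"
  shows "gl_op S K A (gl_op S K B g) \<beta> = gl_op S K (\<lambda>i j. \<Sum>q<K. A i q * B q j) g \<beta> +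
    (\<Sum>l\<in>S. \<Sum>m\<in>S - {l}. \<Sum>i<K. \<Sum>j<K. (A (\<beta> l) i * B (\<beta> m) j) *\<^sub>R g (\<beta>(l := i, m := j)))"
proof -
  have "gl_op S K A (gl_op S K B g) \<beta> =
    (\<Sum>l\<in>S. \<Sum>i<K. A (\<beta> l) i *\<^sub>R (\<Sum>m\<in>S. \<Sum>j<K. B ((\<beta>(l := i)) m) j *\<^sub>R g (\<beta>(l := i, m := j))))"
    by (simp add: gl_op_def)
  also have "\<dots> = (\<Sum>l\<in>S. \<Sum>i<K. A (\<beta> l) i *\<^sub>R ((\<Sum>j<K. B i j *\<^sub>R g (\<beta>(l := j))) +
      (\<Sum>m\<in>S - {l}. \<Sum>j<K. B (\<beta> m) j *\<^sub>R g (\<beta>(l := i, m := j)))))"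
    by (intro sum.cong refl arg_cong2[of _ _ _ _ scaleR])
       (simp_all add: sum.remove[OF assms])
  also have "\<dots> = (\<Sum>l\<in>S. \<Sum>i<K. \<Sum>j<K. (A (\<beta> l) i * B i j) *\<^sub>R g (\<beta>(l := j))) +
     (\<Sum>l\<in>S. \<Sum>i<K. \<Sum>m\<in>S - {l}. \<Sum>j<K. (A (\<beta> l) i * B (\<beta> m) j) *\<^sub>R g (\<beta>(l := i, m := j)))"
    by (simp add: scaleR_add_right sum.distrib scaleR_sum_right)
  also have "(\<Sum>l\<in>S. \<Sum>i<K. \<Sum>j<K. (A (\<beta> l) i * B i j) *\<^sub>R g (\<beta>(l := j))) = gl_op S K (\<lambda>i j. \<Sum>q<K. A i q * B q j) g \<beta>"
    unfolding gl_op_def scaleR_sum_left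
    by (rule sum.cong[OF refl], rule sum.swap)
  also have "(\<Sum>l\<in>S. \<Sum>i<K. \<Sum>m\<in>S - {l}. \<Sum>j<K. (A (\<beta> l) i * B (\<beta> m) j) *\<^sub>R g (\<beta>(l := i, m := j))) =
    (\<Sum>l\<in>S. \<Sum>m\<in>S - {l}. \<Sum>i<K. \<Sum>j<K. (A (\<beta> l) i * B (\<beta> m) j) *\<^sub>R g (\<beta>(l := i, m := j)))"
    by (rule sum.cong[OF refl], rule sum.swap)
  finally show ?thesis .
qed

lemma gl_op_commute:
  assumes "finite S"
  shows "gl_op S K A (gl_op S K B g) = gl_op S K B (gl_op S K A g) +
    gl_op S K (\<lambda>i j. (\<Sum>q<K. A i q * B q j) - (\<Sum>q<K. B i q * A q j)) g"
proof
  fix \<beta> :: "'a \<Rightarrow> nat"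
  define X where "X A B = (\<Sum>l\<in>S. \<Sum>m\<in>S - {l}. \<Sum>i<K. \<Sum>j<K. (A (\<beta> l) i * B (\<beta> m) j) *\<^sub>R g (\<beta>(l := i, m := j)))"
    for A B :: "nat \<Rightarrow> nat \<Rightarrow> real"
  have "X A B = (\<Sum>m\<in>S. \<Sum>l\<in>S - {m}. \<Sum>i<K. \<Sum>j<K. (A (\<beta> l) i * B (\<beta> m) j) *\<^sub>R g (\<beta>(l := i, m := j)))"
  proof -
    have "{l. l \<in> S \<and> m \<in> S - {l}} = S - {m}" if "m \<in> S" for m using that by auto
    moreover have "{m \<in> S. l \<in> S \<and> l \<in> S - {m}} = S - {l}" if "l \<in> S" for l using that by auto
    moreover have "X A B = (\<Sum>l\<in>S. \<Sum>m\<in>{m \<in> S. l \<in> S \<and> l \<in> S - {m}}. \<Sum>i<K. \<Sum>j<K. (A (\<beta> l) i * B (\<beta> m) j) *\<^sub>R g (\<beta>(l := i, m := j)))"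
      unfolding X_def by (intro sum.cong refl) auto
    ultimately show ?thesis
      by (subst (asm) sum.swap_restrict[OF assms assms]) (auto intro!: sum.cong)
  qed
  also have "\<dots> = X B A"
    unfolding X_def
    by (rule sum.cong[OF refl], rule sum.cong[OF refl], subst sum.swap)
       (auto intro!: sum.cong simp: fun_upd_twist mult.commute)
  finally have X: "X A B = X B A" .
  have "gl_op S K (\<lambda>i j. (\<Sum>q<K. A i q * B q j) - (\<Sum>q<K. B i q * A q j)) g =
     gl_op S K (\<lambda>i j. (\<Sum>q<K. A i q * B q j)) g - gl_op S K (\<lambda>i j. (\<Sum>q<K. B i q * A q j)) g"
    using gl_op_add[of S K "\<lambda>i j. (\<Sum>q<K. A i q * B q j)" "-1" "\<lambda>i j. (\<Sum>q<K. B i q * A q j)" g]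
    by simp
  then show "gl_op S K A (gl_op S K B g) \<beta> = (gl_op S K B (gl_op S K A g) +
    gl_op S K (\<lambda>i j. (\<Sum>q<K. A i q * B q j) - (\<Sum>q<K. B i q * A q j)) g) \<beta>"
    using X gl_op_gl_op[OF assms, of K A B g \<beta>] gl_op_gl_op[OF assms, of K B A g \<beta>]
    by (simp add: X_def)
qed

section \<open>Matrix units, weights and sl2-triples\<close>

lemma gl_op_mat_unit:
  assumes "b < K" "finite S"
  shows "gl_op S K (mat_unit a b) g \<beta> = (\<Sum>l | l \<in> S \<and> \<beta> l = a. g (\<beta>(l := b)))"
proof -
  have "(\<Sum>j<K. mat_unit a b (\<beta> l) j *\<^sub>R g (\<beta>(l := j))) = (if \<beta> l = a then g (\<beta>(l := b)) else 0)" for l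
    using assms by (simp add: mat_unit_def if_distrib[of "\<lambda>x. x *\<^sub>R _"] sum.delta cong: if_cong)
  then have "gl_op S K (mat_unit a b) g \<beta> = (\<Sum>l\<in>S. if \<beta> l = a then g (\<beta>(l := b)) else 0)"
    by (simp add: gl_op_def)
  also have "\<dots> = (\<Sum>l | l \<in> S \<and> \<beta> l = a. g (\<beta>(l := b)))"
    using assms by (simp add: sum.inter_filter)
  finally show ?thesis .
qed

text \<open>The operator evaluates \<open>g\<close> after one letter of block \<open>a\<close> has
  been moved to block \<open>b\<close>; \<open>J\<close> applications would move more letters than
  block \<open>a\<close> contains.\<close>

lemma gl_op_mat_unit_nilpotent:
  assumes "b < K" "finite S" "a \<noteq> b" "card {l \<in> S. \<beta> l = a} < J"
  shows "(gl_op S K (mat_unit a b) ^^ J) g \<beta> = 0"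
  using assms(4)
proof (induction J arbitrary: \<beta>)
  case (Suc J)
  have "(gl_op S K (mat_unit a b) ^^ J) g (\<beta>(l := b)) = 0" if "l \<in> S" "\<beta> l = a" for l
  proof (rule Suc.IH)
    have "{m \<in> S. (\<beta>(l := b)) m = a} = {m \<in> S. \<beta> m = a} - {l}" using \<open>a \<noteq> b\<close> by auto
    moreover have "card {m \<in> S. \<beta> m = a} > 0" using that \<open>finite S\<close> by (auto simp: card_gt_0_iff)
    ultimately show "card {m \<in> S. (\<beta>(l := b)) m = a} < J" using Suc.prems that by simp
  qed
  then have "gl_op S K (mat_unit a b) ((gl_op S K (mat_unit a b) ^^ J) g) \<beta> = 0"
    unfolding gl_op_mat_unit[OF assms(1,2)] by (intro sum.neutral) simp
  then show ?case by simp
qed simp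

definition weight_diff :: "nat \<Rightarrow> nat \<Rightarrow> nat \<Rightarrow> nat \<Rightarrow> real" where
  "weight_diff a b i j = (if i = j then of_bool (i = a) - of_bool (i = b) else 0)"

lemma gl_op_weight_diff:
  assumes "a < K" "b < K" "a \<noteq> b" "finite S"
  shows "gl_op S K (weight_diff a b) g \<beta> =
    (real (card {l \<in> S. \<beta> l = a}) - real (card {l \<in> S. \<beta> l = b})) *\<^sub>R g \<beta>"
proof -
  have "(\<Sum>j<K. weight_diff a b (\<beta> l) j *\<^sub>R g (\<beta>(l := j))) = (of_bool (\<beta> l = a) - of_bool (\<beta> l = b)) *\<^sub>R g \<beta>" for l
  proof -
    have "(\<Sum>j<K. weight_diff a b (\<beta> l) j *\<^sub>R g (\<beta>(l := j))) =
       (\<Sum>j<K. if \<beta> l = j then (of_bool (\<beta> l = a) - of_bool (\<beta> l = b)) *\<^sub>R g (\<beta>(l := j)) else 0)"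
      by (intro sum.cong) (auto simp: weight_diff_def)
    also have "\<dots> = (if \<beta> l < K then (of_bool (\<beta> l = a) - of_bool (\<beta> l = b)) *\<^sub>R g \<beta> else 0)"
      by (subst sum.delta') auto
    finally show ?thesis using assms by auto
  qed
  then have "gl_op S K (weight_diff a b) g \<beta> = (\<Sum>l\<in>S. of_bool (\<beta> l = a) - of_bool (\<beta> l = b)) *\<^sub>R g \<beta>"
    by (simp add: gl_op_def scaleR_sum_left)
  moreover have "S \<inter> {l. \<beta> l = c} = {l \<in> S. \<beta> l = c}" for c by auto
  ultimately show ?thesis using assms(4) by (simp add: sum_subtractf sum_of_bool_eq)
qed

text \<open>The matrices \<open>mat_unit a b\<close>, \<open>mat_unit b a\<close> and
  \<open>weight_diff a b\<close> are the \<open>e\<close>, \<open>f\<close> and \<open>h\<close> of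
  \<open>sl2_lowering_injective\<close>.\<close>

lemma gl_op_sl2:
  assumes "a < K" "b < K" "a \<noteq> b" "finite S"
  shows "gl_op S K (mat_unit a b) (gl_op S K (mat_unit b a) x) =
      gl_op S K (mat_unit b a) (gl_op S K (mat_unit a b) x) + gl_op S K (weight_diff a b) x"
    and "gl_op S K (weight_diff a b) (gl_op S K (mat_unit a b) x) =
      gl_op S K (mat_unit a b) (gl_op S K (weight_diff a b) x) + 2 *\<^sub>R gl_op S K (mat_unit a b) x"
proof -
  have "(\<Sum>q<K. mat_unit a b i q * mat_unit b a q j) - (\<Sum>q<K. mat_unit b a i q * mat_unit a b q j) = weight_diff a b i j"
    for i j
  proof -
    have eqs: "(\<Sum>q<K. mat_unit a b i q * mat_unit b a q j) = (\<Sum>q<K. if q = b then of_bool (i = a \<and> j = a) else 0)"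
      "(\<Sum>q<K. mat_unit b a i q * mat_unit a b q j) = (\<Sum>q<K. if q = a then of_bool (i = b \<and> j = b) else 0)"
      by (rule sum.cong; use assms in \<open>auto simp: mat_unit_def\<close>)+
    show ?thesis unfolding eqs using assms by (auto simp: mat_unit_def weight_diff_def)
  qed
  then show "gl_op S K (mat_unit a b) (gl_op S K (mat_unit b a) x) =
      gl_op S K (mat_unit b a) (gl_op S K (mat_unit a b) x) + gl_op S K (weight_diff a b) x"
    by (subst gl_op_commute[OF \<open>finite S\<close>]) simp
  have "(\<Sum>q<K. weight_diff a b i q * mat_unit a b q j) - (\<Sum>q<K. mat_unit a b i q * weight_diff a b q j) = 0 + 2 * mat_unit a b i j"
    for i j
  proof -
    have eqs: "(\<Sum>q<K. weight_diff a b i q * mat_unit a b q j) = (\<Sum>q<K. if q = a then of_bool (i = a \<and> j = b) else 0)"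
      "(\<Sum>q<K. mat_unit a b i q * weight_diff a b q j) = (\<Sum>q<K. if q = b then - of_bool (i = a \<and> j = b) else 0)"
      by (rule sum.cong; use assms in \<open>auto simp: mat_unit_def weight_diff_def\<close>)+
    show ?thesis unfolding eqs using assms by (auto simp: mat_unit_def weight_diff_def)
  qed
  then have eq: "gl_op S K (\<lambda>i j. (\<Sum>q<K. weight_diff a b i q * mat_unit a b q j) - (\<Sum>q<K. mat_unit a b i q * weight_diff a b q j)) x
      = 2 *\<^sub>R gl_op S K (mat_unit a b) x"
    using gl_op_add[of S K "\<lambda>_ _. 0" 2 "mat_unit a b" x] by (simp add: gl_op_def fun_eq_iff)
  show "gl_op S K (weight_diff a b) (gl_op S K (mat_unit a b) x) =
      gl_op S K (mat_unit a b) (gl_op S K (weight_diff a b) x) + 2 *\<^sub>R gl_op S K (mat_unit a b) x"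
    by (subst gl_op_commute[OF \<open>finite S\<close>]) (simp only: eq)
qed

section \<open>The exchange of two blocks and its interplay with sl2\<close>

definition swap_op :: "nat \<Rightarrow> nat \<Rightarrow> (('l \<Rightarrow> nat) \<Rightarrow> 'v) \<Rightarrow> ('l \<Rightarrow> nat) \<Rightarrow> 'v" where
  "swap_op a b g = (\<lambda>\<beta>. g (transpose a b \<circ> \<beta>))"

lemma linear_swap_op: "linear (swap_op a b :: (('l \<Rightarrow> nat) \<Rightarrow> 'v::real_vector) \<Rightarrow> _)"
  by (rule linearI) (simp_all add: swap_op_def fun_eq_iff)

lemma swap_op_idem: "swap_op a b (swap_op a b g) = g"
  by (simp add: swap_op_def flip: comp_assoc)

text \<open>The exchange of the two blocks is the Weyl reflection of the triple: conjugation by it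
  interchanges raising and lowering.\<close>

lemma swap_op_gl_op:
  assumes "a < K" "b < K" "finite S"
  shows "swap_op a b (gl_op S K (mat_unit a b) g) = gl_op S K (mat_unit b a) (swap_op a b g)"
proof
  fix \<beta> :: "'a \<Rightarrow> nat"
  have "{l. l \<in> S \<and> transpose a b (\<beta> l) = a} = {l. l \<in> S \<and> \<beta> l = b}"
    by (auto simp: transpose_def split: if_splits)
  moreover have "(transpose a b \<circ> \<beta>)(l := b) = transpose a b \<circ> \<beta>(l := a)" for l
    by (auto simp: fun_eq_iff)
  ultimately show "swap_op a b (gl_op S K (mat_unit a b) g) \<beta> = gl_op S K (mat_unit b a) (swap_op a b g) \<beta>"
    using assms by (simp add: swap_op_def gl_op_mat_unit)
qed

lemma gl_op_lowering_injective:
  assumes "a < K" "b < K" "a \<noteq> b" "finite S" and \<mu>: "\<mu> > 0"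
    and w: "gl_op S K (weight_diff a b) w = \<mu> *\<^sub>R w" and f: "gl_op S K (mat_unit b a) w = 0"
  shows "w = 0"
proof (rule sl2_lowering_injective[OF linear_gl_op linear_gl_op linear_gl_op, where \<mu> = \<mu> and J = "Suc (card S)"])
  \<comment> \<open>One exponent has to serve all \<beta> at once; no block holds more than
    \<open>card S\<close> letters.\<close>
  show "(gl_op S K (mat_unit a b) ^^ Suc (card S)) w = 0"
  proof
    fix \<beta>
    have "card {l \<in> S. \<beta> l = a} < Suc (card S)" using \<open>finite S\<close> by (simp add: card_mono less_Suc_eq_le)
    then show "(gl_op S K (mat_unit a b) ^^ Suc (card S)) w \<beta> = 0 \<beta>"
      using gl_op_mat_unit_nilpotent[of b K S a \<beta> "Suc (card S)" w] assms by (simp del: funpow.simps)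
  qed
qed (use assms gl_op_sl2 in auto)

text \<open>
  With \<open>e\<close>, \<open>f\<close>, \<open>s\<close> as in the proof, \<open>f e\<close> commutes with \<open>s\<close> in weight 0, so the hypothesis squares to
  \<open>f e f e g = 2 f e g\<close>. Since \<open>e g\<close> has weight 2, this says \<open>f f e e g = 0\<close>.
\<close>

lemma raising_squared_zero:
  assumes ab: "a < K" "b < K" "a \<noteq> b" "finite S"
    and h: "gl_op S K (weight_diff a b) g = 0"
    and \<sigma>: "\<sigma> * \<sigma> = 1"
    and rel: "gl_op S K (mat_unit b a) (gl_op S K (mat_unit a b) g) = g - \<sigma> *\<^sub>R swap_op a b g"
  shows "gl_op S K (mat_unit a b) (gl_op S K (mat_unit a b) g) = 0"
proof -
  let ?e = "gl_op S K (mat_unit a b) :: (('a \<Rightarrow> nat) \<Rightarrow> 'b) \<Rightarrow> _" and ?f = "gl_op S K (mat_unit b a) :: (('a \<Rightarrow> nat) \<Rightarrow> 'b) \<Rightarrow> _"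
    and ?h = "gl_op S K (weight_diff a b) :: (('a \<Rightarrow> nat) \<Rightarrow> 'b) \<Rightarrow> _" and ?s = "swap_op a b :: (('a \<Rightarrow> nat) \<Rightarrow> 'b) \<Rightarrow> _"
  note lin = linear_add[OF linear_gl_op] linear_diff[OF linear_gl_op] linear_scale[OF linear_gl_op] linear_0[OF linear_gl_op]
    linear_add[OF linear_swap_op] linear_diff[OF linear_swap_op] linear_scale[OF linear_swap_op] linear_0[OF linear_swap_op]
  have se: "?s (?e x) = ?f (?s x)" for x using swap_op_gl_op[OF ab(1,2,4)] .
  have es: "?e (?s x) = ?s (?f x)" for x
    by (metis se swap_op_idem)
  have ef: "?e (?f g) = ?f (?e g)" using gl_op_sl2(1)[OF ab, of g] h by simp
  have "?f (?e (?s g)) = ?s (?f (?e g))" by (simp add: es ef flip: se)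
  then have "?f (?e (?f (?e g))) = ?f (?e g) - \<sigma> *\<^sub>R ?s (?f (?e g))"
    by (subst rel) (simp only: lin)
  also have "\<sigma> *\<^sub>R ?s (?f (?e g)) = \<sigma> *\<^sub>R ?s g - g"
    unfolding rel by (simp add: lin swap_op_idem scaleR_diff_right \<sigma>)
  also have "?f (?e g) - (\<sigma> *\<^sub>R ?s g - g) = 2 *\<^sub>R ?f (?e g)"
    unfolding rel by (simp add: scaleR_2)
  finally have fefe: "?f (?e (?f (?e g))) = 2 *\<^sub>R ?f (?e g)" .
  have he: "?h (?e g) = 2 *\<^sub>R ?e g" using gl_op_sl2(2)[OF ab, of g] h by (simp add: lin)
  have "?f (?e (?f (?e g))) = ?f (?f (?e (?e g))) + 2 *\<^sub>R ?f (?e g)"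
    using gl_op_sl2(1)[OF ab, of "?e g"] he by (simp add: lin)
  then have ffee: "?f (?f (?e (?e g))) = 0" using fefe by simp
  have hee: "?h (?e (?e g)) = 4 *\<^sub>R ?e (?e g)" using gl_op_sl2(2)[OF ab, of "?e g"] he by (simp add: lin flip: scaleR_add_left)
  have hf: "?h (?f x) = ?f (?h x) - 2 *\<^sub>R ?f x" for x
  proof -
    have n: "weight_diff a b = (\<lambda>i j. 0 + (-1) * weight_diff b a i j)" by (auto simp: weight_diff_def fun_eq_iff)
    have "?h y = - gl_op S K (weight_diff b a) y" for y
      by (subst n, subst gl_op_add) (simp add: gl_op_def fun_eq_iff)
    then show ?thesis using gl_op_sl2(2)[OF ab(2,1) _ ab(4), of x] ab by (simp add: linear_neg[OF linear_gl_op])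
  qed
  have hfee: "?h (?f (?e (?e g))) = 2 *\<^sub>R ?f (?e (?e g))"
    by (simp add: hf hee lin flip: scaleR_diff_left)
  \<comment> \<open>The two lowering operators in \<open>ffee\<close> are now cancelled one at a
    time: the vectors to which they are applied, \<open>f (e (e g))\<close> and
    \<open>e (e g)\<close>, have the positive weights 2 and 4.\<close>
  have "?f (?e (?e g)) = 0"
    using gl_op_lowering_injective[OF ab _ hfee ffee] by simp
  then show ?thesis using gl_op_lowering_injective[OF ab _ hee] by simp
qed

text \<open>With \<open>e\<close>, \<open>f\<close>, \<open>h\<close>, \<open>s\<close> as in the
  proof, the relation says \<open>f g = \<sigma> s g\<close>. Since \<open>e s = s f\<close>, this
  gives \<open>e (f g) = \<sigma> s (f g) = g\<close>, which equals \<open>h g\<close>, so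
  \<open>f (e g) = 0\<close>. But \<open>e g\<close> has weight 3 and must then vanish.\<close>

lemma raising_zero:
  assumes ab: "a < K" "b < K" "a \<noteq> b" "finite S"
    and h: "gl_op S K (weight_diff a b) g = g"
    and \<sigma>: "\<sigma> * \<sigma> = 1"
    and rel: "g = \<sigma> *\<^sub>R swap_op a b (gl_op S K (mat_unit b a) g)"
  shows "gl_op S K (mat_unit a b) g = 0"
proof -
  let ?e = "gl_op S K (mat_unit a b) :: (('a \<Rightarrow> nat) \<Rightarrow> 'b) \<Rightarrow> _" and ?f = "gl_op S K (mat_unit b a) :: (('a \<Rightarrow> nat) \<Rightarrow> 'b) \<Rightarrow> _"
    and ?h = "gl_op S K (weight_diff a b) :: (('a \<Rightarrow> nat) \<Rightarrow> 'b) \<Rightarrow> _" and ?s = "swap_op a b :: (('a \<Rightarrow> nat) \<Rightarrow> 'b) \<Rightarrow> _"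
  note lin = linear_add[OF linear_gl_op] linear_diff[OF linear_gl_op] linear_scale[OF linear_gl_op] linear_0[OF linear_gl_op]
    linear_add[OF linear_swap_op] linear_diff[OF linear_swap_op] linear_scale[OF linear_swap_op] linear_0[OF linear_swap_op]
  have se: "?s (?e x) = ?f (?s x)" for x using swap_op_gl_op[OF ab(1,2,4)] .
  have es: "?e (?s x) = ?s (?f x)" for x
    by (metis se swap_op_idem)
  have "?s g = \<sigma> *\<^sub>R ?f g" by (subst rel) (simp add: lin swap_op_idem)
  then have fg: "?f g = \<sigma> *\<^sub>R ?s g" by (simp add: \<sigma>)
  have "?e (?f g) = \<sigma> *\<^sub>R ?s (?f g)"
    by (subst fg) (simp only: lin es)
  then have "?e (?f g) = g" using rel by simp
  then have "?f (?e g) = 0" using gl_op_sl2(1)[OF ab, of g] h by simp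
  moreover have "?h (?e g) = 3 *\<^sub>R ?e g"
  proof -
    have "?h (?e g) = 1 *\<^sub>R ?e g + 2 *\<^sub>R ?e g" using gl_op_sl2(2)[OF ab, of g] h by simp
    then show ?thesis by (simp only: flip: scaleR_add_left) simp
  qed
  ultimately show ?thesis using gl_op_lowering_injective[OF ab, of 3] by simp
qed

section \<open>Nilpotency of generic combinations of the matrix units in one column\<close>

definition row_mat :: "(nat \<Rightarrow> real) \<Rightarrow> nat \<Rightarrow> nat \<Rightarrow> nat \<Rightarrow> nat \<Rightarrow> real" where
  "row_mat \<alpha> q c i j = (if i < q \<and> j = c then \<alpha> i else 0)"

text \<open>The induction step is a Heisenberg triple: \<open>a\<close> is the combination for
  column \<open>q\<close>, \<open>b\<close> is the matrix unit \<open>E_q(q+1)\<close>, and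
  \<open>c\<close> is the combination with the same coefficients for column \<open>q + 1\<close>.
  The next operator is \<open>c + \<alpha> q b\<close>. Leaving \<alpha> arbitrary packs all
  products of the commuting matrix units into a single power.\<close>

lemma row_mat_nilpotent:
  fixes g :: "('l \<Rightarrow> nat) \<Rightarrow> 'v::real_vector"
  assumes "finite S"
    and e0: "gl_op S K (mat_unit 0 1) g = 0"
    and ee: "\<And>i. 1 \<le> i \<Longrightarrow> Suc i < K \<Longrightarrow> gl_op S K (mat_unit i (Suc i)) (gl_op S K (mat_unit i (Suc i)) g) = 0"
    and "1 \<le> q" "q < K"
  shows "(gl_op S K (row_mat \<alpha> q q) ^^ q) g = 0"
  using assms(4,5)
proof (induction q rule: nat_induct_at_least)
  case base
  have "row_mat \<alpha> 1 1 = (\<lambda>i j. 0 + \<alpha> 0 * mat_unit 0 1 i j)"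
    by (auto simp: row_mat_def mat_unit_def fun_eq_iff)
  then have "gl_op S K (row_mat \<alpha> 1 1) g = gl_op S K (\<lambda>_ _. 0) g + \<alpha> 0 *\<^sub>R gl_op S K (mat_unit 0 1) g"
    by (simp only: gl_op_add)
  then show ?case using e0 by (simp add: gl_op_def fun_eq_iff)
next
  case (Suc q)
  define a where "a = (gl_op S K (row_mat \<alpha> q q) :: (('l \<Rightarrow> nat) \<Rightarrow> 'v) \<Rightarrow> _)"
  define b where "b = (gl_op S K (mat_unit q (Suc q)) :: (('l \<Rightarrow> nat) \<Rightarrow> 'v) \<Rightarrow> _)"
  define c where "c = (gl_op S K (row_mat \<alpha> q (Suc q)) :: (('l \<Rightarrow> nat) \<Rightarrow> 'v) \<Rightarrow> _)"
  interpret heisenberg a b c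
  proof (rule heisenberg.intro)
    show "linear a" "linear b" "linear c" by (simp_all add: a_def b_def c_def linear_gl_op)
    fix x
    have "(\<Sum>r<K. row_mat \<alpha> q q i r * mat_unit q (Suc q) r j) - (\<Sum>r<K. mat_unit q (Suc q) i r * row_mat \<alpha> q q r j) = row_mat \<alpha> q (Suc q) i j"
      for i j
    proof -
      have "(\<Sum>r<K. row_mat \<alpha> q q i r * mat_unit q (Suc q) r j) = (\<Sum>r<K. if r = q then row_mat \<alpha> q (Suc q) i j else 0)"
        by (intro sum.cong) (auto simp: row_mat_def mat_unit_def)
      moreover have "(\<Sum>r<K. mat_unit q (Suc q) i r * row_mat \<alpha> q q r j) = 0"
        by (intro sum.neutral) (auto simp: row_mat_def mat_unit_def)
      ultimately show ?thesis using Suc.prems by simp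
    qed
    then show "a (b x) = b (a x) + c x"
      unfolding a_def b_def c_def by (subst gl_op_commute[OF \<open>finite S\<close>]) simp
    have "(\<Sum>r<K. row_mat \<alpha> q q i r * row_mat \<alpha> q (Suc q) r j) - (\<Sum>r<K. row_mat \<alpha> q (Suc q) i r * row_mat \<alpha> q q r j) = 0"
      for i j
    proof -
      have "(\<Sum>r<K. row_mat \<alpha> q q i r * row_mat \<alpha> q (Suc q) r j) = 0" "(\<Sum>r<K. row_mat \<alpha> q (Suc q) i r * row_mat \<alpha> q q r j) = 0"
        by (intro sum.neutral; auto simp: row_mat_def)+
      then show ?thesis by simp
    qed
    then show "a (c x) = c (a x)"
      unfolding a_def c_def by (subst gl_op_commute[OF \<open>finite S\<close>]) (simp add: gl_op_def fun_eq_iff)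
    have "(\<Sum>r<K. mat_unit q (Suc q) i r * row_mat \<alpha> q (Suc q) r j) - (\<Sum>r<K. row_mat \<alpha> q (Suc q) i r * mat_unit q (Suc q) r j) = 0"
      for i j
    proof -
      have "(\<Sum>r<K. mat_unit q (Suc q) i r * row_mat \<alpha> q (Suc q) r j) = 0" "(\<Sum>r<K. row_mat \<alpha> q (Suc q) i r * mat_unit q (Suc q) r j) = 0"
        by (intro sum.neutral; auto simp: row_mat_def mat_unit_def)+
      then show ?thesis by simp
    qed
    then show "b (c x) = c (b x)"
      unfolding b_def c_def by (subst gl_op_commute[OF \<open>finite S\<close>]) (simp add: gl_op_def fun_eq_iff)
  qed
  have "row_mat \<alpha> (Suc q) (Suc q) = (\<lambda>i j. row_mat \<alpha> q (Suc q) i j + \<alpha> q * mat_unit q (Suc q) i j)"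
    by (auto simp: row_mat_def mat_unit_def fun_eq_iff)
  then have op: "gl_op S K (row_mat \<alpha> (Suc q) (Suc q)) = (\<lambda>x. c x + \<alpha> q *\<^sub>R b x)"
    unfolding b_def c_def by (intro ext[where 'a = "('l \<Rightarrow> nat) \<Rightarrow> 'v"]) (simp only: gl_op_add)
  have "q < K" using Suc.prems by simp
  then have a: "(a ^^ q) g = 0" using Suc.IH unfolding a_def by blast
  have bb: "b (b g) = 0" using ee[of q] Suc.hyps Suc.prems unfolding b_def by blast
  show ?case unfolding op by (rule add_scale_nilpotent[OF a bb Suc.hyps])
qed

section \<open>Vanishing for few colours\<close>

text \<open>A polynomial that vanishes at every real number has too many roots to be nonzero.
  Several \<open>a\<close> may share an exponent, so only the sum of their \<open>x a\<close> is
  recovered.\<close>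

lemma polyfun_zero_coeff:
  fixes x :: "'a \<Rightarrow> complex" and r :: "'a \<Rightarrow> nat"
  assumes "finite A" and "\<And>t::real. (\<Sum>a\<in>A. t ^ r a *\<^sub>R x a) = 0"
  shows "(\<Sum>a | a \<in> A \<and> r a = k. x a) = 0"
proof (rule ccontr)
  define c where "c m = (\<Sum>a | a \<in> A \<and> r a = m. x a)" for m
  define n where "n = Max (insert k (r ` A))"
  have n: "k \<le> n" "\<And>a. a \<in> A \<Longrightarrow> r a \<le> n" using assms(1) by (auto simp: n_def)
  assume "\<not> ?thesis"
  then have "finite {z. (\<Sum>i\<le>n. c i * z ^ i) = 0}"
    using polyfun_rootbound[of c k n] n by (simp add: c_def)
  moreover have "range complex_of_real \<subseteq> {z. (\<Sum>i\<le>n. c i * z ^ i) = 0}"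
  proof clarify
    fix t :: real
    have "(\<Sum>i\<le>n. c i * of_real t ^ i) = (\<Sum>i\<le>n. \<Sum>a | a \<in> A \<and> r a = i. t ^ r a *\<^sub>R x a)"
      by (auto simp: c_def sum_distrib_left scaleR_conv_of_real mult.commute intro!: sum.cong)
    also have "\<dots> = (\<Sum>a\<in>A. t ^ r a *\<^sub>R x a)"
      using n(2) by (intro sum.group assms(1)) auto
    finally show "(\<Sum>i\<le>n. c i * of_real t ^ i) = 0" using assms(2) by simp
  qed
  ultimately have "finite (range complex_of_real)" by (rule rev_finite_subset)
  then show False
    using finite_imageD[of complex_of_real UNIV] infinite_UNIV_char_0 by (auto simp: inj_on_def)
qed

text \<open>The last variable is eliminated first, with the monomials in the others absorbed into
  \<open>x\<close>.\<close>

lemma multivariate_polyfun_zero_coeff: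
  fixes x :: "'a \<Rightarrow> complex" and r :: "'a \<Rightarrow> nat \<Rightarrow> nat"
  assumes "finite A" and "\<And>\<alpha>. (\<Sum>a\<in>A. (\<Prod>i<q. \<alpha> i ^ r a i) *\<^sub>R x a) = 0"
  shows "(\<Sum>a | a \<in> A \<and> (\<forall>i<q. r a i = \<rho> i). x a) = 0"
  using assms
proof (induction q arbitrary: A)
  case (Suc q)
  have "(\<Sum>a | a \<in> {a \<in> A. r a q = \<rho> q} \<and> (\<forall>i<q. r a i = \<rho> i). x a) = 0"
  proof (rule Suc.IH)
    fix \<alpha> :: "nat \<Rightarrow> real"
    have "(\<Sum>a\<in>A. t ^ r a q *\<^sub>R ((\<Prod>i<q. \<alpha> i ^ r a i) *\<^sub>R x a)) = 0" for t
      using Suc.prems(2)[of "\<alpha>(q := t)"] by (simp add: mult.commute)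
    from polyfun_zero_coeff[OF Suc.prems(1) this]
    show "(\<Sum>a | a \<in> A \<and> r a q = \<rho> q. (\<Prod>i<q. \<alpha> i ^ r a i) *\<^sub>R x a) = 0" .
  qed (use Suc.prems in auto)
  moreover have "{a. a \<in> {a \<in> A. r a q = \<rho> q} \<and> (\<forall>i<q. r a i = \<rho> i)} = {a. a \<in> A \<and> (\<forall>i<Suc q. r a i = \<rho> i)}"
    by (auto simp: less_Suc_eq)
  ultimately show ?case by simp
qed simp

lemma sum_insert_double_count:
  fixes \<phi> :: "'a set \<Rightarrow> 'v::real_vector"
  assumes "finite S"
  shows "(\<Sum>l\<in>S. \<Sum>L | L \<subseteq> S \<and> card L = m \<and> l \<notin> L. \<phi> (insert l L)) = real (Suc m) *\<^sub>R (\<Sum>L | L \<subseteq> S \<and> card L = Suc m. \<phi> L)"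
proof -
  have fin: "finite L" if "L \<subseteq> S" for L using that assms finite_subset by blast
  have "(\<Sum>l\<in>S. \<Sum>L | L \<subseteq> S \<and> card L = m \<and> l \<notin> L. \<phi> (insert l L)) =
     (\<Sum>(l, L)\<in>(SIGMA l:S. {L. L \<subseteq> S \<and> card L = m \<and> l \<notin> L}). \<phi> (insert l L))"
    by (rule sum.Sigma) (use assms in auto)
  also have "\<dots> = (\<Sum>(L, l)\<in>(SIGMA L:{L. L \<subseteq> S \<and> card L = Suc m}. L). \<phi> L)"
    by (rule sum.reindex_bij_witness[where i = "\<lambda>(L, l). (l, L - {l})" and j = "\<lambda>(l, L). (insert l L, l)"])
       (auto simp: fin insert_absorb)
  also have "\<dots> = (\<Sum>L | L \<subseteq> S \<and> card L = Suc m. \<Sum>l\<in>L. \<phi> L)"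
    by (rule sum.Sigma[symmetric]) (use assms fin in auto)
  also have "\<dots> = real (Suc m) *\<^sub>R (\<Sum>L | L \<subseteq> S \<and> card L = Suc m. \<phi> L)"
    by (simp add: scaleR_sum_right sum_constant_scaleR)
  finally show ?thesis .
qed

text \<open>Each factor recolours one letter by \<open>q\<close>, and a letter of colour
  \<open>q\<close> has weight 0, so no letter is chosen twice. There remain the sets of
  \<open>m\<close> letters, each reached in \<open>m!\<close> orders.\<close>

lemma gl_op_row_mat_pow:
  fixes g :: "('l \<Rightarrow> nat) \<Rightarrow> 'v::real_vector"
  assumes "finite S" "q < K"
  shows "(gl_op S K (row_mat \<alpha> q q) ^^ m) g \<beta> =
    fact m *\<^sub>R (\<Sum>L | L \<subseteq> S \<and> card L = m. (\<Prod>l\<in>L. if \<beta> l < q then \<alpha> (\<beta> l) else 0) *\<^sub>R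
      g (\<lambda>l. if l \<in> L then q else \<beta> l))"
proof (induction m arbitrary: \<beta>)
  case 0
  have "{L. L \<subseteq> S \<and> card L = 0} = {{}}" using assms(1) finite_subset by fastforce
  then show ?case by simp
next
  case (Suc m)
  define w where "w i = (if i < q then \<alpha> i else 0)" for i
  let ?g = "\<lambda>\<beta> L. g (\<lambda>l. if l \<in> L then q else \<beta> l)"
  have op: "gl_op S K (row_mat \<alpha> q q) h \<beta> = (\<Sum>l\<in>S. w (\<beta> l) *\<^sub>R h (\<beta>(l := q)))" for h :: "('l \<Rightarrow> nat) \<Rightarrow> 'v"
  proof -
    have "(\<Sum>j<K. row_mat \<alpha> q q (\<beta> l) j *\<^sub>R h (\<beta>(l := j))) = (\<Sum>j<K. if j = q then w (\<beta> l) *\<^sub>R h (\<beta>(l := q)) else 0)" for l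
      by (intro sum.cong) (auto simp: row_mat_def w_def)
    then show ?thesis using \<open>q < K\<close> by (simp add: gl_op_def)
  qed
  have inner: "(\<Sum>L | L \<subseteq> S \<and> card L = m. (\<Prod>m\<in>L. w ((\<beta>(l := q)) m)) *\<^sub>R ?g (\<beta>(l := q)) L) =
     (\<Sum>L | L \<subseteq> S \<and> card L = m \<and> l \<notin> L. (\<Prod>m\<in>L. w (\<beta> m)) *\<^sub>R ?g \<beta> (insert l L))" for l
  proof -
    have "(\<Sum>L | L \<subseteq> S \<and> card L = m. (\<Prod>m\<in>L. w ((\<beta>(l := q)) m)) *\<^sub>R ?g (\<beta>(l := q)) L) =
     (\<Sum>L | L \<subseteq> S \<and> card L = m \<and> l \<notin> L. (\<Prod>m\<in>L. w ((\<beta>(l := q)) m)) *\<^sub>R ?g (\<beta>(l := q)) L)"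
    proof (rule sum.mono_neutral_right)
      show "\<forall>L\<in>{L. L \<subseteq> S \<and> card L = m} - {L. L \<subseteq> S \<and> card L = m \<and> l \<notin> L}.
         (\<Prod>m\<in>L. w ((\<beta>(l := q)) m)) *\<^sub>R ?g (\<beta>(l := q)) L = 0"
      proof
        fix L assume L: "L \<in> {L. L \<subseteq> S \<and> card L = m} - {L. L \<subseteq> S \<and> card L = m \<and> l \<notin> L}"
        then have "finite L" "l \<in> L" using assms(1) finite_subset by auto
        then have "(\<Prod>m\<in>L. w ((\<beta>(l := q)) m)) = 0" by (intro prod_zero) (auto simp: w_def)
        then show "(\<Prod>m\<in>L. w ((\<beta>(l := q)) m)) *\<^sub>R ?g (\<beta>(l := q)) L = 0" by simp
      qed
    qed (use assms in auto)
    also have "\<dots> = (\<Sum>L | L \<subseteq> S \<and> card L = m \<and> l \<notin> L. (\<Prod>m\<in>L. w (\<beta> m)) *\<^sub>R ?g \<beta> (insert l L))"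
      by (intro sum.cong arg_cong2[of _ _ _ _ scaleR] prod.cong arg_cong[of _ _ g]) auto
    finally show ?thesis .
  qed
  have "(gl_op S K (row_mat \<alpha> q q) ^^ Suc m) g \<beta> = (\<Sum>l\<in>S. w (\<beta> l) *\<^sub>R (fact m *\<^sub>R
     (\<Sum>L | L \<subseteq> S \<and> card L = m \<and> l \<notin> L. (\<Prod>m\<in>L. w (\<beta> m)) *\<^sub>R ?g \<beta> (insert l L))))"
    by (simp only: funpow.simps comp_apply op Suc.IH flip: w_def inner)
  also have "\<dots> = fact m *\<^sub>R (\<Sum>l\<in>S. \<Sum>L | L \<subseteq> S \<and> card L = m \<and> l \<notin> L. (\<Prod>m\<in>insert l L. w (\<beta> m)) *\<^sub>R ?g \<beta> (insert l L))"
    unfolding scaleR_sum_right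
    using finite_subset[OF _ assms(1)] by (intro sum.cong refl) (auto simp: mult_ac)
  also have "\<dots> = fact (Suc m) *\<^sub>R (\<Sum>L | L \<subseteq> S \<and> card L = Suc m. (\<Prod>m\<in>L. w (\<beta> m)) *\<^sub>R ?g \<beta> L)"
    by (subst sum_insert_double_count[OF assms(1)]) (simp add: mult.commute)
  finally show ?case by (simp only: w_def)
qed

text \<open>
  Downward induction on the number of letters \<open>l\<close> with \<open>\<beta> l = \<gamma> l\<close>. Recolour the letters of block \<open>q\<close> by \<open>\<gamma>\<close>
  and expand the vanishing of the \<open>p\<close>-th power there: all terms have at least as many such
  letters as \<open>\<beta>\<close>, and those with equally many agree with \<open>\<beta>\<close> up to a permutation preserving \<open>\<gamma>\<close>.
\<close>

lemma few_colours_vanish: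
  fixes g :: "('l \<Rightarrow> nat) \<Rightarrow> complex"
  assumes "finite S" "q < K"
    and supp: "\<And>\<beta>. g \<beta> \<noteq> 0 \<Longrightarrow> (\<forall>l\<in>S. \<beta> l \<le> q) \<and> card {l \<in> S. \<beta> l = q} = p"
    and loc: "\<And>\<beta> \<beta>'. (\<And>l. l \<in> S \<Longrightarrow> \<beta> l = \<beta>' l) \<Longrightarrow> g \<beta> = g \<beta>'"
    and nil: "\<And>\<alpha>. (gl_op S K (row_mat \<alpha> q q) ^^ p) g = 0"
    and \<gamma>: "\<And>l. l \<in> S \<Longrightarrow> \<gamma> l < q"
    and sym: "\<And>\<sigma> \<beta>. \<sigma> permutes S \<Longrightarrow> (\<And>l. l \<in> S \<Longrightarrow> \<gamma> (\<sigma> l) = \<gamma> l) \<Longrightarrow> g (\<beta> \<circ> \<sigma>) = g \<beta>"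
  shows "g \<beta> = 0"
proof (induction "card S - card {l \<in> S. \<beta> l = \<gamma> l}" arbitrary: \<beta> rule: less_induct)
  case less
  note IH = less.hyps
  show ?case
  proof (rule ccontr)
    assume g: "g \<beta> \<noteq> 0"
    define L0 where "L0 = {l \<in> S. \<beta> l = q}"
    define b where "b l = (if l \<in> L0 then \<gamma> l else \<beta> l)" for l
    \<comment> \<open>\<open>r L\<close> is the exponent vector of the monomial in \<alpha> that
      belongs to refilling block \<open>q\<close> with the letters of \<open>L\<close>. Comparing
      coefficients retains the sets with the exponents of \<open>L0\<close>, whose refilling
      \<open>ov L0\<close> is \<beta> itself.\<close>
    define r where "r L i = card {l \<in> L. b l = i}" for L i
    define ov where "ov L l = (if l \<in> L then q else b l)" for L l
    define D where "D = {l \<in> S. b l = \<gamma> l}"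
    have \<beta>: "\<beta> l \<le> q" if "l \<in> S" for l using supp[OF g] that by auto
    have L0: "L0 \<subseteq> S" "card L0 = p" "L0 \<subseteq> D" using supp[OF g] by (auto simp: L0_def D_def b_def)
    have b: "b l < q" if "l \<in> S" for l
      using that \<beta>[OF that] \<gamma>[OF that] by (auto simp: b_def L0_def less_le)
    have ne: "\<gamma> l \<noteq> q" "q \<noteq> \<gamma> l" "b l \<noteq> q" if "l \<in> S" for l using \<gamma>[OF that] b[OF that] by auto
    have fin: "finite L" if "L \<subseteq> S" for L using that \<open>finite S\<close> finite_subset by blast
    have finD: "finite D" "D \<subseteq> S" using \<open>finite S\<close> by (auto simp: D_def)
    have "(\<Sum>L | L \<subseteq> S \<and> card L = p. (\<Prod>i<q. \<alpha> i ^ r L i) *\<^sub>R g (ov L)) = 0" for \<alpha>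
    proof -
      have "(\<Prod>l\<in>L. if b l < q then \<alpha> (b l) else 0) = (\<Prod>i<q. \<alpha> i ^ r L i)" if "L \<subseteq> S" for L
      proof -
        have "(\<Prod>l\<in>L. if b l < q then \<alpha> (b l) else 0) = (\<Prod>l\<in>L. \<alpha> (b l))"
          using b that by (intro prod.cong) auto
        also have "\<dots> = (\<Prod>i<q. \<Prod>l | l \<in> L \<and> b l = i. \<alpha> (b l))"
          using b that fin by (intro prod.group[symmetric]) auto
        also have "\<dots> = (\<Prod>i<q. \<alpha> i ^ r L i)"
          by (intro prod.cong) (auto simp: r_def)
        finally show ?thesis .
      qed
      then have "(\<Sum>L | L \<subseteq> S \<and> card L = p. (\<Prod>i<q. \<alpha> i ^ r L i) *\<^sub>R g (ov L)) =
        (\<Sum>L | L \<subseteq> S \<and> card L = p. (\<Prod>l\<in>L. if b l < q then \<alpha> (b l) else 0) *\<^sub>R g (\<lambda>l. if l \<in> L then q else b l))"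
        by (intro sum.cong) (auto simp: ov_def[abs_def])
      then show ?thesis
        using nil[of \<alpha>] gl_op_row_mat_pow[OF assms(1,2), where \<alpha> = \<alpha> and m = p and g = g and \<beta> = b] by (simp add: fun_eq_iff)
    qed
    from multivariate_polyfun_zero_coeff[OF _ this, of "r L0"]
    have sum0: "(\<Sum>L | L \<in> {L. L \<subseteq> S \<and> card L = p} \<and> (\<forall>i<q. r L i = r L0 i). g (ov L)) = 0"
      using \<open>finite S\<close> by simp
    have one: "g (ov L) = (if L \<subseteq> D then g \<beta> else 0)" if L: "L \<subseteq> S" "card L = p" "\<forall>i<q. r L i = r L0 i" for L
    proof (cases "L \<subseteq> D")
      \<comment> \<open>Refilling with \<open>L\<close> destroys the coincidences with \<gamma> in
        \<open>L \<inter> D\<close>, which are fewer than \<open>p\<close> here, whereas \<beta>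
        lacks the \<open>p\<close> coincidences in \<open>L0\<close>. So \<open>ov L\<close> has
        strictly more of them than \<beta>.\<close>
      case False
      have e1: "{l \<in> S. ov L l = \<gamma> l} = D - L" by (auto simp: ov_def D_def ne)
      have e2: "{l \<in> S. \<beta> l = \<gamma> l} = D - L0" by (auto simp: b_def D_def L0_def ne)
      have "card (D - L) = card D - card (L \<inter> D)"
        using finD by (metis card_Diff_subset_Int Int_commute finite_Int)
      moreover have "card (L \<inter> D) < p"
        using False L fin by (metis inf.absorb_iff1 inf_le1 psubsetI psubset_card_mono)
      moreover have "card (D - L0) = card D - p" "p \<le> card D"
        using L0 finD by (auto simp: card_Diff_subset finite_subset card_mono)
      moreover have "card D \<le> card S" using finD assms(1) by (auto intro: card_mono)
      moreover have "card (L \<inter> D) \<le> card D" using finD by (auto intro: card_mono)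
      ultimately have "card S - card {l \<in> S. ov L l = \<gamma> l} < card S - card {l \<in> S. \<beta> l = \<gamma> l}"
        unfolding e1 e2 by linarith
      from IH[OF this] show ?thesis using False by simp
    next
      case True
      \<comment> \<open>A permutation preserving \<gamma> that carries one colouring to the other
        exists as soon as every pair of colours occurs equally often. Equality of the exponents
        settles the pairs with \<open>d = q\<close>, pairs with \<open>d \<noteq> c\<close> are
        untouched by the refilling, and the pairs with \<open>d = c\<close> are the
        complement.\<close>
      have "image_mset (\<lambda>l. (\<gamma> l, ov L l)) (mset_set S) = image_mset (\<lambda>l. (\<gamma> l, \<beta> l)) (mset_set S)"
      proof (rule multiset_eqI)
        fix x :: "nat \<times> nat"
        obtain c d where x: "x = (c, d)" by (cases x)
        consider "d = q" | "d \<noteq> q" "d \<noteq> c" | "d \<noteq> q" "d = c" by auto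
        then have "card {l \<in> S. \<gamma> l = c \<and> ov L l = d} = card {l \<in> S. \<gamma> l = c \<and> \<beta> l = d}"
        proof cases
          case 1
          have "ov L l = q \<longleftrightarrow> l \<in> L" if "l \<in> S" for l using ne(3)[OF that] by (simp add: ov_def)
          then have "{l \<in> S. \<gamma> l = c \<and> ov L l = d} = {l \<in> L. b l = c}"
            using 1 True L by (auto simp: D_def)
          moreover have "{l \<in> S. \<gamma> l = c \<and> \<beta> l = d} = {l \<in> L0. b l = c}"
            using 1 by (auto simp: b_def L0_def)
          moreover have "{l \<in> L. b l = c} = {}" "{l \<in> L0. b l = c} = {}" if "\<not> c < q"
            using that b L L0 by fastforce+
          ultimately show ?thesis using L(3) unfolding r_def by (metis card.empty)
        next
          case 2
          have "{l \<in> S. \<gamma> l = c \<and> ov L l = d} = {l \<in> S. \<gamma> l = c \<and> b l = d}"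
            using 2 True by (auto simp: ov_def D_def)
          also have "\<dots> = {l \<in> S. \<gamma> l = c \<and> \<beta> l = d}"
            using 2 by (auto simp: b_def L0_def)
          finally show ?thesis by simp
        next
          case 3
          have "{l \<in> S. \<gamma> l = c \<and> ov L l = d} = {l \<in> D. b l = c} - {l \<in> L. b l = c}"
            using 3 True by (auto simp: ov_def D_def)
          moreover have "{l \<in> S. \<gamma> l = c \<and> \<beta> l = d} = {l \<in> D. b l = c} - {l \<in> L0. b l = c}"
            using 3 by (auto simp: b_def L0_def D_def)
          moreover have "card {l \<in> L. b l = c} = card {l \<in> L0. b l = c}"
          proof (cases "c < q")
            case True
            then show ?thesis using L(3) by (simp add: r_def)
          next
            case False
            then have "{l \<in> L. b l = c} = {}" "{l \<in> L0. b l = c} = {}"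
              using b L L0 by fastforce+
            then show ?thesis by (simp only: card.empty)
          qed
          moreover have "{l \<in> L. b l = c} \<subseteq> {l \<in> D. b l = c}" "{l \<in> L0. b l = c} \<subseteq> {l \<in> D. b l = c}"
            using True L0 by auto
          ultimately show ?thesis
            using fin[OF L(1)] fin[OF L0(1)] by (simp add: card_Diff_subset)
        qed
        then show "count (image_mset (\<lambda>l. (\<gamma> l, ov L l)) (mset_set S)) x = count (image_mset (\<lambda>l. (\<gamma> l, \<beta> l)) (mset_set S)) x"
          using \<open>finite S\<close> by (simp add: count_image_mset_eq_card_vimage x)
      qed
      from image_mset_eq_implies_permutes[OF \<open>finite S\<close> this] obtain \<sigma> where
        \<sigma>: "\<sigma> permutes S" "\<forall>l\<in>S. (\<gamma> l, ov L l) = (\<gamma> (\<sigma> l), \<beta> (\<sigma> l))" by blast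
      have "g (ov L) = g (\<beta> \<circ> \<sigma>)" using \<sigma> by (intro loc) auto
      also have "\<dots> = g \<beta>" using \<sigma> by (intro sym) auto
      finally show ?thesis using True by simp
    qed
    define F where "F = {L \<in> {L. L \<subseteq> S \<and> card L = p} . (\<forall>i<q. r L i = r L0 i)}"
    have finF: "finite F" using \<open>finite S\<close> by (simp add: F_def)
    \<comment> \<open>All surviving terms equal \<open>g \<beta>\<close>, so nothing can cancel, and
      \<open>L0\<close> guarantees that there is one.\<close>
    have "0 = (\<Sum>L\<in>F. if L \<subseteq> D then g \<beta> else 0)"
      unfolding F_def by (subst sum0[symmetric], intro sum.cong) (auto simp: one)
    also have "\<dots> = of_nat (card {L \<in> F. L \<subseteq> D}) * g \<beta>"
      using finF by (simp add: sum.inter_filter[symmetric])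
    finally have "card {L \<in> F. L \<subseteq> D} = 0" using g by simp
    moreover have "L0 \<in> {L \<in> F. L \<subseteq> D}" using L0 by (simp add: F_def)
    ultimately show False using finF by auto
  qed
qed

section \<open>Functionals on words that vanish on the Filippov ideal\<close>

definition word_ext :: "('x word \<Rightarrow> complex) \<Rightarrow> ('x word \<Rightarrow>\<^sub>0 complex) \<Rightarrow> complex" where
  "word_ext \<Psi> p = (\<Sum>w\<in>Poly_Mapping.keys p. Poly_Mapping.lookup p w * \<Psi> w)"

lemma word_ext_superset:
  assumes "finite A" "Poly_Mapping.keys p \<subseteq> A"
  shows "word_ext \<Psi> p = (\<Sum>w\<in>A. Poly_Mapping.lookup p w * \<Psi> w)"
  unfolding word_ext_def by (rule sum.mono_neutral_left) (use assms in \<open>auto simp: in_keys_iff\<close>)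

lemma word_ext_add [simp]: "word_ext \<Psi> (p + q) = word_ext \<Psi> p + word_ext \<Psi> q"
proof -
  let ?A = "Poly_Mapping.keys p \<union> Poly_Mapping.keys q"
  have "word_ext \<Psi> (p + q) = (\<Sum>w\<in>?A. Poly_Mapping.lookup (p + q) w * \<Psi> w)"
    by (rule word_ext_superset) (use keys_add[of p q] in auto)
  also have "\<dots> = (\<Sum>w\<in>?A. Poly_Mapping.lookup p w * \<Psi> w) + (\<Sum>w\<in>?A. Poly_Mapping.lookup q w * \<Psi> w)"
    by (simp add: lookup_add algebra_simps sum.distrib)
  also have "\<dots> = word_ext \<Psi> p + word_ext \<Psi> q"
    by (intro arg_cong2[of _ _ _ _ plus] word_ext_superset[symmetric]) auto
  finally show ?thesis .
qed

lemma keys_cscale: "Poly_Mapping.keys (cscale c p) \<subseteq> Poly_Mapping.keys p"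
  by (auto simp: in_keys_iff lookup_cscale)

lemma word_ext_cscale [simp]: "word_ext \<Psi> (cscale c p) = c * word_ext \<Psi> p"
  by (subst word_ext_superset[OF _ keys_cscale]) (simp_all add: word_ext_def lookup_cscale sum_distrib_left mult.assoc)

lemma word_ext_zero [simp]: "word_ext \<Psi> 0 = 0"
  by (simp add: word_ext_def)

lemma word_ext_diff [simp]: "word_ext \<Psi> (p - q) = word_ext \<Psi> p - word_ext \<Psi> q"
  using word_ext_add[of \<Psi> "p - q" q] by (simp add: algebra_simps)

lemma word_ext_sum: "word_ext \<Psi> (sum f A) = (\<Sum>a\<in>A. word_ext \<Psi> (f a))"
  by (induction A rule: infinite_finite_induct) auto

lemma word_ext_single [simp]: "word_ext \<Psi> (Poly_Mapping.single w c) = c * \<Psi> w"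
  by (simp add: word_ext_def)

lemma word_ext_pushforward: "word_ext \<Psi> (pushforward f p) = word_ext (\<Psi> \<circ> f) p"
  unfolding pushforward_def word_ext_sum word_ext_single by (simp add: word_ext_def)

lemma word_ext_sum_functional: "word_ext (\<lambda>w. \<Sum>h\<in>H. c h * \<Psi> h w) p = (\<Sum>h\<in>H. c h * word_ext (\<Psi> h) p)"
  unfolding word_ext_def sum_distrib_left by (subst sum.swap) (simp add: mult.left_commute)

lemma poly_mapping_eq_sum_single: "p = (\<Sum>w\<in>Poly_Mapping.keys p. cscale (Poly_Mapping.lookup p w) (Poly_Mapping.single w 1))"
  by (rule poly_mapping_eqI) (simp add: lookup_sum lookup_cscale lookup_single when_def in_keys_iff
      if_distrib[of "(*) _"] cong: if_cong)

text \<open>A basis of \<open>I\<close> stays independent when \<open>v\<close> is added, and a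
  linear functional can be prescribed on it. On a free vector space it is the extension of a
  function on words, the form used from here on.\<close>

lemma separating_functional:
  assumes I: "cvs.subspace I" and v: "v \<notin> I"
  obtains \<Psi> where "\<And>p. p \<in> I \<Longrightarrow> word_ext \<Psi> p = 0" "word_ext \<Psi> v \<noteq> 0"
proof -
  interpret P: vector_space_pair "cscale :: complex \<Rightarrow> ('a word \<Rightarrow>\<^sub>0 complex) \<Rightarrow> _" "(*) :: complex \<Rightarrow> complex \<Rightarrow> complex"
    by unfold_locales (simp_all add: algebra_simps)
  obtain B where B: "B \<subseteq> I" "cvs.independent B" "I \<subseteq> cvs.span B"
    using cvs.basis_exists by metis
  have span: "cvs.span B = I" using B cvs.span_minimal[OF B(1) I] by blast
  have ind: "cvs.independent (insert v B)"
    using B v span by (simp add: cvs.independent_insertI)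
  obtain g where g: "Vector_Spaces.linear cscale (*) g" "\<forall>x\<in>insert v B. g x = (if x = v then 1 else 0)"
    using P.linear_independent_extend[OF ind, of "\<lambda>x. if x = v then 1 else 0"] by blast
  interpret g: Vector_Spaces.linear cscale "(*)" g by fact
  define \<Psi> where "\<Psi> w = g (Poly_Mapping.single w 1)" for w
  have g_eq: "g p = word_ext \<Psi> p" for p
    by (subst poly_mapping_eq_sum_single) (simp add: g.sum g.scale word_ext_def \<Psi>_def)
  show thesis
  proof
    fix p assume "p \<in> I"
    have "v \<notin> B" using B v by auto
    then have "g x = 0" if "x \<in> B" for x using g(2) that by auto
    then have "g p = 0" using g.eq_0_on_span[of B p] \<open>p \<in> I\<close> span by blast
    then show "word_ext \<Psi> p = 0" by (simp add: g_eq)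
  next
    show "word_ext \<Psi> v \<noteq> 0" using g(2) by (simp flip: g_eq)
  qed
qed

section \<open>Brackets of words and the carrier of the ideal\<close>

lemma in_listset_iff: "ws \<in> listset As \<longleftrightarrow> list_all2 (\<in>) ws As"
  by (induction As arbitrary: ws) (auto simp: set_Cons_def list_all2_Cons2)

lemma listset_singletons: "listset (map (\<lambda>w. {w}) ws) = {ws}"
  by (induction ws) (auto simp: set_Cons_def)

text \<open>With single words in all places but the first, bracketing is a linear substitution of
  words, along which a functional can be pulled back.\<close>

lemma bracket_Cons_singles:
  "bracket (p # map (\<lambda>w. Poly_Mapping.single w 1) us) = pushforward (\<lambda>w. Bracket (w # us)) p"
proof -
  have "listset (map Poly_Mapping.keys (p # map (\<lambda>w. Poly_Mapping.single w (1::complex)) us)) = (\<lambda>w. w # us) ` Poly_Mapping.keys p"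
    using listset_singletons[of us] by (auto simp: set_Cons_def o_def)
  moreover have "inj_on (\<lambda>w. w # us) (Poly_Mapping.keys p)" by (auto simp: inj_on_def)
  ultimately show ?thesis
    unfolding bracket_def pushforward_def
    by (simp add: sum.reindex prod.lessThan_Suc_shift del: prod.lessThan_Suc)
qed

lemma pushforward_single: "pushforward f (Poly_Mapping.single w c) = Poly_Mapping.single (f w) c"
  by (simp add: pushforward_def)

lemma bracket_singles:
  assumes "ws \<noteq> []"
  shows "bracket (map (\<lambda>w. Poly_Mapping.single w 1) ws) = Poly_Mapping.single (Bracket ws) 1"
  using bracket_Cons_singles[of "Poly_Mapping.single (hd ws) 1" "tl ws"] assms
  by (cases ws) (simp_all add: pushforward_single)

lemma free_module_carrier: "p \<in> carrier (free_module S) \<longleftrightarrow> Poly_Mapping.keys p \<subseteq> S"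
  by (simp add: free_module_def)

lemma keys_sum_subset: "(\<And>a. a \<in> A \<Longrightarrow> Poly_Mapping.keys (f a) \<subseteq> S) \<Longrightarrow> Poly_Mapping.keys (sum f A) \<subseteq> S"
proof (induction A rule: infinite_finite_induct)
  case (insert a A)
  then show ?case using keys_add[of "f a" "sum f A"] by fastforce
qed auto

lemma bracket_carrier:
  assumes "ps \<in> lists (carrier (free_module (nwords n X)))" "length ps = n"
  shows "bracket ps \<in> carrier (free_module (nwords n X))"
  unfolding free_module_carrier bracket_def
proof (rule keys_sum_subset)
  fix ws assume "ws \<in> listset (map Poly_Mapping.keys ps)"
  then have *: "list_all2 (\<in>) ws (map Poly_Mapping.keys ps)" by (simp add: in_listset_iff)
  then have "length ws = n" using assms by (auto dest: list_all2_lengthD)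
  moreover have "ws \<in> lists (nwords n X)"
    unfolding in_lists_conv_set
  proof
    fix w assume "w \<in> set ws"
    then obtain i where "i < length ws" "w = ws ! i" by (auto simp: in_set_conv_nth)
    then have "w \<in> Poly_Mapping.keys (ps ! i)" "ps ! i \<in> set ps"
      using * \<open>length ws = n\<close> assms by (auto dest: list_all2_nthD)
    then show "w \<in> nwords n X" using assms(1) by (auto simp: free_module_carrier in_lists_conv_set)
  qed
  ultimately have "Bracket ws \<in> nwords n X" by (intro nwords.intros)
  then show "Poly_Mapping.keys (Poly_Mapping.single (Bracket ws) (\<Prod>i<length ps. Poly_Mapping.lookup (ps ! i) (ws ! i))) \<subseteq> nwords n X"
    by simp
qed

text \<open>The closure rule of the ideal for brackets demands arguments in this carrier, so an
  element of the ideal can be bracketed again only after this has been checked.\<close>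

lemma filippov_ideal_carrier:
  assumes "p \<in> filippov_ideal n X" "n \<ge> 1"
  shows "p \<in> carrier (free_module (nwords n X))"
  using assms
proof (induction rule: filippov_ideal.induct)
  case zero
  show ?case by (simp add: free_module_carrier)
next
  case (add p q)
  then show ?case using keys_add[of p q] by (auto simp: free_module_carrier)
next
  case (scale p c)
  then show ?case using keys_cscale[of c p] by (auto simp: free_module_carrier)
next
  case (bracket ps i)
  show ?case by (rule bracket_carrier) (use bracket in auto)
next
  case (antisymmetry ps \<sigma>)
  have "permute_list \<sigma> ps \<in> lists (carrier (free_module (nwords n X)))"
    using antisymmetry by (simp add: in_lists_conv_set set_permute_list)
  then have "bracket ps \<in> carrier (free_module (nwords n X))" "bracket (permute_list \<sigma> ps) \<in> carrier (free_module (nwords n X))"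
    using antisymmetry by (auto intro!: bracket_carrier)
  then show ?case
    using keys_diff[of "bracket ps" "cscale (of_int (sign \<sigma>)) (bracket (permute_list \<sigma> ps))"] keys_cscale
    by (fastforce simp: free_module_carrier)
next
  case (jacobi ps qs)
  have br: "bracket (p # qs) \<in> carrier (free_module (nwords n X))" if "p \<in> carrier (free_module (nwords n X))" for p
    using that jacobi by (intro bracket_carrier) auto
  have "bracket (ps[i := bracket (ps ! i # qs)]) \<in> carrier (free_module (nwords n X))" if "i < n" for i
    using that jacobi br[of "ps ! i"] by (intro bracket_carrier) (auto simp: in_lists_conv_set set_update_subset_insert[THEN subsetD] dest!: set_update_subset_insert[THEN subsetD])
  then have "Poly_Mapping.keys (\<Sum>i<n. bracket (ps[i := bracket (ps ! i # qs)])) \<subseteq> nwords n X"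
    by (intro keys_sum_subset) (auto simp: free_module_carrier)
  moreover have "bracket (bracket ps # qs) \<in> carrier (free_module (nwords n X))"
    using jacobi by (intro br bracket_carrier) auto
  ultimately show ?case
    using keys_diff[of "bracket (bracket ps # qs)" "\<Sum>i<n. bracket (ps[i := bracket (ps ! i # qs)])"]
    by (auto simp: free_module_carrier)
qed

lemma subspace_filippov_ideal: "cvs.subspace (filippov_ideal n X)"
  by (rule cvs.subspaceI) (auto intro: filippov_ideal.intros)

section \<open>Left-normed words and Filippov functionals\<close>

definition left_normed :: "'x word \<Rightarrow> 'x word list list \<Rightarrow> 'x word" where
  "left_normed w uss = foldl (\<lambda>w us. Bracket (w # us)) w uss"

lemma left_normed_simps [simp]:
  "left_normed w [] = w"
  "left_normed w (us # uss) = left_normed (Bracket (w # us)) uss"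
  "left_normed w (uss @ uss') = left_normed (left_normed w uss) uss'"
  by (simp_all add: left_normed_def)

definition nary_args :: "nat \<Rightarrow> 'x set \<Rightarrow> 'x word list set" where
  "nary_args m X = {us \<in> lists (nwords (Suc m) X). length us = m}"

text \<open>The context \<open>uss\<close> makes the property stable under \<open>\<Psi> \<mapsto> (\<lambda>w. \<Psi> (Bracket (w # us)))\<close>.\<close>

definition filippov_functional :: "nat \<Rightarrow> 'x set \<Rightarrow> ('x word \<Rightarrow> complex) \<Rightarrow> bool" where
  "filippov_functional m X \<Psi> \<longleftrightarrow> (\<forall>uss\<in>lists (nary_args m X). \<forall>xs\<in>lists (nwords (Suc m) X). length xs = Suc m \<longrightarrow>
     (\<forall>i j. i < j \<longrightarrow> j \<le> m \<longrightarrow>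
       \<Psi> (left_normed (Bracket (xs[i := xs ! j, j := xs ! i])) uss) = - \<Psi> (left_normed (Bracket xs) uss)) \<and>
     (\<forall>us\<in>nary_args m X. \<Psi> (left_normed (Bracket (Bracket xs # us)) uss) =
        (\<Sum>i\<le>m. \<Psi> (left_normed (Bracket (xs[i := Bracket (xs ! i # us)])) uss))))"

lemma filippov_functionalD:
  assumes "filippov_functional m X \<Psi>" "xs \<in> lists (nwords (Suc m) X)" "length xs = Suc m"
  shows filippov_functional_antisymmetric: "\<And>i j. i < j \<Longrightarrow> j \<le> m \<Longrightarrow> \<Psi> (Bracket (xs[i := xs ! j, j := xs ! i])) = - \<Psi> (Bracket xs)"
    and filippov_functional_jacobi: "\<And>us. us \<in> nary_args m X \<Longrightarrow>
       \<Psi> (Bracket (Bracket xs # us)) = (\<Sum>i\<le>m. \<Psi> (Bracket (xs[i := Bracket (xs ! i # us)])))"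
  using assms unfolding filippov_functional_def by (force dest: bspec[of _ _ "[]"])+

lemma filippov_functional_left_normed:
  assumes "filippov_functional m X \<Psi>" "uss \<in> lists (nary_args m X)"
  shows "filippov_functional m X (\<lambda>w. \<Psi> (left_normed w uss))"
  unfolding filippov_functional_def
proof (intro ballI impI)
  fix uss' xs assume *: "uss' \<in> lists (nary_args m X)" "xs \<in> lists (nwords (Suc m) X)" "length xs = Suc m"
  have "uss' @ uss \<in> lists (nary_args m X)" using assms * by auto
  then show "(\<forall>i j. i < j \<longrightarrow> j \<le> m \<longrightarrow>
      \<Psi> (left_normed (left_normed (Bracket (xs[i := xs ! j, j := xs ! i])) uss') uss) =
      - \<Psi> (left_normed (left_normed (Bracket xs) uss') uss)) \<and>
    (\<forall>us\<in>nary_args m X. \<Psi> (left_normed (left_normed (Bracket (Bracket xs # us)) uss') uss) =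
        (\<Sum>i\<le>m. \<Psi> (left_normed (left_normed (Bracket (xs[i := Bracket (xs ! i # us)])) uss') uss)))"
    using assms(1) * unfolding filippov_functional_def left_normed_simps(3)[symmetric] by blast
qed

lemma filippov_functional_bracket:
  assumes "filippov_functional m X \<Psi>" "us \<in> nary_args m X"
  shows "filippov_functional m X (\<lambda>w. \<Psi> (Bracket (w # us)))"
  using filippov_functional_left_normed[OF assms(1), of "[us]"] assms(2) by simp

lemma nwords_map_word:
  assumes "w \<in> nwords n X" "h ` X \<subseteq> Y"
  shows "map_word h w \<in> nwords n Y"
  using assms by (induction rule: nwords.induct) (auto intro!: nwords.intros simp: in_lists_conv_set)

lemma map_word_left_normed:
  "map_word h (left_normed w uss) = left_normed (map_word h w) (map (map (map_word h)) uss)"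
  by (induction uss arbitrary: w) auto

lemma nary_args_map_word:
  assumes "us \<in> nary_args m X" "h ` X \<subseteq> Y"
  shows "map (map_word h) us \<in> nary_args m Y"
  using assms nwords_map_word by (fastforce simp: nary_args_def in_lists_conv_set)

text \<open>This is what permits averaging over a group of permutations: both identities are linear
  in \<Psi> and stable under relabelling.\<close>

lemma filippov_functional_relabel:
  assumes "filippov_functional m X \<Psi>" "\<And>h. h \<in> H \<Longrightarrow> h ` X \<subseteq> X"
  shows "filippov_functional m X (\<lambda>w. \<Sum>h\<in>H. c h * \<Psi> (map_word h w))"
  unfolding filippov_functional_def
proof (intro ballI impI conjI allI)
  fix uss xs assume *: "uss \<in> lists (nary_args m X)" "xs \<in> lists (nwords (Suc m) X)" "length xs = Suc m"
  have **: "map (map (map_word h)) uss \<in> lists (nary_args m X)" "map (map_word h) xs \<in> lists (nwords (Suc m) X)" "length (map (map_word h) xs) = Suc m"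
    if "h \<in> H" for h
    using * assms(2)[OF that] nwords_map_word nary_args_map_word by (fastforce simp: in_lists_conv_set)+
  {
    fix i j assume ij: "i < j" "j \<le> m"
    have "\<Psi> (map_word h (left_normed (Bracket (xs[i := xs ! j, j := xs ! i])) uss)) = - \<Psi> (map_word h (left_normed (Bracket xs) uss))"
      if "h \<in> H" for h
      using assms(1)[unfolded filippov_functional_def, rule_format, OF **[OF that]] ij *
      by (auto simp: map_word_left_normed map_update)
    then show "(\<Sum>h\<in>H. c h * \<Psi> (map_word h (left_normed (Bracket (xs[i := xs ! j, j := xs ! i])) uss))) =
       - (\<Sum>h\<in>H. c h * \<Psi> (map_word h (left_normed (Bracket xs) uss)))"
      by (simp add: sum_negf)
  next
    fix us assume us: "us \<in> nary_args m X"
    have "\<Psi> (map_word h (left_normed (Bracket (Bracket xs # us)) uss)) =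
       (\<Sum>i\<le>m. \<Psi> (map_word h (left_normed (Bracket (xs[i := Bracket (xs ! i # us)])) uss)))" if "h \<in> H" for h
      using assms(1)[unfolded filippov_functional_def, rule_format, OF **[OF that]] nary_args_map_word[OF us assms(2)[OF that]] *
      by (auto simp: map_word_left_normed map_update)
    then show "(\<Sum>h\<in>H. c h * \<Psi> (map_word h (left_normed (Bracket (Bracket xs # us)) uss))) =
       (\<Sum>i\<le>m. \<Sum>h\<in>H. c h * \<Psi> (map_word h (left_normed (Bracket (xs[i := Bracket (xs ! i # us)])) uss)))"
      by (subst sum.swap) (simp add: sum_distrib_left)
  }
qed

lemma filippov_functional_ideal:
  assumes "\<And>p. p \<in> filippov_ideal (Suc m) X \<Longrightarrow> word_ext \<Psi> p = 0"
  shows "filippov_functional m X \<Psi>"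
  unfolding filippov_functional_def
proof (intro ballI impI conjI allI)
  fix uss xs assume *: "uss \<in> lists (nary_args m X)" "xs \<in> lists (nwords (Suc m) X)" "length xs = Suc m"
  let ?I = "filippov_ideal (Suc m) X"
  let ?s = "\<lambda>w. Poly_Mapping.single w (1::complex)"
  \<comment> \<open>Bracketing with words maps the ideal into itself, so \<Psi> kills the ideal
    inside every left-normed context as well.\<close>
  have kill: "uss \<in> lists (nary_args m X) \<Longrightarrow> p \<in> ?I \<Longrightarrow> word_ext (\<lambda>w. \<Psi> (left_normed w uss)) p = 0" for uss p
  proof (induction uss arbitrary: p)
    case Nil
    then show ?case using assms by simp
  next
    case (Cons us uss)
    have "bracket (p # map ?s us) \<in> ?I"
    proof (rule filippov_ideal.bracket[where i = 0])
      show "p # map ?s us \<in> lists (carrier (free_module (nwords (Suc m) X)))"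
        using Cons.prems filippov_ideal_carrier[OF Cons.prems(2)]
        by (auto simp: nary_args_def free_module_carrier in_lists_conv_set)
    qed (use Cons.prems in \<open>auto simp: nary_args_def\<close>)
    then have "word_ext (\<lambda>w. \<Psi> (left_normed w uss)) (pushforward (\<lambda>w. Bracket (w # us)) p) = 0"
      using Cons by (simp add: bracket_Cons_singles)
    then show ?case by (simp add: word_ext_pushforward o_def)
  qed
  have lift: "map ?s ys \<in> lists (carrier (free_module (nwords (Suc m) X)))" if "ys \<in> lists (nwords (Suc m) X)" for ys
    using that by (auto simp: free_module_carrier in_lists_conv_set)
  have ne: "xs \<noteq> []" using * by auto
  {
    fix i j assume ij: "i < j" "j \<le> m"
    have perm: "permute_list (transpose i j) (map ?s xs) = map ?s (xs[i := xs ! j, j := xs ! i])"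
      by (rule nth_equalityI)
         (use ij * in \<open>auto simp: permute_list_def transpose_def nth_list_update simp del: upt_Suc\<close>)
    have tp: "transpose i j permutes {..<Suc m}" using ij by (intro permutes_swap_id) auto
    have "bracket (map ?s xs) - cscale (of_int (sign (transpose i j))) (bracket (permute_list (transpose i j) (map ?s xs))) \<in> ?I"
      using lift[OF *(2)] * tp by (intro filippov_ideal.antisymmetry) auto
    then have "?s (Bracket xs) - cscale (-1) (?s (Bracket (xs[i := xs ! j, j := xs ! i]))) \<in> ?I"
      using ij ne by (simp only: perm) (simp add: bracket_singles sign_swap_id)
    from kill[OF *(1) this]
    show "\<Psi> (left_normed (Bracket (xs[i := xs ! j, j := xs ! i])) uss) = - \<Psi> (left_normed (Bracket xs) uss)"
      by (simp add: eq_neg_iff_add_eq_0 add.commute)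
  next
    fix us assume us: "us \<in> nary_args m X"
    have "bracket (bracket (map ?s xs) # map ?s us) - (\<Sum>i<Suc m. bracket ((map ?s xs)[i := bracket ((map ?s xs) ! i # map ?s us)])) \<in> ?I"
      using lift[OF *(2)] lift[of us] * us by (intro filippov_ideal.jacobi) (auto simp: nary_args_def)
    moreover have "bracket ((map ?s xs)[i := bracket ((map ?s xs) ! i # map ?s us)]) = ?s (Bracket (xs[i := Bracket (xs ! i # us)]))"
      if "i < Suc m" for i
    proof -
      have "(map ?s xs)[i := bracket ((map ?s xs) ! i # map ?s us)] = map ?s (xs[i := Bracket (xs ! i # us)])"
        using that * bracket_singles[of "xs ! i # us"] by (simp add: map_update)
      then show ?thesis using ne by (simp add: bracket_singles)
    qed
    ultimately have "?s (Bracket (Bracket xs # us)) - (\<Sum>i<Suc m. ?s (Bracket (xs[i := Bracket (xs ! i # us)]))) \<in> ?I"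
      using ne bracket_singles[of "Bracket xs # us"] by (simp add: bracket_singles del: sum.lessThan_Suc)
    from kill[OF *(1) this]
    show "\<Psi> (left_normed (Bracket (Bracket xs # us)) uss) =
        (\<Sum>i\<le>m. \<Psi> (left_normed (Bracket (xs[i := Bracket (xs ! i # us)])) uss))"
      by (simp add: word_ext_sum lessThan_Suc_atMost del: sum.lessThan_Suc)
  }
qed

section \<open>Left-normed words span\<close>

lemma sum_list_map_update:
  fixes f :: "'a \<Rightarrow> 'b::comm_monoid_add"
  shows "j < length us \<Longrightarrow> sum_list (map f (us[j := y])) + f (us ! j) = sum_list (map f us) + f y"
proof (induction us arbitrary: j)
  case (Cons u us)
  then show ?case by (cases j) (auto simp: algebra_simps)
qed simp

text \<open>Up to order, \<open>tl (g[q := g ! 0])\<close> is \<open>g\<close> without its entry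
  \<open>q\<close>: the arguments left over when that entry is exchanged into the head
  position.\<close>

lemma sum_list_map_tl_swap:
  fixes f :: "'a \<Rightarrow> 'b::cancel_comm_monoid_add"
  assumes "q < length g"
  shows "sum_list (map f (tl (g[q := g ! 0]))) + f (g ! q) = sum_list (map f g)"
proof -
  obtain a g' where g: "g = a # g'" using assms by (cases g) auto
  show ?thesis
  proof (cases q)
    case (Suc r)
    then show ?thesis using sum_list_map_update[of r g' f a] assms by (simp add: g add.commute)
  qed (simp add: g add.commute)
qed

definition combs :: "nat \<Rightarrow> 'x set \<Rightarrow> 'x word set" where
  "combs m X = {left_normed (Letter x) (map (map Letter) uss) | x uss. x \<in> X \<and> uss \<in> lists {us \<in> lists X. length us = m}}"

lemma combsI:
  "x \<in> X \<Longrightarrow> uss \<in> lists {us \<in> lists X. length us = m} \<Longrightarrow> left_normed (Letter x) (map (map Letter) uss) \<in> combs m X"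
  unfolding combs_def by blast

lemma combs_nwords: "C \<in> combs m X \<Longrightarrow> C \<in> nwords (Suc m) X"
proof -
  have "left_normed w (map (map Letter) uss) \<in> nwords (Suc m) X"
    if "w \<in> nwords (Suc m) X" "uss \<in> lists {us \<in> lists X. length us = m}" for w uss
    using that
  proof (induction uss arbitrary: w)
    case (Cons us uss)
    have "Bracket (w # map Letter us) \<in> nwords (Suc m) X"
      using Cons.prems by (intro nwords.intros) (auto intro!: nwords.intros simp: in_lists_conv_set)
    then show ?case using Cons by auto
  qed simp
  then show "C \<in> combs m X \<Longrightarrow> C \<in> nwords (Suc m) X"
    unfolding combs_def by (auto intro!: nwords.intros(1))
qed

abbreviation content :: "'x word \<Rightarrow> 'x multiset" where
  "content w \<equiv> mset (letters w)"

text \<open>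
  If some argument in \<open>us\<close> is a bracket, antisymmetry and the Jacobi identity move its arguments
  into brackets \<open>[[C, \<dots>], \<dots>]\<close> whose argument lists have smaller total size than \<open>us\<close>.
\<close>

lemma comb_bracket_vanish:
  assumes "filippov_functional m X \<Psi>" "us \<in> nary_args m X" "C \<in> combs m X"
    and "\<And>C'. C' \<in> combs m X \<Longrightarrow> content C' = content C + sum_list (map content us) \<Longrightarrow> \<Psi> C' = 0"
  shows "\<Psi> (Bracket (C # us)) = 0"
  using assms
proof (induction "sum_list (map size us)" arbitrary: \<Psi> us C rule: less_induct)
  case less
  note F = less.prems(1)
  have len: "length us = m" and us: "us \<in> lists (nwords (Suc m) X)" using less.prems(2) by (auto simp: nary_args_def)
  have C: "C \<in> nwords (Suc m) X" using combs_nwords[OF less.prems(3)] .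
  show ?case
  proof (cases "\<exists>j<m. \<exists>g. us ! j = Bracket g")
    case False
    have "\<exists>y\<in>X. u = Letter y" if u: "u \<in> set us" for u
    proof -
      obtain j where j: "j < m" "us ! j = u" using u by (auto simp: len in_set_conv_nth)
      from u us have "u \<in> nwords (Suc m) X" by auto
      then show ?thesis using False j by cases auto
    qed
    then have "\<forall>u. \<exists>y. u \<in> set us \<longrightarrow> y \<in> X \<and> u = Letter y" by blast
    then obtain f where f: "\<And>u. u \<in> set us \<Longrightarrow> f u \<in> X \<and> u = Letter (f u)" by metis
    define ys where "ys = map f us"
    have us_eq: "us = map Letter ys" using f by (simp add: ys_def map_idI)
    have ys: "ys \<in> lists X" "length ys = m" using f len by (auto simp: ys_def)
    obtain x uss where C_eq: "C = left_normed (Letter x) (map (map Letter) uss)" "x \<in> X" "uss \<in> lists {us \<in> lists X. length us = m}"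
      using less.prems(3) by (auto simp: combs_def)
    have "Bracket (C # us) = left_normed (Letter x) (map (map Letter) (uss @ [ys]))"
      by (simp add: C_eq us_eq)
    moreover have "uss @ [ys] \<in> lists {us \<in> lists X. length us = m}" using C_eq(3) ys by simp
    ultimately have "Bracket (C # us) \<in> combs m X" using combsI[OF C_eq(2), of "uss @ [ys]" m] by (simp only:)
    then show ?thesis using less.prems(4) by (simp add: mset_concat o_def)
  next
    case True
    then obtain j g where j: "j < m" "us ! j = Bracket g" by blast
    have "Bracket g \<in> nwords (Suc m) X" using j us len by (metis in_lists_conv_set nth_mem)
    then have g: "g \<in> lists (nwords (Suc m) X)" "length g = Suc m" by (auto elim: nwords.cases)
    have swap_in: "Bracket g # us[j := C] = (C # us)[0 := (C # us) ! Suc j, Suc j := (C # us) ! 0]"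
      by (simp add: j)
    have usC: "us[j := C] \<in> nary_args m X"
      using us C len by (auto simp: nary_args_def in_lists_conv_set dest!: set_update_subset_insert[THEN subsetD])
    have "\<Psi> (Bracket (C # us)) = - \<Psi> (Bracket (Bracket g # us[j := C]))"
      unfolding swap_in using us C len j by (subst filippov_functional_antisymmetric[OF F]) auto
    also have "\<Psi> (Bracket (Bracket g # us[j := C])) = (\<Sum>q\<le>m. \<Psi> (Bracket (g[q := Bracket (g ! q # us[j := C])])))"
      by (rule filippov_functional_jacobi[OF F g usC])
    also have "\<dots> = 0"
    proof (rule sum.neutral, rule ballI)
      fix q assume "q \<in> {..m}"
      then have q: "q \<le> m" by simp
      \<comment> \<open>\<open>W\<close> is the new entry in the \<open>q\<close>-th Jacobi term.
        Bringing \<open>W\<close> to the head leaves the arguments \<open>g'\<close>, and exchanging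
        \<open>C\<close> with \<open>g ! q\<close> inside \<open>W\<close> turns the term, up to
        sign, into \<open>[[C, us'], g']\<close>, where \<open>us'\<close> is \<open>us\<close> with
        \<open>g ! q\<close> in place of the bracket \<open>us ! j\<close>.\<close>
      define g' where "g' = tl (g[q := g ! 0])"
      define W where "W = Bracket (g ! q # us[j := C])"
      have gq: "g ! q \<in> nwords (Suc m) X" using g q by (auto simp: in_lists_conv_set)
      have W: "W \<in> nwords (Suc m) X"
        unfolding W_def using gq usC by (intro nwords.intros) (auto simp: nary_args_def)
      have g': "g' \<in> nary_args m X"
        using g q by (auto simp: g'_def nary_args_def in_lists_conv_set dest!: list.set_sel(2)[rotated] set_update_subset_insert[THEN subsetD])
      have sum_g': "sum_list (map f g') + f (g ! q) = sum_list (map f g)" for f :: "'a word \<Rightarrow> 'b::cancel_comm_monoid_add"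
        unfolding g'_def using q g by (intro sum_list_map_tl_swap) auto
      have size_g: "sum_list (map size g) < size (us ! j)"
        by (simp add: j size_list_conv_sum_list sum_list_addf[symmetric] sum_list_mono le_imp_less_Suc)
      have sum_us: "sum_list (map f (us[j := g ! q])) + f (us ! j) = sum_list (map f us) + f (g ! q)" for f :: "'a word \<Rightarrow> 'b::comm_monoid_add"
        using sum_list_map_update[of j us f] j len by simp
      have size_j: "size (us ! j) \<le> sum_list (map size us)"
        using j(1) len by (intro member_le_sum_list) simp_all
      have F': "filippov_functional m X (\<lambda>w. \<Psi> (Bracket (w # g')))" using F g' by (rule filippov_functional_bracket)
      have usq: "us[j := g ! q] \<in> nary_args m X"
        using us gq len by (auto simp: nary_args_def in_lists_conv_set dest!: set_update_subset_insert[THEN subsetD])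
      \<comment> \<open>Both argument lists are smaller than \<open>us\<close>, since
        \<open>g ! q\<close> and the entries of \<open>g'\<close> together make up the bracket
        \<open>us ! j\<close>. The induction hypothesis is used first for the functional with
        context \<open>g'\<close>, then for \<Psi> itself on the resulting left-normed
        words.\<close>
      have inner: "\<Psi> (Bracket (Bracket (C # us[j := g ! q]) # g')) = 0"
      proof (rule less.hyps[OF _ F' usq less.prems(3)])
        show "sum_list (map size (us[j := g ! q])) < sum_list (map size us)"
          using sum_us[of size] sum_g'[of size] size_g by simp
        fix C' assume C': "C' \<in> combs m X" "content C' = content C + sum_list (map content (us[j := g ! q]))"
        show "\<Psi> (Bracket (C' # g')) = 0"
        proof (rule less.hyps[OF _ F g' C'(1)])
          show "sum_list (map size g') < sum_list (map size us)"
            using sum_g'[of size] size_g size_j by simp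
          fix C'' assume C'': "C'' \<in> combs m X" "content C'' = content C' + sum_list (map content g')"
          have "content C'' = content C + sum_list (map content us)"
          proof -
            have "sum_list (map content (us[j := g ! q])) + content (us ! j) = sum_list (map content us) + content (g ! q)"
              by (rule sum_us)
            moreover have "content (us ! j) = sum_list (map content g') + content (g ! q)"
              using sum_g'[of content] by (simp add: j mset_concat o_def)
            ultimately have "(sum_list (map content (us[j := g ! q])) + sum_list (map content g')) + content (g ! q) =
                sum_list (map content us) + content (g ! q)"
              by (simp only: add.assoc)
            then have "sum_list (map content (us[j := g ! q])) + sum_list (map content g') = sum_list (map content us)"
              by (simp only: add_right_cancel)
            then show ?thesis by (simp only: C''(2) C'(2) add.assoc)
          qed
          then show "\<Psi> C'' = 0" using C'' less.prems(4) by simp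
        qed
      qed
      have "\<Psi> (Bracket (W # g')) = - \<Psi> (Bracket (Bracket (C # us[j := g ! q]) # g'))"
      proof -
        have "g ! q # us[j := C] = (C # us[j := g ! q])[0 := (C # us[j := g ! q]) ! Suc j, Suc j := (C # us[j := g ! q]) ! 0]"
          using j len by simp
        then show ?thesis
          unfolding W_def using C usq j len
          by (simp only:) (subst filippov_functional_antisymmetric[OF F'], auto simp: nary_args_def)
      qed
      then have W0: "\<Psi> (Bracket (W # g')) = 0" using inner by simp
      show "\<Psi> (Bracket (g[q := Bracket (g ! q # us[j := C])])) = 0"
      proof (cases "q = 0")
        case True
        then have "g[q := W] = W # g'" using g by (cases g) (auto simp: g'_def)
        then show ?thesis using W0 by (simp add: W_def)
      next
        case False
        let ?y = "g[q := W]"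
        have y: "?y \<in> lists (nwords (Suc m) X)" "length ?y = Suc m"
          using g W by (auto simp: in_lists_conv_set dest!: set_update_subset_insert[THEN subsetD])
        have "?y[0 := ?y ! q, q := ?y ! 0] = W # g'"
          using False g q by (cases g; cases q) (auto simp: g'_def)
        then show ?thesis
          using filippov_functional_antisymmetric[OF F y, of 0 q] False q W0 by (simp add: W_def)
      qed
    qed
    finally show ?thesis by simp
  qed
qed

text \<open>The spanning statement in dual form. Since the functional is arbitrary in the induction,
  the first argument of a bracket can be treated with the other arguments absorbed into the
  functional. Equality of contents ensures that multilinear words lead only to multilinear
  ones.\<close>

lemma vanish_on_combs:
  assumes "w \<in> nwords (Suc m) X" "filippov_functional m X \<Psi>"
    and "\<And>C. C \<in> combs m X \<Longrightarrow> content C = content w \<Longrightarrow> \<Psi> C = 0"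
  shows "\<Psi> w = 0"
  using assms
proof (induction arbitrary: \<Psi> rule: nwords.induct)
  case (1 x)
  have "Letter x \<in> combs m X" using combsI[OF 1(1), of "[]" m] by simp
  then show ?case using 1 by simp
next
  case (2 ws)
  then obtain w us where ws: "ws = w # us" by (cases ws) auto
  have us: "us \<in> nary_args m X" using 2 by (auto simp: ws nary_args_def)
  have F': "filippov_functional m X (\<lambda>w. \<Psi> (Bracket (w # us)))" using 2 us by (intro filippov_functional_bracket)
  have vanish: "\<Psi> (Bracket (C # us)) = 0" if "C \<in> combs m X" "content C = content w" for C
  proof (rule comb_bracket_vanish[OF 2(3) us that(1)])
    fix C' assume "C' \<in> combs m X" "content C' = content C + sum_list (map content us)"
    then show "\<Psi> C' = 0" using 2(4)[of C'] that(2) by (simp add: ws mset_concat o_def)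
  qed
  have "\<And>\<Psi>. filippov_functional m X \<Psi> \<Longrightarrow> (\<And>C. C \<in> combs m X \<Longrightarrow> content C = content w \<Longrightarrow> \<Psi> C = 0) \<Longrightarrow> \<Psi> w = 0"
    using 2(1) by (simp add: ws)
  from this[OF F' vanish] show ?case by (simp add: ws)
qed

section \<open>Exchange relations between consecutive blocks\<close>

lemma nary_args_update:
  "us \<in> nary_args m X \<Longrightarrow> y \<in> nwords (Suc m) X \<Longrightarrow> us[a := y] \<in> nary_args m X"
  by (auto simp: nary_args_def in_lists_conv_set dest!: set_update_subset_insert[THEN subsetD])

lemma nary_args_nth: "us \<in> nary_args m X \<Longrightarrow> a < m \<Longrightarrow> us ! a \<in> nwords (Suc m) X"
  by (auto simp: nary_args_def in_lists_conv_set)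

lemma nary_args_Bracket: "us \<in> nary_args m X \<Longrightarrow> w \<in> nwords (Suc m) X \<Longrightarrow> Bracket (w # us) \<in> nwords (Suc m) X"
  by (intro nwords.intros) (auto simp: nary_args_def)

lemma filippov_functional_swap_head:
  assumes "filippov_functional m X \<Psi>" "us \<in> nary_args m X" "x \<in> nwords (Suc m) X" "y \<in> nwords (Suc m) X" "a < m"
  shows "\<Psi> (Bracket (x # us[a := y])) = - \<Psi> (Bracket (y # us[a := x]))"
proof -
  have len: "length us = m" using assms by (simp add: nary_args_def)
  have y: "y # us[a := x] \<in> lists (nwords (Suc m) X)" "length (y # us[a := x]) = Suc m"
    using nary_args_update[OF assms(2,3)] assms(4) by (auto simp: nary_args_def)
  have eq: "(y # us[a := x])[0 := (y # us[a := x]) ! Suc a, Suc a := (y # us[a := x]) ! 0] = x # us[a := y]"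
    using assms(5) len by simp
  show ?thesis
    using filippov_functional_antisymmetric[OF assms(1) y, of 0 "Suc a"] assms(5) unfolding eq by simp
qed

lemma filippov_functional_jacobi_head:
  assumes "filippov_functional m X \<Psi>" "v \<in> nary_args m X" "u \<in> nary_args m X" "w \<in> nwords (Suc m) X"
  shows "\<Psi> (Bracket (Bracket (w # v) # u)) = \<Psi> (Bracket (Bracket (w # u) # v)) +
    (\<Sum>a<m. \<Psi> (Bracket (w # v[a := Bracket (v ! a # u)])))"
proof -
  have "w # v \<in> lists (nwords (Suc m) X)" "length (w # v) = Suc m"
    using assms by (auto simp: nary_args_def)
  from filippov_functional_jacobi[OF assms(1) this assms(3)]
  show ?thesis by (simp add: sum.atMost_shift)
qed

text \<open>The brackets created by the Jacobi identity are moved to the head, so that every term is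
  nested on the left again.\<close>

lemma filippov_functional_exchange_head:
  assumes F: "filippov_functional m X \<Psi>" and v: "v \<in> nary_args m X" and u: "u \<in> nary_args m X"
    and w: "w \<in> nwords (Suc m) X"
  shows "\<Psi> (Bracket (Bracket (w # v) # u)) = \<Psi> (Bracket (Bracket (w # u) # v)) -
    (\<Sum>a<m. \<Psi> (Bracket (Bracket (v ! a # u) # v[a := w])))"
proof -
  have "(\<Sum>a<m. \<Psi> (Bracket (w # v[a := Bracket (v ! a # u)]))) = (\<Sum>a<m. - \<Psi> (Bracket (Bracket (v ! a # u) # v[a := w])))"
    by (intro sum.cong filippov_functional_swap_head[OF F v w] nary_args_Bracket[OF u] nary_args_nth[OF v]) auto
  then show ?thesis using filippov_functional_jacobi_head[OF assms] by (simp add: sum_negf)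
qed

text \<open>Every term \<open>[[v_a, u], v[a := w]]\<close> of the previous identity is expanded by
  a second Jacobi identity. The part with \<open>u\<close> outside has \<open>v_a\<close> and
  \<open>w\<close> in the same inner bracket and is the original word up to sign, which yields the
  factor \<open>m\<close>. The other parts exchange one argument of \<open>v\<close> with one of
  \<open>u\<close>.\<close>

lemma filippov_functional_exchange:
  assumes F: "filippov_functional m X \<Psi>" and v: "v \<in> nary_args m X" and u: "u \<in> nary_args m X"
    and w: "w \<in> nwords (Suc m) X"
  shows "\<Psi> (Bracket (Bracket (w # v) # u)) = \<Psi> (Bracket (Bracket (w # u) # v)) +
    of_nat m * \<Psi> (Bracket (Bracket (w # v) # u)) -
    (\<Sum>a<m. \<Sum>b<m. \<Psi> (Bracket (Bracket (w # v[a := u ! b]) # u[b := v ! a])))"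
proof -
  have "\<Psi> (Bracket (Bracket (v ! a # u) # v[a := w])) = - \<Psi> (Bracket (Bracket (w # v) # u)) +
      (\<Sum>b<m. \<Psi> (Bracket (Bracket (w # v[a := u ! b]) # u[b := v ! a])))" if a: "a < m" for a
  proof -
    have va: "v ! a \<in> nwords (Suc m) X" using nary_args_nth[OF v a] .
    have vw: "v[a := w] \<in> nary_args m X" using nary_args_update[OF v w] .
    have F': "filippov_functional m X (\<lambda>x. \<Psi> (Bracket (x # u)))" if "u \<in> nary_args m X" for u
      using filippov_functional_bracket[OF F that] .
    have "\<Psi> (Bracket (v ! a # u[b := Bracket (u ! b # v[a := w])])) =
       \<Psi> (Bracket (Bracket (w # v[a := u ! b]) # u[b := v ! a]))" if b: "b < m" for b
    proof -
      have ub: "u ! b \<in> nwords (Suc m) X" using nary_args_nth[OF u b] .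
      have "\<Psi> (Bracket (v ! a # u[b := Bracket (u ! b # v[a := w])])) = - \<Psi> (Bracket (Bracket (u ! b # v[a := w]) # u[b := v ! a]))"
        by (rule filippov_functional_swap_head[OF F u va nary_args_Bracket[OF vw ub] b])
      also have "\<Psi> (Bracket (Bracket (u ! b # v[a := w]) # u[b := v ! a])) = - \<Psi> (Bracket (Bracket (w # v[a := u ! b]) # u[b := v ! a]))"
        by (rule filippov_functional_swap_head[OF F'[OF nary_args_update[OF u va]] v ub w a])
      finally show ?thesis by simp
    qed
    moreover have "\<Psi> (Bracket (Bracket (v ! a # v[a := w]) # u)) = - \<Psi> (Bracket (Bracket (w # v) # u))"
      using filippov_functional_swap_head[OF F'[OF u] v va w a] by simp
    ultimately show ?thesis
      using filippov_functional_jacobi_head[OF F u vw va] by simp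
  qed
  then have sum: "(\<Sum>a<m. \<Psi> (Bracket (Bracket (v ! a # u) # v[a := w]))) = - (of_nat m * \<Psi> (Bracket (Bracket (w # v) # u))) +
      (\<Sum>a<m. \<Sum>b<m. \<Psi> (Bracket (Bracket (w # v[a := u ! b]) # u[b := v ! a])))"
    by (simp add: sum_subtractf)
  show ?thesis
    by (subst filippov_functional_exchange_head[OF assms], subst sum) simp
qed

text \<open>
  The letters of a left-normed word are numbered from left to right, starting from 1. By truncated
  subtraction position 1 belongs to block 0, which therefore has \<open>p + 1\<close> positions.
\<close>

definition pos_block :: "nat \<Rightarrow> nat \<Rightarrow> nat" where
  "pos_block p x = (x - 2) div p"

definition block_args :: "nat \<Rightarrow> (nat \<Rightarrow> nat) \<Rightarrow> nat \<Rightarrow> nat word list" where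
  "block_args p \<theta> b = map (\<lambda>a. Letter (\<theta> (b * p + 2 + a))) [0..<p]"

definition comb_word :: "nat \<Rightarrow> nat \<Rightarrow> (nat \<Rightarrow> nat) \<Rightarrow> nat word" where
  "comb_word p K \<theta> = left_normed (Letter (\<theta> 1)) (map (block_args p \<theta>) [0..<K])"

text \<open>Only \<open>q = p\<close>, the exchange of two whole blocks, matters; the general case serves to compute the sign.\<close>

definition block_swap :: "nat \<Rightarrow> nat \<Rightarrow> nat \<Rightarrow> nat \<Rightarrow> nat" where
  "block_swap p i q x = (if i * p + 2 \<le> x \<and> x < i * p + 2 + q then x + p
     else if i * p + p + 2 \<le> x \<and> x < i * p + p + 2 + q then x - p else x)"

lemma pos_block_eq: "a < p \<Longrightarrow> pos_block p (b * p + 2 + a) = b"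
  by (simp add: pos_block_def)

lemma pos_block_cases:
  assumes "p \<ge> 1" "x \<ge> 1"
  obtains "x = 1" "pos_block p x = 0" | b a where "a < p" "x = b * p + 2 + a" "pos_block p x = b"
proof (cases "x = 1")
  case False
  then have "x = ((x - 2) div p) * p + 2 + (x - 2) mod p" "(x - 2) mod p < p" using assms by simp_all
  then show thesis using that(2)[OF _ _ pos_block_def] by blast
qed (use that(1) in \<open>simp add: pos_block_def\<close>)

lemma block_args_cong:
  assumes "\<And>x. pos_block p x = b \<Longrightarrow> x \<ge> 2 \<Longrightarrow> \<theta> x = \<theta>' x"
  shows "block_args p \<theta> b = block_args p \<theta>' b"
  unfolding block_args_def using assms pos_block_eq by auto

lemma block_args_nth [simp]: "a < p \<Longrightarrow> block_args p \<theta> b ! a = Letter (\<theta> (b * p + 2 + a))"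
  by (simp add: block_args_def)

lemma length_block_args [simp]: "length (block_args p \<theta> b) = p"
  by (simp add: block_args_def)

lemma comb_word_split:
  assumes "i < K"
  shows "comb_word p K \<theta> = left_normed (Bracket (left_normed (Letter (\<theta> 1)) (map (block_args p \<theta>) [0..<i]) # block_args p \<theta> i))
     (map (block_args p \<theta>) [Suc i..<K])"
proof -
  have "[0..<K] = [0..<i] @ [i] @ [Suc i..<K]"
    using assms by (metis append_Cons append_Nil le_add1 less_imp_add_positive upt_add_eq_append upt_conv_Cons zero_order(1))
  then show ?thesis by (simp add: comb_word_def del: upt_Suc)
qed

lemma comb_word_split2:
  assumes "Suc i < K"
  shows "comb_word p K \<theta> = left_normed (Bracket (Bracket (left_normed (Letter (\<theta> 1)) (map (block_args p \<theta>) [0..<i]) # block_args p \<theta> i)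
     # block_args p \<theta> (Suc i))) (map (block_args p \<theta>) [Suc (Suc i)..<K])"
  using assms by (subst comb_word_split[of i]) (simp_all add: upt_conv_Cons)

lemma map_word_comb_word: "map_word \<sigma> (comb_word p K \<theta>) = comb_word p K (\<sigma> \<circ> \<theta>)"
  by (simp add: comb_word_def map_word_left_normed block_args_def[abs_def] o_def)

lemma block_swap_Suc:
  assumes "q < p"
  shows "block_swap p i (Suc q) = block_swap p i q \<circ> transpose (i * p + 2 + q) (i * p + p + 2 + q)"
proof
  fix x
  show "block_swap p i (Suc q) x = (block_swap p i q \<circ> transpose (i * p + 2 + q) (i * p + p + 2 + q)) x"
    using assms by (auto simp: block_swap_def transpose_def)
qed

lemma block_swap_permutes_sign:
  assumes "Suc i < K" "q \<le> p"
  shows "block_swap p i q permutes {1..K * p + 1} \<and> sign (block_swap p i q) = (-1) ^ q"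
  using assms(2)
proof (induction q)
  case 0
  have "block_swap p i 0 = id" by (auto simp: block_swap_def)
  then show ?case by (simp only: permutes_id sign_id power_0 simp_thms)
next
  case (Suc q)
  have "(i + 2) * p \<le> K * p" using assms by (intro mult_le_mono1) simp
  then have tp: "transpose (i * p + 2 + q) (i * p + p + 2 + q) permutes {1..K * p + 1}"
    using Suc.prems by (intro permutes_swap_id) (auto simp: algebra_simps)
  have IH: "block_swap p i q permutes {1..K * p + 1}" "sign (block_swap p i q) = (-1) ^ q" using Suc by auto
  have "permutation (transpose (i * p + 2 + q) (i * p + p + 2 + q))" "permutation (block_swap p i q)"
    using tp IH(1) permutation_permutes by blast+
  then have "sign (block_swap p i (Suc q)) = (-1) ^ q * sign (transpose (i * p + 2 + q) (i * p + p + 2 + q))"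
    using Suc.prems IH(2) by (simp only: block_swap_Suc[OF Suc_le_lessD] sign_compose)
  moreover have "sign (transpose (i * p + 2 + q) (i * p + p + 2 + q)) = -1" using Suc.prems by (simp add: sign_swap_id)
  moreover have "block_swap p i (Suc q) permutes {1..K * p + 1}"
    unfolding block_swap_Suc[OF Suc_le_lessD[OF Suc.prems]] by (rule permutes_compose[OF tp IH(1)])
  ultimately show ?case by simp
qed

lemma block_swap_fixes:
  assumes "p \<ge> 1" "x \<ge> 2" "pos_block p x \<noteq> i" "pos_block p x \<noteq> Suc i" "q \<le> p"
  shows "block_swap p i q x = x"
proof -
  define a where "a = (x - 2) mod p"
  define b where "b = (x - 2) div p"
  have ab: "a < p" "x = b * p + 2 + a" "pos_block p x = b"
    using assms by (simp_all add: a_def b_def pos_block_def)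
  show ?thesis
  proof (rule ccontr)
    assume "\<not> ?thesis"
    then have "i * p + 2 \<le> x" "x < i * p + p + p + 2" using assms(5) by (auto simp: block_swap_def split: if_splits)
    then have "i * p < Suc b * p" "b * p < Suc (Suc i) * p" using ab by simp_all
    then have "i < Suc b" "b < Suc (Suc i)" by (simp_all only: mult_less_cancel2)
    then show False using assms ab by simp
  qed
qed

lemma pos_block_block_swap:
  assumes "p \<ge> 1" "x \<ge> 2"
  shows "pos_block p (block_swap p i p x) = transpose i (Suc i) (pos_block p x)"
proof -
  define a where "a = (x - 2) mod p"
  define b where "b = (x - 2) div p"
  have ab: "a < p" "x = b * p + 2 + a" "pos_block p x = b"
    using assms by (simp_all add: a_def b_def pos_block_def)
  consider "b = i" | "b = Suc i" | "b \<noteq> i" "b \<noteq> Suc i" by blast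
  then show ?thesis
  proof cases
    case 1
    then have "block_swap p i p x = Suc i * p + 2 + a" using ab by (simp add: block_swap_def)
    then show ?thesis using pos_block_eq[OF ab(1), of "Suc i"] 1 ab by simp
  next
    case 2
    then have "block_swap p i p x = i * p + 2 + a" using ab by (simp add: block_swap_def)
    then show ?thesis using pos_block_eq[OF ab(1), of i] 2 ab by simp
  next
    case 3
    have "block_swap p i p x = x" using 3 ab assms by (intro block_swap_fixes) auto
    then show ?thesis using 3 ab by simp
  qed
qed

lemma left_normed_nwords:
  "w \<in> nwords (Suc m) X \<Longrightarrow> uss \<in> lists (nary_args m X) \<Longrightarrow> left_normed w uss \<in> nwords (Suc m) X"
  by (induction uss arbitrary: w) (auto intro: nary_args_Bracket)

lemma pos_block_less: "p \<ge> 1 \<Longrightarrow> K \<ge> 1 \<Longrightarrow> x \<in> {1..K * p + 1} \<Longrightarrow> pos_block p x < K"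
  unfolding pos_block_def by (rule less_mult_imp_div_less, cases "K * p") auto

lemma position_in_range:
  fixes a b p K :: nat
  assumes "b < K" "a < p"
  shows "b * p + 2 + a \<in> {1..K * p + 1}"
proof -
  have "Suc b * p \<le> K * p" using assms by (intro mult_le_mono1) simp
  then show ?thesis using assms by simp
qed

section \<open>Positions, letters and the exchange relations for left-normed words\<close>

locale comb_functional =
  fixes p K :: nat and \<Psi> :: "nat word \<Rightarrow> complex"
  assumes p: "p \<ge> 1" and K: "K \<ge> 1"
    and functional: "filippov_functional p {1..K * p + 1} \<Psi>"
begin

abbreviation "S \<equiv> {1..K * p + 1}"

text \<open>\<theta> sends a position to the letter standing there. Hence composition on the right
  permutes positions and composition on the left relabels letters.\<close>

definition phi :: "(nat \<Rightarrow> nat) \<Rightarrow> complex" where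
  "phi \<theta> = \<Psi> (comb_word p K \<theta>)"

lemma block_args_nary:
  assumes "\<theta> permutes S" "b < K"
  shows "block_args p \<theta> b \<in> nary_args p S"
proof -
  have "Letter (\<theta> (b * p + 2 + a)) \<in> nwords (Suc p) S" if "a < p" for a
  proof (rule nwords.intros)
    show "\<theta> (b * p + 2 + a) \<in> S"
      using position_in_range[OF assms(2) that] permutes_in_image[OF assms(1)] by blast
  qed
  then show ?thesis by (auto simp: nary_args_def block_args_def)
qed

lemma block_args_lists:
  assumes "\<theta> permutes S" "set bs \<subseteq> {..<K}"
  shows "map (block_args p \<theta>) bs \<in> lists (nary_args p S)"
  using assms block_args_nary by (auto simp: in_lists_conv_set)

lemma initial_word:
  assumes "\<theta> permutes S" "i \<le> K"
  shows "left_normed (Letter (\<theta> 1)) (map (block_args p \<theta>) [0..<i]) \<in> nwords (Suc p) S"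
proof (rule left_normed_nwords)
  show "Letter (\<theta> 1) \<in> nwords (Suc p) S"
  proof (rule nwords.intros)
    have "1 \<in> S" by simp
    then show "\<theta> 1 \<in> S" using permutes_in_image[OF assms(1)] by blast
  qed
  show "map (block_args p \<theta>) [0..<i] \<in> lists (nary_args p S)"
    using assms by (intro block_args_lists) auto
qed

lemma phi_comp:
  assumes "Suc i < K" "\<And>x. x \<ge> 2 \<Longrightarrow> pos_block p x \<noteq> i \<Longrightarrow> pos_block p x \<noteq> Suc i \<Longrightarrow> \<tau> x = x" "\<tau> 1 = 1"
  shows "phi (\<theta> \<circ> \<tau>) = \<Psi> (left_normed (Bracket (Bracket (left_normed (Letter (\<theta> 1)) (map (block_args p \<theta>) [0..<i])
     # block_args p (\<theta> \<circ> \<tau>) i) # block_args p (\<theta> \<circ> \<tau>) (Suc i))) (map (block_args p \<theta>) [Suc (Suc i)..<K]))"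
proof -
  have "block_args p (\<theta> \<circ> \<tau>) b = block_args p \<theta> b" if "b \<noteq> i" "b \<noteq> Suc i" for b
    using that assms(2) by (intro block_args_cong) auto
  then have eqs: "map (block_args p (\<theta> \<circ> \<tau>)) [0..<i] = map (block_args p \<theta>) [0..<i]"
    "map (block_args p (\<theta> \<circ> \<tau>)) [Suc (Suc i)..<K] = map (block_args p \<theta>) [Suc (Suc i)..<K]"
    by (auto simp del: upt_Suc)
  have t: "(\<theta> \<circ> \<tau>) 1 = \<theta> 1" using assms(3) by simp
  show ?thesis
    unfolding phi_def comb_word_split2[OF assms(1)] eqs t ..
qed

lemma block_args_block_swap:
  shows "block_args p (\<theta> \<circ> block_swap p i p) i = block_args p \<theta> (Suc i)"
    and "block_args p (\<theta> \<circ> block_swap p i p) (Suc i) = block_args p \<theta> i"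
  by (auto simp: block_args_def block_swap_def algebra_simps)

lemma block_args_transpose:
  assumes "a < p" "b < p"
  shows "block_args p (\<theta> \<circ> transpose (i * p + 2 + a) (Suc i * p + 2 + b)) i = (block_args p \<theta> i)[a := block_args p \<theta> (Suc i) ! b]"
    and "block_args p (\<theta> \<circ> transpose (i * p + 2 + a) (Suc i * p + 2 + b)) (Suc i) = (block_args p \<theta> (Suc i))[b := block_args p \<theta> i ! a]"
  using assms by (auto intro!: nth_equalityI simp: nth_list_update transpose_def)

lemma block_swap_1 [simp]: "block_swap p i q 1 = 1"
  by (simp add: block_swap_def)

lemma transpose_fixes:
  assumes "a < p" "b < p" "pos_block p x \<noteq> i" "pos_block p x \<noteq> Suc i"
  shows "transpose (i * p + 2 + a) (Suc i * p + 2 + b) x = x"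
  using assms pos_block_eq[OF assms(1), of i] pos_block_eq[OF assms(2), of "Suc i"] by (metis transpose_apply_other)

lemma phi_exchange:
  assumes \<theta>: "\<theta> permutes S" and i: "Suc i < K"
  shows "phi \<theta> = phi (\<theta> \<circ> block_swap p i p) + of_nat p * phi \<theta> -
    (\<Sum>a<p. \<Sum>b<p. phi (\<theta> \<circ> transpose (i * p + 2 + a) (Suc i * p + 2 + b)))"
proof -
  let ?w = "left_normed (Letter (\<theta> 1)) (map (block_args p \<theta>) [0..<i])"
  let ?R = "map (block_args p \<theta>) [Suc (Suc i)..<K]"
  have "?R \<in> lists (nary_args p S)" using \<theta> by (intro block_args_lists) auto
  from filippov_functional_left_normed[OF functional this]
  have F': "filippov_functional p S (\<lambda>w. \<Psi> (left_normed w ?R))" .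
  have eq: "phi \<theta> = \<Psi> (left_normed (Bracket (Bracket (?w # block_args p \<theta> i) # block_args p \<theta> (Suc i))) ?R)"
    unfolding phi_def comb_word_split2[OF i] ..
  have swap: "phi (\<theta> \<circ> block_swap p i p) = \<Psi> (left_normed (Bracket (Bracket (?w # block_args p \<theta> (Suc i)) # block_args p \<theta> i)) ?R)"
    using block_swap_fixes[OF p] by (subst phi_comp[OF i]) (auto simp: block_args_block_swap simp del: One_nat_def)
  have ex: "phi (\<theta> \<circ> transpose (i * p + 2 + a) (Suc i * p + 2 + b)) = \<Psi> (left_normed (Bracket (Bracket
       (?w # (block_args p \<theta> i)[a := block_args p \<theta> (Suc i) ! b]) # (block_args p \<theta> (Suc i))[b := block_args p \<theta> i ! a])) ?R)"
    if "a < p" "b < p" for a b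
    unfolding block_args_transpose[OF that, symmetric]
    by (rule phi_comp[OF i transpose_fixes[OF that]]) (auto simp: transpose_def)
  have "(\<Sum>a<p. \<Sum>b<p. phi (\<theta> \<circ> transpose (i * p + 2 + a) (Suc i * p + 2 + b))) =
     (\<Sum>a<p. \<Sum>b<p. \<Psi> (left_normed (Bracket (Bracket
       (?w # (block_args p \<theta> i)[a := block_args p \<theta> (Suc i) ! b]) # (block_args p \<theta> (Suc i))[b := block_args p \<theta> i ! a])) ?R))"
    by (intro sum.cong refl ex) auto
  then show ?thesis
    unfolding swap eq
    using filippov_functional_exchange[OF F' block_args_nary[OF \<theta>] block_args_nary[OF \<theta>] initial_word[OF \<theta>], of i "Suc i" i] i
    by (simp only: Suc_lessD less_imp_le_nat)
qed

lemma phi_antisymmetric: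
  assumes \<theta>: "\<theta> permutes S" and PQ: "P \<in> S" "Q \<in> S" "P < Q" "pos_block p P = pos_block p Q"
  shows "phi (\<theta> \<circ> transpose P Q) = - phi \<theta>"
proof -
  define i where "i = pos_block p Q"
  have i: "i < K" using pos_block_less[OF p K] PQ by (simp add: i_def)
  define a' where "a' = (Q - 2) mod p"
  have a': "a' < p" "Q = i * p + 2 + a'" using p PQ by (simp_all add: a'_def i_def pos_block_def)
  let ?w = "\<lambda>\<theta>. left_normed (Letter (\<theta> 1)) (map (block_args p \<theta>) [0..<i])"
  let ?R = "map (block_args p \<theta>) [Suc i..<K]"
  have "?R \<in> lists (nary_args p S)" using \<theta> by (intro block_args_lists) auto
  from filippov_functional_left_normed[OF functional this]
  have F': "filippov_functional p S (\<lambda>w. \<Psi> (left_normed w ?R))" .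
  let ?xs = "?w \<theta> # block_args p \<theta> i"
  have xs: "?xs \<in> lists (nwords (Suc p) S)" "length ?xs = Suc p"
    using initial_word[OF \<theta>] block_args_nary[OF \<theta> i] i by (auto simp: nary_args_def)
  let ?\<theta> = "\<theta> \<circ> transpose P Q"
  have other: "block_args p ?\<theta> b = block_args p \<theta> b" if "b \<noteq> i" for b
  proof (rule block_args_cong)
    fix x assume "pos_block p x = b"
    then have "x \<noteq> P" "x \<noteq> Q" using that PQ by (auto simp: i_def)
    then show "?\<theta> x = \<theta> x" by simp
  qed
  then have R: "map (block_args p ?\<theta>) [Suc i..<K] = ?R" and init: "map (block_args p ?\<theta>) [0..<i] = map (block_args p \<theta>) [0..<i]"
    by (auto simp del: upt_Suc)
  \<comment> \<open>\<open>j\<close> and \<open>Suc a'\<close> are the places of the two letters in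
    the argument list of the bracket of block \<open>i\<close>. Position 1 is such an argument only
    in block 0, where the head of the list is a single letter.\<close>
  obtain j where j: "j \<le> a'" and
    list_eq: "?w ?\<theta> # block_args p ?\<theta> i = ?xs[j := ?xs ! Suc a', Suc a' := ?xs ! j]"
  proof (cases "P = 1")
    case True
    then have i0: "i = 0" using PQ by (simp add: i_def pos_block_def)
    have "block_args p ?\<theta> i = (block_args p \<theta> i)[a' := Letter (\<theta> 1)]"
      using a' True i0 by (auto intro!: nth_equalityI simp: nth_list_update transpose_def)
    moreover have "?\<theta> 1 = \<theta> Q" using True by simp
    ultimately show thesis using that[of 0] a' i0 by simp
  next
    case False
    define a where "a = (P - 2) mod p"
    have i_eq: "i = (P - 2) div p" using PQ(4) by (simp add: i_def pos_block_def)
    have a: "P = i * p + 2 + a" unfolding i_eq a_def using PQ False by simp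
    have "a < p" using p by (simp add: a_def)
    note a = this a
    have e1: "block_args p ?\<theta> i = (block_args p \<theta> i)[a := block_args p \<theta> i ! a', a' := block_args p \<theta> i ! a]"
      using a a' PQ by (auto intro!: nth_equalityI simp: nth_list_update transpose_def)
    have e2: "?\<theta> 1 = \<theta> 1" using a a' by (simp add: transpose_def)
    show thesis
    proof (rule that[of "Suc a"])
      show "Suc a \<le> a'" using a a' PQ by simp
      show "?w ?\<theta> # block_args p ?\<theta> i = ?xs[Suc a := ?xs ! Suc a', Suc a' := ?xs ! Suc a]"
        unfolding e1 e2 init by (simp only: list_update_code nth_Cons_Suc)
    qed
  qed
  have "phi ?\<theta> = \<Psi> (left_normed (Bracket (?w ?\<theta> # block_args p ?\<theta> i)) ?R)"
    unfolding phi_def comb_word_split[OF i] R ..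
  also have "\<dots> = - \<Psi> (left_normed (Bracket ?xs) ?R)"
    unfolding list_eq using filippov_functional_antisymmetric[OF F' xs, of j "Suc a'"] j a'(1) by simp
  also have "\<Psi> (left_normed (Bracket ?xs) ?R) = phi \<theta>"
    unfolding phi_def comb_word_split[OF i] ..
  finally show ?thesis .
qed

text \<open>In blocks 0 and 1 the head \<open>w\<close> is a letter, so one Jacobi identity
  suffices: the terms \<open>[[v_a, u], v[a := w]]\<close> already continue to left-normed
  words.\<close>

lemma phi_exchange_head:
  assumes \<theta>: "\<theta> permutes S" and "1 < K"
  shows "phi \<theta> = phi (\<theta> \<circ> block_swap p 0 p) - (\<Sum>a<p. phi (\<theta> \<circ> transpose 1 (2 + a) \<circ> block_swap p 0 p))"
proof -
  let ?R = "map (block_args p \<theta>) [2..<K]"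
  have "?R \<in> lists (nary_args p S)" using \<theta> by (intro block_args_lists) auto
  from filippov_functional_left_normed[OF functional this]
  have F': "filippov_functional p S (\<lambda>w. \<Psi> (left_normed w ?R))" .
  have split: "phi \<theta> = \<Psi> (left_normed (Bracket (Bracket (Letter (\<theta> 1) # block_args p \<theta> 0) # block_args p \<theta> 1)) (map (block_args p \<theta>) [2..<K]))" for \<theta>
    using comb_word_split2[of 0 K p \<theta>] \<open>1 < K\<close> by (simp add: phi_def numeral_2_eq_2)
  have swap: "phi (\<theta> \<circ> block_swap p 0 p) = \<Psi> (left_normed (Bracket (Bracket (Letter (\<theta> 1) # block_args p \<theta> 1) # block_args p \<theta> 0)) (map (block_args p \<theta>) [2..<K]))" for \<theta>
  proof -
    have K1: "Suc 0 < K" using \<open>1 < K\<close> by simp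
    have fx: "block_swap p 0 p x = x" if "x \<ge> 2" "pos_block p x \<noteq> 0" "pos_block p x \<noteq> Suc 0" for x
      by (rule block_swap_fixes[OF p that]) simp
    show ?thesis
      using phi_comp[OF K1 fx block_swap_1, of \<theta>]
      by (simp only: block_args_block_swap) (simp add: numeral_2_eq_2)
  qed
  have ex: "phi (\<theta> \<circ> transpose 1 (2 + a) \<circ> block_swap p 0 p) =
     \<Psi> (left_normed (Bracket (Bracket (block_args p \<theta> 0 ! a # block_args p \<theta> 1) # (block_args p \<theta> 0)[a := Letter (\<theta> 1)])) ?R)"
    if "a < p" for a
  proof -
    have "block_args p (\<theta> \<circ> transpose 1 (2 + a)) b = block_args p \<theta> b" if "b \<noteq> 0" for b
    proof (rule block_args_cong)
      fix x assume "pos_block p x = b" "x \<ge> 2"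
      then have "x \<noteq> 1" "x \<noteq> 2 + a" using that \<open>a < p\<close> pos_block_eq[of a p 0] by auto
      then show "(\<theta> \<circ> transpose 1 (2 + a)) x = \<theta> x" by simp
    qed
    then have e1: "map (block_args p (\<theta> \<circ> transpose 1 (2 + a))) [2..<K] = ?R"
      "block_args p (\<theta> \<circ> transpose 1 (2 + a)) 1 = block_args p \<theta> 1" by (auto simp del: upt_Suc)
    have e2: "block_args p (\<theta> \<circ> transpose 1 (2 + a)) 0 = (block_args p \<theta> 0)[a := Letter (\<theta> 1)]"
      using that by (auto intro!: nth_equalityI simp: nth_list_update transpose_def)
    have e3: "Letter ((\<theta> \<circ> transpose 1 (2 + a)) 1) = block_args p \<theta> 0 ! a" using that by simp
    show ?thesis unfolding swap e1 e2 e3 ..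
  qed
  have w: "Letter (\<theta> 1) \<in> nwords (Suc p) S" using initial_word[OF \<theta>, of 0] by simp
  have "(\<Sum>a<p. phi (\<theta> \<circ> transpose 1 (2 + a) \<circ> block_swap p 0 p)) =
     (\<Sum>a<p. \<Psi> (left_normed (Bracket (Bracket (block_args p \<theta> 0 ! a # block_args p \<theta> 1) # (block_args p \<theta> 0)[a := Letter (\<theta> 1)])) ?R))"
    by (intro sum.cong refl ex) auto
  then show ?thesis
    unfolding swap split[of \<theta>]
    using filippov_functional_exchange_head[OF F' block_args_nary[OF \<theta>] block_args_nary[OF \<theta>] w, of 0 1] \<open>1 < K\<close>
    by simp
qed

end

section \<open>Signed sums over arrangements\<close>

lemma permutes_comp_transpose:
  assumes "\<theta> permutes A"
  shows "\<theta> \<circ> transpose a b = transpose (\<theta> a) (\<theta> b) \<circ> \<theta>"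
  using permutes_inj[OF assms] by (auto simp: fun_eq_iff transpose_def inj_eq)

lemma permutes_sign_compose:
  assumes "finite A" "\<sigma> permutes A" "\<tau> permutes A"
  shows "sign (\<sigma> \<circ> \<tau>) = sign \<sigma> * sign \<tau>"
  using assms by (intro sign_compose) (auto simp: permutation_permutes)

context comb_functional
begin

text \<open>\<open>b\<close> prescribes a block for each position and \<beta> for each letter.
  Keeping \<open>b\<close> apart from \<open>pos_block p\<close> lets permutations of the positions
  act on it.\<close>

definition arrangements :: "(nat \<Rightarrow> nat) \<Rightarrow> (nat \<Rightarrow> nat) \<Rightarrow> (nat \<Rightarrow> nat) set" where
  "arrangements b \<beta> = {\<theta>. \<theta> permutes S \<and> (\<forall>x\<in>S. \<beta> (\<theta> x) = b x)}"

definition arrangement_sum :: "(nat \<Rightarrow> nat) \<Rightarrow> (nat \<Rightarrow> nat) \<Rightarrow> complex" where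
  "arrangement_sum b \<beta> = (\<Sum>\<theta>\<in>arrangements b \<beta>. of_int (sign \<theta>) * phi \<theta>)"

definition block_sum :: "(nat \<Rightarrow> nat) \<Rightarrow> complex" where
  "block_sum = arrangement_sum (pos_block p)"

lemma finite_arrangements [simp]: "finite (arrangements b \<beta>)"
  by (rule finite_subset[OF _ finite_permutations[of S]]) (auto simp: arrangements_def)

lemma arrangements_permutes: "\<theta> \<in> arrangements b \<beta> \<Longrightarrow> \<theta> permutes S"
  by (simp add: arrangements_def)

lemma sum_arrangements_comp:
  assumes \<tau>: "\<tau> permutes S"
  shows "(\<Sum>\<theta>\<in>arrangements b \<beta>. of_int (sign \<theta>) * phi (\<theta> \<circ> \<tau>)) = of_int (sign \<tau>) * arrangement_sum (b \<circ> \<tau>) \<beta>"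
proof -
  have "(\<Sum>\<theta>\<in>arrangements b \<beta>. of_int (sign \<theta>) * phi (\<theta> \<circ> \<tau>)) =
    (\<Sum>\<theta>\<in>arrangements (b \<circ> \<tau>) \<beta>. of_int (sign \<tau>) * (of_int (sign \<theta>) * phi \<theta>))"
  proof (rule sum.reindex_bij_witness[where i = "\<lambda>\<theta>. \<theta> \<circ> Hilbert_Choice.inv \<tau>" and j = "\<lambda>\<theta>. \<theta> \<circ> \<tau>"])
    fix \<theta> assume \<theta>: "\<theta> \<in> arrangements b \<beta>"
    show "\<theta> \<circ> \<tau> \<circ> Hilbert_Choice.inv \<tau> = \<theta>" using \<tau> by (simp add: comp_assoc permutes_inv_o)
    show "\<theta> \<circ> \<tau> \<in> arrangements (b \<circ> \<tau>) \<beta>"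
      using \<theta> \<tau> permutes_in_image[OF \<tau>] by (auto simp: arrangements_def intro: permutes_compose)
    have "sign (\<theta> \<circ> \<tau>) = sign \<theta> * sign \<tau>"
      using arrangements_permutes[OF \<theta>] \<tau> by (intro permutes_sign_compose[of S]) auto
    then show "of_int (sign \<tau>) * (of_int (sign (\<theta> \<circ> \<tau>)) * phi (\<theta> \<circ> \<tau>)) = of_int (sign \<theta>) * phi (\<theta> \<circ> \<tau>)"
      by (auto simp: sign_def)
  next
    fix \<theta> assume \<theta>: "\<theta> \<in> arrangements (b \<circ> \<tau>) \<beta>"
    show "\<theta> \<circ> Hilbert_Choice.inv \<tau> \<circ> \<tau> = \<theta>" using \<tau> by (simp add: comp_assoc permutes_inv_o)
    have inv: "Hilbert_Choice.inv \<tau> permutes S" using \<tau> by (rule permutes_inv)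
    show "\<theta> \<circ> Hilbert_Choice.inv \<tau> \<in> arrangements b \<beta>"
      unfolding arrangements_def
    proof (intro CollectI conjI ballI)
      show "\<theta> \<circ> Hilbert_Choice.inv \<tau> permutes S" using \<theta> inv by (auto simp: arrangements_def intro: permutes_compose)
      fix x assume "x \<in> S"
      then have "Hilbert_Choice.inv \<tau> x \<in> S" using permutes_in_image[OF inv] by blast
      then have "\<beta> (\<theta> (Hilbert_Choice.inv \<tau> x)) = b (\<tau> (Hilbert_Choice.inv \<tau> x))" using \<theta> by (auto simp: arrangements_def)
      then show "\<beta> ((\<theta> \<circ> Hilbert_Choice.inv \<tau>) x) = b x" using permutes_inverses(1)[OF \<tau>] by simp
    qed
  qed
  then show ?thesis by (simp add: arrangement_sum_def sum_distrib_left)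
qed

lemma arrangements_cong:
  assumes "\<And>x. x \<in> S \<Longrightarrow> b x = b' x"
  shows "arrangements b \<beta> = arrangements b' \<beta>"
  using assms by (auto simp: arrangements_def)

lemma positions_of_block:
  assumes "b < K"
  shows "{x \<in> S. pos_block p x = b} = (if b = 0 then {1} else {}) \<union> (\<lambda>a. b * p + 2 + a) ` {..<p}"
proof (intro equalityI subsetI)
  fix x assume x: "x \<in> {x \<in> S. pos_block p x = b}"
  show "x \<in> (if b = 0 then {1} else {}) \<union> (\<lambda>a. b * p + 2 + a) ` {..<p}"
    by (rule pos_block_cases[OF p, of x]) (use x in auto)
next
  fix x assume "x \<in> (if b = 0 then {1} else {}) \<union> (\<lambda>a. b * p + 2 + a) ` {..<p}"
  then consider "b = 0" "x = 1" | a where "a < p" "x = b * p + 2 + a" by (auto split: if_splits)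
  then show "x \<in> {x \<in> S. pos_block p x = b}"
  proof cases
    case 1
    then show ?thesis by (simp add: pos_block_def)
  next
    case 2
    then show ?thesis using pos_block_eq[of a p b] position_in_range[OF assms, of a p] by simp
  qed
qed

lemma card_positions:
  assumes "b < K"
  shows "card {x \<in> S. pos_block p x = b} = (if b = 0 then p + 1 else p)"
proof -
  have "card ((\<lambda>a. b * p + 2 + a) ` {..<p}) = p" by (subst card_image) (auto simp: inj_on_def)
  moreover have "1 \<notin> (\<lambda>a. b * p + 2 + a) ` {..<p}" by auto
  ultimately show ?thesis unfolding positions_of_block[OF assms] by auto
qed

lemma arrangements_bij:
  assumes "\<theta> \<in> arrangements b \<beta>"
  shows "bij_betw \<theta> {x \<in> S. b x = c} {l \<in> S. \<beta> l = c}"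
proof -
  have \<theta>: "\<theta> permutes S" "\<forall>x\<in>S. \<beta> (\<theta> x) = b x" using assms by (auto simp: arrangements_def)
  show ?thesis
  proof (rule bij_betw_imageI)
    show "inj_on \<theta> {x \<in> S. b x = c}" using permutes_inj[OF \<theta>(1)] by (rule inj_on_subset) simp
    show "\<theta> ` {x \<in> S. b x = c} = {l \<in> S. \<beta> l = c}"
    proof (intro equalityI subsetI)
      fix l assume "l \<in> \<theta> ` {x \<in> S. b x = c}"
      then obtain x where x: "x \<in> S" "b x = c" "l = \<theta> x" by blast
      then have "l \<in> S" using permutes_in_image[OF \<theta>(1)] by blast
      then show "l \<in> {l \<in> S. \<beta> l = c}" using \<theta>(2) x by simp
    next
      fix l assume l: "l \<in> {l \<in> S. \<beta> l = c}"
      then obtain x where "x \<in> S" "l = \<theta> x" using permutes_image[OF \<theta>(1)] by blast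
      then show "l \<in> \<theta> ` {x \<in> S. b x = c}" using \<theta>(2) l by auto
    qed
  qed
qed

section \<open>Weight and symmetries of the signed block sums\<close>

lemma block_sum_support:
  assumes "block_sum \<beta> \<noteq> 0"
  shows "l \<in> S \<Longrightarrow> \<beta> l < K" and "b < K \<Longrightarrow> card {l \<in> S. \<beta> l = b} = (if b = 0 then p + 1 else p)"
proof -
  obtain \<theta> where \<theta>: "\<theta> \<in> arrangements (pos_block p) \<beta>"
    using assms unfolding block_sum_def arrangement_sum_def by (meson sum.not_neutral_contains_not_neutral)
  have per: "\<theta> permutes S" using arrangements_permutes[OF \<theta>] .
  show "\<beta> l < K" if "l \<in> S"
  proof -
    have "l \<in> \<theta> ` S" unfolding permutes_image[OF per] by (rule that)
    then obtain x where x: "x \<in> S" "l = \<theta> x" by (elim imageE)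
    then have "\<beta> l = pos_block p x" using \<theta> unfolding arrangements_def by blast
    then show ?thesis using pos_block_less[OF p K x(1)] by (simp only:)
  qed
  show "card {l \<in> S. \<beta> l = b} = (if b = 0 then p + 1 else p)" if "b < K"
    using bij_betw_same_card[OF arrangements_bij[OF \<theta>, of b]] card_positions[OF that] by simp
qed

lemma block_sum_local:
  assumes "\<And>l. l \<in> S \<Longrightarrow> \<beta> l = \<beta>' l"
  shows "block_sum \<beta> = block_sum \<beta>'"
proof -
  have "\<theta> x \<in> S" if "\<theta> permutes S" "x \<in> S" for \<theta> x using permutes_in_image[OF that(1)] that(2) by blast
  then have "arrangements (pos_block p) \<beta> = arrangements (pos_block p) \<beta>'"
    using assms by (auto simp: arrangements_def)
  then show ?thesis by (simp add: block_sum_def arrangement_sum_def)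
qed

lemma block_sum_swap_blocks:
  "swap_op i j block_sum \<beta> = arrangement_sum (transpose i j \<circ> pos_block p) \<beta>"
proof -
  have "transpose i j u = v \<longleftrightarrow> u = transpose i j v" for u v :: nat by (metis transpose_involutory)
  then have "arrangements (pos_block p) (transpose i j \<circ> \<beta>) = arrangements (transpose i j \<circ> pos_block p) \<beta>"
    unfolding arrangements_def comp_apply by blast
  then show ?thesis by (simp add: swap_op_def block_sum_def arrangement_sum_def)
qed

lemma block_sum_transpose_letters:
  assumes l: "l \<in> S" "l' \<in> S" "l \<noteq> l'"
  shows "block_sum (\<beta> \<circ> transpose l l') =
    - (\<Sum>\<theta>\<in>arrangements (pos_block p) \<beta>. of_int (sign \<theta>) * phi (transpose l l' \<circ> \<theta>))"
proof -
  let ?t = "transpose l l'"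
  have t: "?t permutes S" using l by (intro permutes_swap_id) auto
  have "block_sum (\<beta> \<circ> ?t) = (\<Sum>\<theta>\<in>arrangements (pos_block p) \<beta>. - (of_int (sign \<theta>) * phi (?t \<circ> \<theta>)))"
    unfolding block_sum_def arrangement_sum_def
  proof (rule sum.reindex_bij_witness[where i = "\<lambda>\<theta>. ?t \<circ> \<theta>" and j = "\<lambda>\<theta>. ?t \<circ> \<theta>"])
    fix \<theta> assume \<theta>: "\<theta> \<in> arrangements (pos_block p) (\<beta> \<circ> ?t)"
    show "?t \<circ> (?t \<circ> \<theta>) = \<theta>" by (simp flip: comp_assoc)
    show "?t \<circ> \<theta> \<in> arrangements (pos_block p) \<beta>"
      using \<theta> t by (auto simp: arrangements_def intro: permutes_compose)
    have "sign (?t \<circ> \<theta>) = - sign \<theta>"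
      using permutes_sign_compose[OF _ t arrangements_permutes[OF \<theta>]] l by (simp add: sign_swap_id)
    then show "- (of_int (sign (?t \<circ> \<theta>)) * phi (?t \<circ> (?t \<circ> \<theta>))) = of_int (sign \<theta>) * phi \<theta>"
      by (simp flip: comp_assoc)
  next
    fix \<theta> assume \<theta>: "\<theta> \<in> arrangements (pos_block p) \<beta>"
    show "?t \<circ> (?t \<circ> \<theta>) = \<theta>" by (simp flip: comp_assoc)
    show "?t \<circ> \<theta> \<in> arrangements (pos_block p) (\<beta> \<circ> ?t)"
      using \<theta> t by (auto simp: arrangements_def intro: permutes_compose)
  qed
  then show ?thesis by (simp add: sum_negf)
qed

text \<open>On the left a letter enters block \<open>i\<close> and a letter leaves it. If it is the
  same one, \<beta> is restored, once for each of the \<open>p\<close> letters of block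
  \<open>i + 1\<close>; otherwise two letters are exchanged, with a sign. Summing
  \<open>phi_exchange\<close> over the arrangements evaluates these exchanges through the swap of
  the whole blocks. For \<open>i \<ge> 1\<close> both blocks consist of exactly the swapped
  positions.\<close>

lemma block_sum_exchange:
  assumes i: "1 \<le> i" "Suc i < K"
  shows "gl_op S K (mat_unit (Suc i) i) (gl_op S K (mat_unit i (Suc i)) block_sum) =
    block_sum - ((-1) ^ p) *\<^sub>R swap_op i (Suc i) block_sum"
proof
  fix \<beta> :: "nat \<Rightarrow> nat"
  let ?A = "arrangements (pos_block p) \<beta>"
  let ?L = "{l. l \<in> S \<and> \<beta> l = Suc i}" and ?L' = "{l. l \<in> S \<and> \<beta> l = i}"
  let ?P = "{x \<in> S. pos_block p x = Suc i}" and ?P' = "{x \<in> S. pos_block p x = i}"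
  have iK: "i < K" using i by simp
  define X where "X = (\<Sum>\<theta>\<in>?A. of_int (sign \<theta>) * (\<Sum>a<p. \<Sum>b<p. phi (\<theta> \<circ> transpose (i * p + 2 + a) (Suc i * p + 2 + b))))"
  have inner: "(\<Sum>l' | l' \<in> S \<and> (\<beta>(l := i)) l' = i. block_sum (\<beta>(l := i, l' := Suc i))) =
     block_sum \<beta> + (\<Sum>l'\<in>?L'. block_sum (\<beta> \<circ> transpose l l'))" if l: "l \<in> ?L" for l
  proof -
    have "{l'. l' \<in> S \<and> (\<beta>(l := i)) l' = i} = insert l ?L'" using l by auto
    moreover have "l \<notin> ?L'" using l by auto
    moreover have "\<beta>(l := i, l := Suc i) = \<beta>" using l by auto
    moreover have "\<beta>(l := i, l' := Suc i) = \<beta> \<circ> transpose l l'" if "l' \<in> ?L'" for l'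
      using l that by (auto simp: fun_eq_iff transpose_def)
    ultimately show ?thesis by simp
  qed
  have "gl_op S K (mat_unit (Suc i) i) (gl_op S K (mat_unit i (Suc i)) block_sum) \<beta> =
     (\<Sum>l\<in>?L. \<Sum>l' | l' \<in> S \<and> (\<beta>(l := i)) l' = i. block_sum (\<beta>(l := i, l' := Suc i)))"
    using i by (simp only: gl_op_mat_unit[OF iK finite_atLeastAtMost] gl_op_mat_unit[OF i(2) finite_atLeastAtMost])
  also have "\<dots> = (\<Sum>l\<in>?L. block_sum \<beta> + (\<Sum>l'\<in>?L'. block_sum (\<beta> \<circ> transpose l l')))"
    by (rule sum.cong[OF refl inner])
  also have "\<dots> = of_nat (card ?L) * block_sum \<beta> + (\<Sum>l\<in>?L. \<Sum>l'\<in>?L'. block_sum (\<beta> \<circ> transpose l l'))"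
    by (simp add: sum.distrib)
  \<comment> \<open>The block size \<open>p\<close> is guaranteed only on the support of
    \<open>block_sum\<close>; elsewhere both sides are 0.\<close>
  also have "of_nat (card ?L) * block_sum \<beta> = of_nat p * block_sum \<beta>"
    using block_sum_support(2)[of \<beta> "Suc i"] i by (cases "block_sum \<beta> = 0") auto
  also have "(\<Sum>l\<in>?L. \<Sum>l'\<in>?L'. block_sum (\<beta> \<circ> transpose l l')) =
     (\<Sum>l\<in>?L. \<Sum>l'\<in>?L'. - (\<Sum>\<theta>\<in>?A. of_int (sign \<theta>) * phi (transpose l l' \<circ> \<theta>)))"
    by (intro sum.cong refl block_sum_transpose_letters) auto
  also have "\<dots> = - (\<Sum>\<theta>\<in>?A. of_int (sign \<theta>) * (\<Sum>l\<in>?L. \<Sum>l'\<in>?L'. phi (transpose l l' \<circ> \<theta>)))"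
  proof -
    have "(\<Sum>l\<in>?L. \<Sum>l'\<in>?L'. \<Sum>\<theta>\<in>?A. of_int (sign \<theta>) * phi (transpose l l' \<circ> \<theta>)) =
       (\<Sum>\<theta>\<in>?A. \<Sum>l\<in>?L. \<Sum>l'\<in>?L'. of_int (sign \<theta>) * phi (transpose l l' \<circ> \<theta>))"
      by (rule trans[OF sum.cong[OF refl sum.swap] sum.swap])
    then show ?thesis by (simp add: sum_negf sum_distrib_left)
  qed
  also have "\<dots> = - X"
  proof -
    have "(\<Sum>l\<in>?L. \<Sum>l'\<in>?L'. phi (transpose l l' \<circ> \<theta>)) =
       (\<Sum>a<p. \<Sum>b<p. phi (\<theta> \<circ> transpose (i * p + 2 + a) (Suc i * p + 2 + b)))" if \<theta>: "\<theta> \<in> ?A" for \<theta>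
    proof -
      have b: "bij_betw \<theta> ?P {l \<in> S. \<beta> l = Suc i}" "bij_betw \<theta> ?P' {l \<in> S. \<beta> l = i}"
        using arrangements_bij[OF \<theta>] by auto
      have P: "?P = (\<lambda>a. Suc i * p + 2 + a) ` {..<p}" "?P' = (\<lambda>a. i * p + 2 + a) ` {..<p}"
        using positions_of_block[OF i(2)] positions_of_block[OF iK] i(1) by auto
      have "(\<Sum>l\<in>?L. \<Sum>l'\<in>?L'. phi (transpose l l' \<circ> \<theta>)) = (\<Sum>x\<in>?P. \<Sum>x'\<in>?P'. phi (transpose (\<theta> x) (\<theta> x') \<circ> \<theta>))"
        by (simp only: sum.reindex_bij_betw[OF b(1), symmetric] sum.reindex_bij_betw[OF b(2), symmetric])
      also have "\<dots> = (\<Sum>b<p. \<Sum>a<p. phi (\<theta> \<circ> transpose (i * p + 2 + a) (Suc i * p + 2 + b)))"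
        unfolding P by (simp add: sum.reindex inj_on_def transpose_commute permutes_comp_transpose[OF arrangements_permutes[OF \<theta>]])
      finally show ?thesis by (subst (asm) sum.swap)
    qed
    then show ?thesis by (simp add: X_def)
  qed
  finally have lhs: "gl_op S K (mat_unit (Suc i) i) (gl_op S K (mat_unit i (Suc i)) block_sum) \<beta> = of_nat p * block_sum \<beta> - X"
    by simp
  have bs: "block_swap p i p permutes S" "sign (block_swap p i p) = (-1) ^ p"
    using block_swap_permutes_sign[OF i(2), of p p] by auto
  have "(\<Sum>\<theta>\<in>?A. of_int (sign \<theta>) * phi (\<theta> \<circ> block_swap p i p)) = (-1) ^ p * swap_op i (Suc i) block_sum \<beta>"
  proof -
    have "pos_block p (block_swap p i p x) = transpose i (Suc i) (pos_block p x)" if "x \<in> S" for x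
    proof (cases "x = 1")
      case True
      then show ?thesis using i by (simp add: block_swap_def pos_block_def transpose_def)
    next
      case False
      then show ?thesis using that by (intro pos_block_block_swap p) auto
    qed
    then have "arrangement_sum (pos_block p \<circ> block_swap p i p) \<beta> = arrangement_sum (transpose i (Suc i) \<circ> pos_block p) \<beta>"
      unfolding arrangement_sum_def by (intro sum.cong arrangements_cong) auto
    then show ?thesis
      by (simp add: sum_arrangements_comp[OF bs(1)] bs(2) block_sum_swap_blocks)
  qed
  moreover have "block_sum \<beta> = (\<Sum>\<theta>\<in>?A. of_int (sign \<theta>) * phi (\<theta> \<circ> block_swap p i p)) + of_nat p * block_sum \<beta> - X"
  proof -
    have "block_sum \<beta> = (\<Sum>\<theta>\<in>?A. of_int (sign \<theta>) * (phi (\<theta> \<circ> block_swap p i p) + of_nat p * phi \<theta> -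
       (\<Sum>a<p. \<Sum>b<p. phi (\<theta> \<circ> transpose (i * p + 2 + a) (Suc i * p + 2 + b)))))"
      unfolding block_sum_def arrangement_sum_def
      by (intro sum.cong refl arg_cong2[of _ _ _ _ "(*)"] phi_exchange arrangements_permutes i(2))
    also have "\<dots> = (\<Sum>\<theta>\<in>?A. of_int (sign \<theta>) * phi (\<theta> \<circ> block_swap p i p)) +
       (\<Sum>\<theta>\<in>?A. of_nat p * (of_int (sign \<theta>) * phi \<theta>)) - X"
      unfolding X_def sum.distrib[symmetric] sum_subtractf[symmetric]
      by (intro sum.cong refl) (simp only: algebra_simps)
    also have "(\<Sum>\<theta>\<in>?A. of_nat p * (of_int (sign \<theta>) * phi \<theta>)) = of_nat p * block_sum \<beta>"
      by (simp add: block_sum_def arrangement_sum_def sum_distrib_left)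
    finally show ?thesis .
  qed
  ultimately have "of_nat p * block_sum \<beta> - X = block_sum \<beta> - (-1) ^ p * swap_op i (Suc i) block_sum \<beta>"
    by (metis add_diff_cancel_left' add_diff_eq)
  then show "gl_op S K (mat_unit (Suc i) i) (gl_op S K (mat_unit i (Suc i)) block_sum) \<beta> =
    (block_sum - ((-1) ^ p) *\<^sub>R swap_op i (Suc i) block_sum) \<beta>"
    unfolding lhs by (simp add: scaleR_conv_of_real)
qed

text \<open>Up to sign both sides are \<open>p + 1\<close> times the sum for \<open>c 1\<close>, in
  which blocks 0 and 1 are exchanged except for position 1. On the left these are the
  \<open>p + 1\<close> terms of \<open>phi_exchange_head\<close>, re-indexed. On the right there is
  one sum \<open>c q\<close> for each position \<open>q\<close> of block 0 at which the recoloured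
  letter may stand.\<close>

lemma block_sum_exchange_head:
  assumes "1 < K"
  shows "block_sum = ((-1) ^ p) *\<^sub>R swap_op 0 1 (gl_op S K (mat_unit 1 0) block_sum)"
proof
  fix \<beta> :: "nat \<Rightarrow> nat"
  let ?A = "arrangements (pos_block p) \<beta>"
  let ?t = "transpose 0 (1::nat)"
  let ?P = "{x \<in> S. pos_block p x = 0}"
  define c where "c q x = (if x = q then 0 else ?t (pos_block p x))" for q x
  have bs: "block_swap p 0 p permutes S" "sign (block_swap p 0 p) = (-1) ^ p"
    using block_swap_permutes_sign[of 0 K p p] assms by auto
  have P: "?P = insert 1 ((\<lambda>a. 2 + a) ` {..<p})" using positions_of_block[of 0] assms by simp
  have one: "1 \<in> S" by simp
  \<comment> \<open>Exchanging positions 1 and \<open>q\<close> costs one sign by re-indexing and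
    another by antisymmetry in block 0.\<close>
  have c: "arrangement_sum (c q) \<beta> = arrangement_sum (c 1) \<beta>" if q: "q \<in> ?P" for q
  proof (cases "q = 1")
    case False
    then have "1 < q" using q by auto
    have b1: "pos_block p 1 = 0" by (simp add: pos_block_def)
    have "transpose 1 q permutes S" using q by (intro permutes_swap_id) auto
    note comp = sum_arrangements_comp[OF this]
    have "c q \<circ> transpose 1 q = c 1"
      using q b1 by (auto simp: c_def fun_eq_iff transpose_def)
    then have "(\<Sum>\<theta>\<in>arrangements (c q) \<beta>. of_int (sign \<theta>) * phi (\<theta> \<circ> transpose 1 q)) = - arrangement_sum (c 1) \<beta>"
      using comp[of "c q" \<beta>] \<open>1 < q\<close> by (simp add: sign_swap_id)
    moreover have "(\<Sum>\<theta>\<in>arrangements (c q) \<beta>. of_int (sign \<theta>) * phi (\<theta> \<circ> transpose 1 q)) =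
       (\<Sum>\<theta>\<in>arrangements (c q) \<beta>. of_int (sign \<theta>) * - phi \<theta>)"
      using q b1 \<open>1 < q\<close> by (intro sum.cong refl arg_cong2[of _ _ _ _ "(*)"] phi_antisymmetric arrangements_permutes) auto
    ultimately show ?thesis by (simp add: arrangement_sum_def sum_negf)
  qed simp
  have "swap_op 0 1 (gl_op S K (mat_unit 1 0) block_sum) \<beta> =
     (\<Sum>l | l \<in> S \<and> (?t \<circ> \<beta>) l = 1. block_sum ((?t \<circ> \<beta>)(l := 0)))"
    using assms by (simp only: swap_op_def gl_op_mat_unit[of 0 K, OF _ finite_atLeastAtMost])
  also have "\<dots> = (\<Sum>l | l \<in> S \<and> \<beta> l = 0. \<Sum>\<theta> | \<theta> permutes S \<and> \<theta> \<in> arrangements (pos_block p) ((?t \<circ> \<beta>)(l := 0)).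
      of_int (sign \<theta>) * phi \<theta>)"
    by (intro sum.cong) (auto simp: transpose_def block_sum_def arrangement_sum_def arrangements_def split: if_splits)
  also have "\<dots> = (\<Sum>\<theta> | \<theta> permutes S. \<Sum>l | l \<in> {l. l \<in> S \<and> \<beta> l = 0} \<and> \<theta> \<in> arrangements (pos_block p) ((?t \<circ> \<beta>)(l := 0)).
      of_int (sign \<theta>) * phi \<theta>)"
    by (subst sum.swap_restrict) (auto intro: finite_permutations)
  \<comment> \<open>With \<theta> fixed in the outer sum, the letters \<open>l\<close> can be
    indexed by their positions \<open>q\<close>, where \<open>l = \<theta> q\<close>.\<close>
  also have "\<dots> = (\<Sum>\<theta> | \<theta> permutes S. \<Sum>q | q \<in> ?P \<and> \<theta> \<in> arrangements (c q) \<beta>. of_int (sign \<theta>) * phi \<theta>)"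
  proof (rule sum.cong[OF refl])
    fix \<theta> assume "\<theta> \<in> {\<theta>. \<theta> permutes S}"
    then have \<theta>: "\<theta> permutes S" by simp
    have inS: "\<theta> x \<in> S \<longleftrightarrow> x \<in> S" for x using permutes_in_image[OF \<theta>] .
    have inj: "\<theta> x = \<theta> y \<longleftrightarrow> x = y" for x y using permutes_inj[OF \<theta>] by (simp add: inj_eq)
    have iff: "\<beta> (\<theta> q) = 0 \<and> \<theta> \<in> arrangements (pos_block p) ((?t \<circ> \<beta>)(\<theta> q := 0)) \<longleftrightarrow> q \<in> ?P \<and> \<theta> \<in> arrangements (c q) \<beta>"
      if q: "q \<in> S" for q
    proof -
      have "(\<forall>x\<in>S. ((?t \<circ> \<beta>)(\<theta> q := 0)) (\<theta> x) = pos_block p x) \<longleftrightarrow> pos_block p q = 0 \<and> (\<forall>x\<in>S - {q}. \<beta> (\<theta> x) = ?t (pos_block p x))"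
      proof -
        have upd: "((?t \<circ> \<beta>)(\<theta> q := 0)) (\<theta> x) = (if x = q then 0 else ?t (\<beta> (\<theta> x)))" for x by (simp add: inj)
        have teq: "?t u = v \<longleftrightarrow> u = ?t v" for u v by (metis transpose_involutory)
        show ?thesis unfolding upd
        proof (intro iffI conjI ballI)
          assume L: "\<forall>x\<in>S. (if x = q then 0 else ?t (\<beta> (\<theta> x))) = pos_block p x"
          show "pos_block p q = 0" using bspec[OF L q] by simp
          fix x assume "x \<in> S - {q}"
          then have "x \<in> S" "x \<noteq> q" by blast+
          then have "?t (\<beta> (\<theta> x)) = pos_block p x" using bspec[OF L \<open>x \<in> S\<close>] by (simp only: if_False)
          then show "\<beta> (\<theta> x) = ?t (pos_block p x)" by (rule teq[THEN iffD1])
        next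
          fix x assume R: "pos_block p q = 0 \<and> (\<forall>x\<in>S - {q}. \<beta> (\<theta> x) = ?t (pos_block p x))" and x: "x \<in> S"
          have "?t (\<beta> (\<theta> x)) = pos_block p x" if "x \<noteq> q"
            using R x that unfolding teq by blast
          then show "(if x = q then 0 else ?t (\<beta> (\<theta> x))) = pos_block p x" using R by simp
        qed
      qed
      moreover have "(\<forall>x\<in>S. \<beta> (\<theta> x) = c q x) \<longleftrightarrow> \<beta> (\<theta> q) = 0 \<and> (\<forall>x\<in>S - {q}. \<beta> (\<theta> x) = ?t (pos_block p x))"
        using q by (auto simp: c_def)
      ultimately show ?thesis using \<theta> q unfolding arrangements_def by blast
    qed
    have "{l. l \<in> {l. l \<in> S \<and> \<beta> l = 0} \<and> \<theta> \<in> arrangements (pos_block p) ((?t \<circ> \<beta>)(l := 0))} =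
      \<theta> ` {q. q \<in> ?P \<and> \<theta> \<in> arrangements (c q) \<beta>}"
    proof (intro equalityI subsetI)
      fix l assume l: "l \<in> {l. l \<in> {l. l \<in> S \<and> \<beta> l = 0} \<and> \<theta> \<in> arrangements (pos_block p) ((?t \<circ> \<beta>)(l := 0))}"
      then obtain q where "q \<in> S" "l = \<theta> q" using permutes_image[OF \<theta>] by blast
      then show "l \<in> \<theta> ` {q. q \<in> ?P \<and> \<theta> \<in> arrangements (c q) \<beta>}" using iff[of q] l by blast
    next
      fix l assume "l \<in> \<theta> ` {q. q \<in> ?P \<and> \<theta> \<in> arrangements (c q) \<beta>}"
      then obtain q where q: "q \<in> ?P" "\<theta> \<in> arrangements (c q) \<beta>" "l = \<theta> q" by blast
      then have "q \<in> S" by blast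
      then show "l \<in> {l. l \<in> {l. l \<in> S \<and> \<beta> l = 0} \<and> \<theta> \<in> arrangements (pos_block p) ((?t \<circ> \<beta>)(l := 0))}"
        using iff[of q] q inS[of q] by blast
    qed
    moreover have "inj_on \<theta> B" for B using permutes_inj[OF \<theta>] by (rule inj_on_subset) simp
    ultimately show "(\<Sum>l | l \<in> {l. l \<in> S \<and> \<beta> l = 0} \<and> \<theta> \<in> arrangements (pos_block p) ((?t \<circ> \<beta>)(l := 0)). of_int (sign \<theta>) * phi \<theta>) =
      (\<Sum>q | q \<in> ?P \<and> \<theta> \<in> arrangements (c q) \<beta>. of_int (sign \<theta>) * phi \<theta>)"
      by (simp only: sum_constant card_image)
  qed
  also have "\<dots> = (\<Sum>q\<in>?P. \<Sum>\<theta> | \<theta> \<in> {\<theta>. \<theta> permutes S} \<and> \<theta> \<in> arrangements (c q) \<beta>. of_int (sign \<theta>) * phi \<theta>)"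
    by (rule sum.swap_restrict) (auto intro: finite_permutations)
  also have "\<dots> = (\<Sum>q\<in>?P. arrangement_sum (c q) \<beta>)"
    unfolding arrangement_sum_def by (intro sum.cong) (auto simp: arrangements_def)
  also have "\<dots> = (\<Sum>q\<in>?P. arrangement_sum (c 1) \<beta>)" by (rule sum.cong[OF refl c])
  also have "\<dots> = of_nat (p + 1) * arrangement_sum (c 1) \<beta>"
    using card_positions[of 0] assms by simp
  finally have rhs: "swap_op 0 1 (gl_op S K (mat_unit 1 0) block_sum) \<beta> = of_nat (p + 1) * arrangement_sum (c 1) \<beta>" .

  have sw: "arrangement_sum (pos_block p \<circ> block_swap p 0 p) \<beta> = arrangement_sum (c 1) \<beta>"
  proof -
    have "(pos_block p \<circ> block_swap p 0 p) x = c 1 x" if "x \<in> S" for x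
    proof (cases "x = 1")
      case True
      then show ?thesis using block_swap_1[of 0 p] by (simp add: c_def pos_block_def)
    next
      case False
      then have "pos_block p (block_swap p 0 p x) = transpose 0 (Suc 0) (pos_block p x)"
        using that by (intro pos_block_block_swap p) auto
      then show ?thesis using False by (simp add: c_def)
    qed
    then show ?thesis unfolding arrangement_sum_def by (intro sum.cong arrangements_cong) auto
  qed
  have term0: "(\<Sum>\<theta>\<in>?A. of_int (sign \<theta>) * phi (\<theta> \<circ> block_swap p 0 p)) = (-1) ^ p * arrangement_sum (c 1) \<beta>"
    using sum_arrangements_comp[OF bs(1), of "pos_block p" \<beta>] by (simp add: bs(2) sw)
  have term_a: "(\<Sum>\<theta>\<in>?A. of_int (sign \<theta>) * phi (\<theta> \<circ> transpose 1 (2 + a) \<circ> block_swap p 0 p)) = - ((-1) ^ p * arrangement_sum (c 1) \<beta>)"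
    if a: "a < p" for a
  proof -
    have "2 + a \<in> ?P" using a unfolding P by simp
    then have a2: "2 + a \<in> S" "pos_block p (2 + a) = 0" by auto
    have b1: "pos_block p 1 = 0" by (simp add: pos_block_def)
    have t: "transpose 1 (2 + a) permutes S" using a2 by (intro permutes_swap_id) auto
    have tb: "transpose 1 (2 + a) \<circ> block_swap p 0 p permutes S" using bs(1) t by (rule permutes_compose)
    have "sign (transpose 1 (2 + a) \<circ> block_swap p 0 p) = - ((-1) ^ p)"
      using permutes_sign_compose[OF _ t bs(1)] by (simp add: bs(2) sign_swap_id)
    moreover have "pos_block p \<circ> transpose 1 (2 + a) = pos_block p"
      using a2 b1 by (auto simp: fun_eq_iff transpose_def)
    then have "pos_block p \<circ> (transpose 1 (2 + a) \<circ> block_swap p 0 p) = pos_block p \<circ> block_swap p 0 p"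
      by (simp only: comp_assoc[symmetric])
    ultimately show ?thesis
      using sum_arrangements_comp[OF tb, of "pos_block p" \<beta>] by (simp add: sw comp_assoc)
  qed
  have "block_sum \<beta> = (\<Sum>\<theta>\<in>?A. of_int (sign \<theta>) * (phi (\<theta> \<circ> block_swap p 0 p) - (\<Sum>a<p. phi (\<theta> \<circ> transpose 1 (2 + a) \<circ> block_swap p 0 p))))"
    unfolding block_sum_def arrangement_sum_def
    by (intro sum.cong refl arg_cong2[of _ _ _ _ "(*)"] phi_exchange_head arrangements_permutes assms)
  also have "\<dots> = (\<Sum>\<theta>\<in>?A. of_int (sign \<theta>) * phi (\<theta> \<circ> block_swap p 0 p)) -
      (\<Sum>a<p. \<Sum>\<theta>\<in>?A. of_int (sign \<theta>) * phi (\<theta> \<circ> transpose 1 (2 + a) \<circ> block_swap p 0 p))"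
    unfolding right_diff_distrib sum_subtractf sum_distrib_left
    by (intro arg_cong2[of _ _ _ _ minus] refl sum.swap)
  also have "\<dots> = (-1) ^ p * arrangement_sum (c 1) \<beta> - (\<Sum>a<p. - ((-1) ^ p * arrangement_sum (c 1) \<beta>))"
    unfolding term0 by (intro arg_cong2[of _ _ _ _ minus] sum.cong refl term_a) auto
  also have "\<dots> = (-1) ^ p * (of_nat (p + 1) * arrangement_sum (c 1) \<beta>)"
    by (simp add: sum_negf algebra_simps)
  finally show "block_sum \<beta> = (((-1) ^ p) *\<^sub>R swap_op 0 1 (gl_op S K (mat_unit 1 0) block_sum)) \<beta>"
    using rhs by (simp add: scaleR_conv_of_real)
qed

end

section \<open>From the operator relations to the vanishing of the functional\<close>

context comb_functional
begin

lemma phi_block_permutation: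
  assumes "\<tau> permutes S" "\<And>x. x \<in> S \<Longrightarrow> pos_block p (\<tau> x) = pos_block p x" "\<theta> permutes S"
  shows "phi (\<theta> \<circ> \<tau>) = of_int (sign \<tau>) * phi \<theta>"
  using assms
proof (induction "card {x \<in> S. \<tau> x \<noteq> x}" arbitrary: \<tau> \<theta> rule: less_induct)
  case less
  note \<tau> = less.prems(1) and blk = less.prems(2) and \<theta> = less.prems(3)
  show ?case
  proof (cases "\<exists>y. \<tau> y \<noteq> y")
    case False
    then have "\<tau> = id" by auto
    then show ?thesis by simp
  next
    case True
    then obtain y where y: "\<tau> y \<noteq> y" by blast
    have yS: "y \<in> S" using y permutes_not_in[OF \<tau>] by blast
    have tyS: "\<tau> y \<in> S" using yS permutes_in_image[OF \<tau>] by blast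
    let ?t = "transpose y (\<tau> y)"
    \<comment> \<open>This makes \<open>y\<close> a fixed point and moves no new position; as
      \<open>y\<close> and \<open>\<tau> y\<close> share a block, the blocks are still
      preserved.\<close>
    define \<tau>' where "\<tau>' = ?t \<circ> \<tau>"
    have t: "?t permutes S" using yS tyS by (rule permutes_swap_id)
    have \<tau>': "\<tau>' permutes S" unfolding \<tau>'_def using \<tau> t by (rule permutes_compose)
    have t_tau: "?t \<circ> \<tau>' = \<tau>" by (simp add: \<tau>'_def flip: comp_assoc)
    have t_blk: "pos_block p (?t x) = pos_block p x" for x
      using blk[OF yS] by (auto simp: transpose_def)
    have inj: "\<tau> u = \<tau> v \<longleftrightarrow> u = v" for u v using permutes_inj[OF \<tau>] by (simp add: inj_eq)
    have "{x \<in> S. \<tau>' x \<noteq> x} \<subset> {x \<in> S. \<tau> x \<noteq> x}"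
    proof
      show "{x \<in> S. \<tau>' x \<noteq> x} \<subseteq> {x \<in> S. \<tau> x \<noteq> x}"
      proof clarify
        fix x assume "\<tau>' x \<noteq> x" "\<tau> x = x"
        then have "?t x \<noteq> x" by (simp add: \<tau>'_def)
        then have "x = y \<or> x = \<tau> y" by (metis transpose_apply_other)
        then show False using y \<open>\<tau> x = x\<close> inj[of "\<tau> y" y] by auto
      qed
      have "\<tau>' y = y" by (simp add: \<tau>'_def)
      then show "{x \<in> S. \<tau>' x \<noteq> x} \<noteq> {x \<in> S. \<tau> x \<noteq> x}" using y yS by blast
    qed
    then have "card {x \<in> S. \<tau>' x \<noteq> x} < card {x \<in> S. \<tau> x \<noteq> x}"
      by (intro psubset_card_mono) auto
    moreover have "pos_block p (\<tau>' x) = pos_block p x" if "x \<in> S" for x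
      unfolding \<tau>'_def comp_apply t_blk by (rule blk[OF that])
    moreover have "\<theta> \<circ> ?t permutes S" using t \<theta> by (rule permutes_compose)
    ultimately have IH: "phi ((\<theta> \<circ> ?t) \<circ> \<tau>') = of_int (sign \<tau>') * phi (\<theta> \<circ> ?t)"
      using less.hyps \<tau>' by blast
    have "phi (\<theta> \<circ> ?t) = - phi \<theta>"
    proof (cases "y < \<tau> y")
      case True
      then show ?thesis using phi_antisymmetric[OF \<theta> yS tyS] blk[OF yS] by simp
    next
      case False
      then show ?thesis using phi_antisymmetric[OF \<theta> tyS yS] blk[OF yS] y by (simp add: transpose_commute)
    qed
    moreover have "sign \<tau> = - sign \<tau>'"
    proof -
      have "sign (?t \<circ> \<tau>') = sign ?t * sign \<tau>'" using t \<tau>' by (intro permutes_sign_compose[of S]) auto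
      then show ?thesis using y unfolding t_tau by (simp add: sign_swap_id)
    qed
    moreover have "(\<theta> \<circ> ?t) \<circ> \<tau>' = \<theta> \<circ> \<tau>" by (simp only: comp_assoc t_tau)
    ultimately show ?thesis using IH by simp
  qed
qed

lemma block_sum_weight:
  assumes "a < K" "b < K" "a \<noteq> b"
  shows "gl_op S K (weight_diff a b) block_sum = (of_bool (a = 0) - of_bool (b = 0)) *\<^sub>R block_sum"
proof
  fix \<beta>
  show "gl_op S K (weight_diff a b) block_sum \<beta> = ((of_bool (a = 0) - of_bool (b = 0)) *\<^sub>R block_sum) \<beta>"
    unfolding gl_op_weight_diff[OF assms finite_atLeastAtMost]
    using block_sum_support(2)[of \<beta>, OF _ assms(1)] block_sum_support(2)[of \<beta>, OF _ assms(2)] assms(3)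
    by (cases "block_sum \<beta> = 0") auto
qed

lemma phi_eq_zero:
  assumes "K \<le> Suc p"
    and \<gamma>: "\<And>l. l \<in> S \<Longrightarrow> \<gamma> l < K - 1"
    and sym: "\<And>\<sigma> \<theta>. \<sigma> permutes S \<Longrightarrow> (\<And>l. l \<in> S \<Longrightarrow> \<gamma> (\<sigma> l) = \<gamma> l) \<Longrightarrow> \<theta> permutes S \<Longrightarrow>
      phi (\<sigma> \<circ> \<theta>) = of_int (sign \<sigma>) * phi \<theta>"
    and \<theta>: "\<theta> permutes S"
  shows "phi \<theta> = 0"
proof -
  let ?q = "K - 1"
  have "\<gamma> 1 < K - 1" by (rule \<gamma>) simp
  then have K2: "1 < K" and q: "1 \<le> ?q" "?q < K" by auto
  have sq: "(-1 :: real) ^ p * (-1) ^ p = 1" by (simp flip: power_mult_distrib)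
  have e0: "gl_op S K (mat_unit 0 1) block_sum = 0"
  proof (rule raising_zero[OF _ K2 _ finite_atLeastAtMost])
    show "gl_op S K (weight_diff 0 1) block_sum = block_sum"
      using block_sum_weight[of 0 1] K2 by simp
    show "block_sum = ((-1) ^ p) *\<^sub>R swap_op 0 1 (gl_op S K (mat_unit 1 0) block_sum)"
      using K2 by (rule block_sum_exchange_head)
  qed (use K2 sq in simp_all)
  have ee: "gl_op S K (mat_unit i (Suc i)) (gl_op S K (mat_unit i (Suc i)) block_sum) = 0" if "1 \<le> i" "Suc i < K" for i
  proof (rule raising_squared_zero[OF _ that(2) _ finite_atLeastAtMost])
    show "gl_op S K (weight_diff i (Suc i)) block_sum = 0"
      using block_sum_weight[of i "Suc i"] that by simp
    show "gl_op S K (mat_unit (Suc i) i) (gl_op S K (mat_unit i (Suc i)) block_sum) =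
      block_sum - ((-1) ^ p) *\<^sub>R swap_op i (Suc i) block_sum"
      using that by (rule block_sum_exchange)
  qed (use that sq in simp_all)
  have nil: "(gl_op S K (row_mat \<alpha> ?q ?q) ^^ p) block_sum = 0" for \<alpha>
  proof -
    have "(gl_op S K (row_mat \<alpha> ?q ?q) ^^ ?q) block_sum = 0"
      by (rule row_mat_nilpotent[OF finite_atLeastAtMost e0 ee q])
    \<comment> \<open>The last block has \<open>p\<close> letters, so it is the power
      \<open>p\<close> that is required; \<open>K \<le> Suc p\<close> places it above the known
      power \<open>K - 1\<close>.\<close>
    moreover have "p = (p - ?q) + ?q" using assms(1) by simp
    ultimately have "(gl_op S K (row_mat \<alpha> ?q ?q) ^^ p) block_sum = (gl_op S K (row_mat \<alpha> ?q ?q) ^^ (p - ?q)) 0"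
      by (metis funpow_add comp_apply)
    then show ?thesis by (simp only: linear_0[OF linear_funpow[OF linear_gl_op]])
  qed
  have zero: "block_sum \<beta> = 0" for \<beta>
  proof (rule few_colours_vanish[OF finite_atLeastAtMost q(2) _ _ nil \<gamma>])
    fix \<beta> assume "block_sum \<beta> \<noteq> 0"
    then show "(\<forall>l\<in>S. \<beta> l \<le> ?q) \<and> card {l \<in> S. \<beta> l = ?q} = p"
      using block_sum_support(1)[of \<beta>] block_sum_support(2)[of \<beta> ?q] q by fastforce
  next
    fix \<beta> \<beta>' :: "nat \<Rightarrow> nat" assume "\<And>l. l \<in> S \<Longrightarrow> \<beta> l = \<beta>' l"
    then show "block_sum \<beta> = block_sum \<beta>'" by (rule block_sum_local)
  next
    fix \<sigma> \<beta> assume \<sigma>: "\<sigma> permutes S" "\<And>l. l \<in> S \<Longrightarrow> \<gamma> (\<sigma> l) = \<gamma> l"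
    have inv: "Hilbert_Choice.inv \<sigma> permutes S" using \<sigma>(1) by (rule permutes_inv)
    \<comment> \<open>The sign from re-indexing cancels the sign in \<open>sym\<close>:
      \<open>phi\<close> is antisymmetric under \<sigma>, but \<open>block_sum\<close> is
      symmetric.\<close>
    show "block_sum (\<beta> \<circ> \<sigma>) = block_sum \<beta>"
      unfolding block_sum_def arrangement_sum_def
    proof (rule sum.reindex_bij_witness[where i = "\<lambda>\<theta>. Hilbert_Choice.inv \<sigma> \<circ> \<theta>" and j = "\<lambda>\<theta>. \<sigma> \<circ> \<theta>"])
      fix \<theta> assume a: "\<theta> \<in> arrangements (pos_block p) (\<beta> \<circ> \<sigma>)"
      have \<theta>: "\<theta> permutes S" using a by (rule arrangements_permutes)
      show "Hilbert_Choice.inv \<sigma> \<circ> (\<sigma> \<circ> \<theta>) = \<theta>" using permutes_inv_o(2)[OF \<sigma>(1)] by (simp flip: comp_assoc)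
      have "\<sigma> \<circ> \<theta> permutes S" using \<theta> \<sigma>(1) by (rule permutes_compose)
      then show "\<sigma> \<circ> \<theta> \<in> arrangements (pos_block p) \<beta>"
        using a unfolding arrangements_def by simp
      have "sign (\<sigma> \<circ> \<theta>) = sign \<sigma> * sign \<theta>" using \<sigma>(1) \<theta> by (intro permutes_sign_compose[of S]) auto
      moreover have "phi (\<sigma> \<circ> \<theta>) = of_int (sign \<sigma>) * phi \<theta>" using \<sigma> \<theta> by (rule sym)
      ultimately show "of_int (sign (\<sigma> \<circ> \<theta>)) * phi (\<sigma> \<circ> \<theta>) = of_int (sign \<theta>) * phi \<theta>"
        by (auto simp: sign_def)
    next
      fix \<theta> assume a: "\<theta> \<in> arrangements (pos_block p) \<beta>"
      have \<theta>: "\<theta> permutes S" using a by (rule arrangements_permutes)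
      show "\<sigma> \<circ> (Hilbert_Choice.inv \<sigma> \<circ> \<theta>) = \<theta>" using permutes_inv_o(1)[OF \<sigma>(1)] by (simp flip: comp_assoc)
      have "Hilbert_Choice.inv \<sigma> \<circ> \<theta> permutes S" using \<theta> inv by (rule permutes_compose)
      then show "Hilbert_Choice.inv \<sigma> \<circ> \<theta> \<in> arrangements (pos_block p) (\<beta> \<circ> \<sigma>)"
        using a permutes_inverses(1)[OF \<sigma>(1)] unfolding arrangements_def by simp
    qed
  qed
  \<comment> \<open>For this choice \<theta> is one of the arrangements, and every other one differs
    from it by a permutation inside the blocks. All terms of the sum therefore agree.\<close>
  define \<beta> where "\<beta> = pos_block p \<circ> Hilbert_Choice.inv \<theta>"
  let ?A = "arrangements (pos_block p) \<beta>"
  have "\<theta> \<in> ?A" using \<theta> permutes_inverses(2)[OF \<theta>] by (simp add: arrangements_def \<beta>_def)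
  have "of_int (sign \<theta>') * phi \<theta>' = of_int (sign \<theta>) * phi \<theta>" if "\<theta>' \<in> ?A" for \<theta>'
  proof -
    define \<tau> where "\<tau> = Hilbert_Choice.inv \<theta> \<circ> \<theta>'"
    have \<theta>': "\<theta>' permutes S" using that by (rule arrangements_permutes)
    have \<tau>: "\<tau> permutes S" unfolding \<tau>_def using \<theta>' permutes_inv[OF \<theta>] by (rule permutes_compose)
    have eq: "\<theta>' = \<theta> \<circ> \<tau>" unfolding \<tau>_def using permutes_inv_o(1)[OF \<theta>] by (simp flip: comp_assoc)
    have "pos_block p (\<tau> x) = pos_block p x" if "x \<in> S" for x
      using that \<open>\<theta>' \<in> ?A\<close> unfolding arrangements_def \<tau>_def \<beta>_def by simp
    then have "phi \<theta>' = of_int (sign \<tau>) * phi \<theta>" unfolding eq using \<tau> \<theta> by (intro phi_block_permutation)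
    moreover have "sign \<theta>' = sign \<theta> * sign \<tau>" unfolding eq using \<theta> \<tau> by (intro permutes_sign_compose[of S]) auto
    ultimately show ?thesis by (auto simp: sign_def)
  qed
  then have "block_sum \<beta> = of_nat (card ?A) * (of_int (sign \<theta>) * phi \<theta>)"
    unfolding block_sum_def arrangement_sum_def by simp
  moreover have "card ?A \<noteq> 0" using \<open>\<theta> \<in> ?A\<close> by auto
  ultimately show ?thesis using zero by simp
qed

end

section \<open>Multilinear left-normed words\<close>

lemma concat_nth_uniform:
  assumes "\<And>us. us \<in> set uss \<Longrightarrow> length us = p" "b < length uss" "a < p"
  shows "concat uss ! (b * p + a) = uss ! b ! a"
  using assms
proof (induction uss arbitrary: b)
  case (Cons us uss)
  then show ?case by (cases b) (auto simp: nth_append)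
qed simp

lemma letters_left_normed_Letters:
  "letters (left_normed w (map (map Letter) uss)) = letters w @ concat uss"
  by (induction uss arbitrary: w) (auto simp: o_def)

lemma comb_eq_comb_word:
  assumes C: "C \<in> combs p X" and p: "p \<ge> 1"
    and letters: "distinct (letters C)" "set (letters C) = {1..K * p + 1}"
  obtains \<theta> where "\<theta> permutes {1..K * p + 1}" "C = comb_word p K \<theta>"
proof -
  let ?S = "{1..K * p + 1}"
  obtain x uss where C_eq: "C = left_normed (Letter x) (map (map Letter) uss)"
    and uss: "\<And>us. us \<in> set uss \<Longrightarrow> length us = p"
    using C unfolding combs_def by (auto simp: in_lists_conv_set)
  define xs where "xs = x # concat uss"
  have xs: "letters C = xs" by (simp add: C_eq letters_left_normed_Letters xs_def)
  have len: "length xs = K * p + 1" using letters distinct_card[of xs] by (simp add: xs)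
  have "length (concat uss) = length uss * p"
    using uss by (induction uss) auto
  then have lu: "length uss = K" using len p by (simp add: xs_def)
  define \<theta> where "\<theta> i = (if i \<in> ?S then xs ! (i - 1) else i)" for i
  have "\<theta> permutes ?S"
  proof (rule bij_imp_permutes)
    have inj: "inj_on \<theta> ?S"
    proof (rule inj_onI)
      fix i j assume ij: "i \<in> ?S" "j \<in> ?S" "\<theta> i = \<theta> j"
      then have "xs ! (i - 1) = xs ! (j - 1)" by (simp add: \<theta>_def)
      moreover have "i - 1 < length xs" "j - 1 < length xs" using ij len by auto
      ultimately have "i - 1 = j - 1" using letters(1) nth_eq_iff_index_eq unfolding xs by blast
      then show "i = j" using ij by auto
    qed
    moreover have "\<theta> ` ?S \<subseteq> ?S"
    proof clarify
      fix i assume i: "i \<in> ?S"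
      then have "i - 1 < length xs" using len by auto
      then have "xs ! (i - 1) \<in> ?S" using letters(2) nth_mem unfolding xs by blast
      then show "\<theta> i \<in> ?S" using i by (simp add: \<theta>_def)
    qed
    ultimately show "bij_betw \<theta> ?S ?S"
      using endo_inj_surj[of ?S \<theta>] by (simp add: bij_betw_def)
  qed (auto simp: \<theta>_def)
  moreover have "C = comb_word p K \<theta>"
  proof -
    have "map Letter (uss ! b) = block_args p \<theta> b" if b: "b < K" for b
    proof (rule nth_equalityI)
      show "length (map Letter (uss ! b)) = length (block_args p \<theta> b)" using uss b lu by simp
      fix a assume "a < length (map Letter (uss ! b))"
      then have a: "a < p" "a < length (uss ! b)" using uss b lu by auto
      have "\<theta> (b * p + 2 + a) = xs ! (b * p + 2 + a - 1)"
        using position_in_range[OF b a(1)] unfolding \<theta>_def by (simp only: if_True)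
      also have "\<dots> = concat uss ! (b * p + a)" by (simp add: xs_def)
      also have "\<dots> = uss ! b ! a" using uss b lu a by (intro concat_nth_uniform) auto
      finally show "map Letter (uss ! b) ! a = block_args p \<theta> b ! a" using a by simp
    qed
    then have "map (map Letter) uss = map (block_args p \<theta>) [0..<K]"
      using lu by (auto intro!: nth_equalityI)
    moreover have "\<theta> 1 = x" by (simp add: \<theta>_def xs_def)
    ultimately show ?thesis by (simp add: C_eq comb_word_def)
  qed
  ultimately show thesis by (rule that)
qed

lemma vanish_on_multilinear_words:
  assumes F: "filippov_functional p {1..K * p + 1} \<Psi>" and p: "p \<ge> 1"
    and comb: "\<And>\<theta>. \<theta> permutes {1..K * p + 1} \<Longrightarrow> \<Psi> (comb_word p K \<theta>) = 0"
    and w: "w \<in> multilinear_words (Suc p) (K * p + 1)"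
  shows "\<Psi> w = 0"
proof (rule vanish_on_combs[OF _ F])
  show "w \<in> nwords (Suc p) {1..K * p + 1}" using w by (simp add: multilinear_words_def)
  fix C assume C: "C \<in> combs p {1..K * p + 1}" "content C = content w"
  have "distinct (letters w)" "set (letters w) = {1..K * p + 1}" using w by (auto simp: multilinear_words_def)
  then have "distinct (letters C)" "set (letters C) = {1..K * p + 1}"
    using mset_eq_imp_distinct_iff[OF C(2)] mset_eq_setD[OF C(2)] by auto
  from comb_eq_comb_word[OF C(1) p this] obtain \<theta> where "\<theta> permutes {1..K * p + 1}" "C = comb_word p K \<theta>" .
  then show "\<Psi> C = 0" using comb by simp
qed

section \<open>Occurrences of Specht modules\<close>

lemma pushforward_superset:
  assumes "finite A" "Poly_Mapping.keys p \<subseteq> A"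
  shows "pushforward f p = (\<Sum>b\<in>A. Poly_Mapping.single (f b) (Poly_Mapping.lookup p b))"
  unfolding pushforward_def by (rule sum.mono_neutral_left) (use assms in \<open>auto simp: in_keys_iff\<close>)

lemma pushforward_add: "pushforward f (p + q) = pushforward f p + pushforward f q"
proof -
  let ?A = "Poly_Mapping.keys p \<union> Poly_Mapping.keys q"
  have "pushforward f (p + q) = (\<Sum>b\<in>?A. Poly_Mapping.single (f b) (Poly_Mapping.lookup (p + q) b))"
    by (rule pushforward_superset) (use keys_add[of p q] in auto)
  also have "\<dots> = (\<Sum>b\<in>?A. Poly_Mapping.single (f b) (Poly_Mapping.lookup p b)) + (\<Sum>b\<in>?A. Poly_Mapping.single (f b) (Poly_Mapping.lookup q b))"
    by (simp add: lookup_add single_add sum.distrib)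
  also have "\<dots> = pushforward f p + pushforward f q"
    by (intro arg_cong2[of _ _ _ _ plus] pushforward_superset[symmetric]) auto
  finally show ?thesis .
qed

lemma pushforward_zero: "pushforward f 0 = 0"
  by (simp add: pushforward_def)

lemma pushforward_sum: "pushforward f (sum g A) = (\<Sum>a\<in>A. pushforward f (g a))"
  by (induction A rule: infinite_finite_induct) (simp_all add: pushforward_zero pushforward_add)

lemma cscale_single: "cscale c (Poly_Mapping.single b x) = Poly_Mapping.single b (c * x)"
  by (rule poly_mapping_eqI) (simp add: lookup_cscale lookup_single when_def)

lemma pushforward_comp: "pushforward f (pushforward g p) = pushforward (f \<circ> g) p"
  unfolding pushforward_def[of g] pushforward_sum pushforward_single by (simp add: pushforward_def)

section \<open>Cosets of the ideal and intertwiners\<close>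

lemma free_module_coset: "H +>\<^bsub>free_module W\<^esub> a = {h + a | h. h \<in> H}"
  unfolding a_r_coset_def' by (auto simp: free_module_def)

lemma rho_simps:
  "carrier (rho n k) = {filippov_ideal n {1..k * (n - 1) + 1} +>\<^bsub>free_module (nwords n {1..k * (n - 1) + 1})\<^esub> p | p.
     Poly_Mapping.keys p \<subseteq> multilinear_words n (k * (n - 1) + 1)}"
  "smult (rho n k) = (\<lambda>c C. \<Union>p\<in>C. filippov_ideal n {1..k * (n - 1) + 1} +>\<^bsub>free_module (nwords n {1..k * (n - 1) + 1})\<^esub> cscale c p)"
  "act (rho n k) = (\<lambda>\<sigma> C. pushforward (map_word \<sigma>) ` C)"
  by (simp_all add: rho_def Let_def subrep_def free_filippov_def quot_module_def free_module_def)

lemma specht_simps: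
  "carrier (specht lam) = cvs.span (polytabloid lam ` tableaux lam)"
  "smult (specht lam) = cscale"
  "act (specht lam) = (\<lambda>\<sigma>. pushforward (map ((`) \<sigma>)))"
  by (simp_all add: specht_def subrep_def free_module_def)

text \<open>The image of \<open>e\<close> is a coset. An eigenvector relation for \<open>e\<close>
  passes to a representative \<open>v\<close> only modulo the ideal, which is enough for functionals
  that kill the ideal.\<close>

lemma intertwiner_image:
  assumes f: "f \<in> intertwiners (sym_group N) (specht lam) (rho n k)" and inj: "inj_on f (carrier (specht lam))"
    and N: "N = k * (n - 1) + 1" and e: "e \<in> carrier (specht lam)" "e \<noteq> 0"
  obtains v where "Poly_Mapping.keys v \<subseteq> multilinear_words n N" "v \<notin> filippov_ideal n {1..N}"
    "\<And>\<sigma> c. \<sigma> permutes {1..N} \<Longrightarrow> pushforward (map ((`) \<sigma>)) e = cscale c e \<Longrightarrow>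
       pushforward (map_word \<sigma>) v - cscale c v \<in> filippov_ideal n {1..N}"
proof -
  let ?I = "filippov_ideal n {1..N}"
  note sub = subspace_filippov_ideal[of n "{1..N}"]
  have I0: "0 \<in> ?I" and Iadd: "\<And>p q. p \<in> ?I \<Longrightarrow> q \<in> ?I \<Longrightarrow> p + q \<in> ?I" and Isc: "\<And>c p. p \<in> ?I \<Longrightarrow> cscale c p \<in> ?I"
    by (auto intro: filippov_ideal.intros)
  have "f e \<in> carrier (rho n k)" using f e by (auto simp: intertwiners_def)
  then obtain v where v: "Poly_Mapping.keys v \<subseteq> multilinear_words n N" "f e = {h + v | h. h \<in> ?I}"
    unfolding rho_simps free_module_coset N by blast
  have fscale: "f (cscale c e) = {h' + cscale c (h + v) | h h'. h \<in> ?I \<and> h' \<in> ?I}" for c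
  proof -
    have "f (c \<odot>\<^bsub>specht lam\<^esub> e) = c \<odot>\<^bsub>rho n k\<^esub> f e" using f e by (auto simp: intertwiners_def)
    then show ?thesis unfolding specht_simps rho_simps free_module_coset v(2) N by blast
  qed
  have "v \<notin> ?I"
  proof
    assume vI: "v \<in> ?I"
    \<comment> \<open>The zero vector is reached as a multiple of \<open>e\<close>, because
      homogeneity gives its image directly: the ideal itself, which would also be
      \<open>f e\<close>.\<close>
    have "f (cscale 0 e) = f e"
      unfolding fscale v(2)
    proof (intro equalityI subsetI)
      fix x assume "x \<in> {h' + cscale 0 (h + v) | h h'. h \<in> ?I \<and> h' \<in> ?I}"
      then have "x \<in> ?I" by auto
      then have "x - v \<in> ?I" using vI sub by (simp add: cvs.subspace_diff)
      then show "x \<in> {h + v | h. h \<in> ?I}" by force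
    next
      fix x assume "x \<in> {h + v | h. h \<in> ?I}"
      then have "x \<in> ?I" using Iadd vI by blast
      moreover have "x = x + cscale 0 (0 + v)" by simp
      ultimately show "x \<in> {h' + cscale 0 (h + v) | h h'. h \<in> ?I \<and> h' \<in> ?I}" using I0 by blast
    qed
    moreover have "cscale 0 e \<in> carrier (specht lam)" using e(1) unfolding specht_simps by (rule cvs.span_scale)
    ultimately have "cscale 0 e = e" using inj e(1) by (meson inj_onD)
    then show False using e(2) by simp
  qed
  moreover have "pushforward (map_word \<sigma>) v - cscale c v \<in> ?I"
    if \<sigma>: "\<sigma> permutes {1..N}" and eq: "pushforward (map ((`) \<sigma>)) e = cscale c e" for \<sigma> c
  proof -
    have "\<sigma> \<in> carrier (sym_group N)" using \<sigma> by (simp add: sym_group_def)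
    then have "f (act (specht lam) \<sigma> e) = act (rho n k) \<sigma> (f e)" using f e by (auto simp: intertwiners_def)
    then have "f (cscale c e) = pushforward (map_word \<sigma>) ` f e" by (simp only: specht_simps rho_simps eq)
    moreover have "v \<in> f e" unfolding v(2) using I0 by force
    ultimately have "pushforward (map_word \<sigma>) v \<in> f (cscale c e)" by blast
    then obtain h h' where h: "h \<in> ?I" "h' \<in> ?I" "pushforward (map_word \<sigma>) v = h' + cscale c (h + v)"
      unfolding fscale by blast
    have diff: "pushforward (map_word \<sigma>) v - cscale c v = h' + cscale c h"
      unfolding h(3) by (simp add: cvs.scale_right_distrib)
    show ?thesis unfolding diff using Iadd Isc h by blast
  qed
  ultimately show thesis using that v(1) by blast
qed

text \<open>A separating functional is averaged against the sign-valued character \<open>c\<close>,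
  which is its own inverse. Modulo the ideal \<open>v\<close> is an eigenvector with the same
  character, so all terms agree at \<open>v\<close> and the value is multiplied by
  \<open>card H\<close>.\<close>

lemma symmetrized_functional:
  assumes v: "v \<notin> filippov_ideal (Suc p) X" and H: "finite H" "H \<noteq> {}" "\<And>\<sigma>. \<sigma> \<in> H \<Longrightarrow> \<sigma> permutes X"
    and comp: "\<And>\<sigma> \<tau>. \<sigma> \<in> H \<Longrightarrow> \<tau> \<in> H \<Longrightarrow> \<sigma> \<circ> \<tau> \<in> H"
    and c: "\<And>\<sigma>. \<sigma> \<in> H \<Longrightarrow> c \<sigma> * c \<sigma> = 1" "\<And>\<sigma> \<tau>. \<sigma> \<in> H \<Longrightarrow> \<tau> \<in> H \<Longrightarrow> c (\<sigma> \<circ> \<tau>) = c \<sigma> * c \<tau>"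
    and eq: "\<And>\<sigma>. \<sigma> \<in> H \<Longrightarrow> pushforward (map_word \<sigma>) v - cscale (c \<sigma>) v \<in> filippov_ideal (Suc p) X"
  obtains \<Psi> where "filippov_functional p X \<Psi>" "word_ext \<Psi> v \<noteq> 0"
    "\<And>\<sigma> w. \<sigma> \<in> H \<Longrightarrow> \<Psi> (map_word \<sigma> w) = c \<sigma> * \<Psi> w"
proof -
  obtain \<Psi>0 where \<Psi>0: "\<And>q. q \<in> filippov_ideal (Suc p) X \<Longrightarrow> word_ext \<Psi>0 q = 0" "word_ext \<Psi>0 v \<noteq> 0"
    using separating_functional[OF subspace_filippov_ideal v] by blast
  define \<Psi> where "\<Psi> w = (\<Sum>h\<in>H. c h * \<Psi>0 (map_word h w))" for w
  have "filippov_functional p X \<Psi>"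
    unfolding \<Psi>_def[abs_def]
  proof (rule filippov_functional_relabel)
    show "filippov_functional p X \<Psi>0" using \<Psi>0(1) by (rule filippov_functional_ideal)
    show "h ` X \<subseteq> X" if "h \<in> H" for h using permutes_image[OF H(3)[OF that]] by simp
  qed
  moreover have "word_ext \<Psi> v \<noteq> 0"
  proof -
    have "word_ext (\<lambda>w. \<Psi>0 (map_word h w)) v = c h * word_ext \<Psi>0 v" if "h \<in> H" for h
      using \<Psi>0(1)[OF eq[OF that]] by (simp add: word_ext_pushforward o_def)
    then have "word_ext \<Psi> v = (\<Sum>h\<in>H. (c h * c h) * word_ext \<Psi>0 v)"
      unfolding \<Psi>_def[abs_def] word_ext_sum_functional by (intro sum.cong) (auto simp: mult.assoc)
    also have "\<dots> = of_nat (card H) * word_ext \<Psi>0 v" using c(1) by simp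
    finally show ?thesis using \<Psi>0(2) H(1,2) by simp
  qed
  moreover have "\<Psi> (map_word \<sigma> w) = c \<sigma> * \<Psi> w" if \<sigma>: "\<sigma> \<in> H" for \<sigma> w
  proof -
    have "inj_on (\<lambda>h. h \<circ> \<sigma>) H"
      using permutes_surj[OF H(3)[OF \<sigma>]] by (auto intro!: inj_onI simp: fun_eq_iff surj_def) metis
    moreover have "(\<lambda>h. h \<circ> \<sigma>) ` H \<subseteq> H" using comp \<sigma> by auto
    ultimately have bij: "bij_betw (\<lambda>h. h \<circ> \<sigma>) H H"
      using endo_inj_surj[OF H(1)] by (simp add: bij_betw_def)
    have "c \<sigma> * \<Psi> w = (\<Sum>h\<in>H. c \<sigma> * (c h * \<Psi>0 (map_word h w)))" by (simp add: \<Psi>_def sum_distrib_left)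
    also have "\<dots> = (\<Sum>h\<in>H. c \<sigma> * (c (h \<circ> \<sigma>) * \<Psi>0 (map_word (h \<circ> \<sigma>) w)))"
      by (rule sum.reindex_bij_betw[OF bij, symmetric])
    also have "\<dots> = (\<Sum>h\<in>H. c h * \<Psi>0 (map_word h (map_word \<sigma> w)))"
    proof (rule sum.cong[OF refl])
      fix h assume "h \<in> H"
      then have "c \<sigma> * c (h \<circ> \<sigma>) = c h" using c \<sigma> by (simp add: mult.left_commute)
      then show "c \<sigma> * (c (h \<circ> \<sigma>) * \<Psi>0 (map_word (h \<circ> \<sigma>) w)) = c h * \<Psi>0 (map_word h (map_word \<sigma> w))"
        by (simp add: word.map_comp flip: mult.assoc)
    qed
    finally show ?thesis by (simp add: \<Psi>_def)
  qed
  ultimately show thesis by (rule that)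
qed

lemma functional_comb_nonzero:
  assumes "filippov_functional p {1..K * p + 1} \<Psi>" "p \<ge> 1" "word_ext \<Psi> v \<noteq> 0"
    and "Poly_Mapping.keys v \<subseteq> multilinear_words (Suc p) (K * p + 1)"
  obtains \<theta> where "\<theta> permutes {1..K * p + 1}" "\<Psi> (comb_word p K \<theta>) \<noteq> 0"
proof (rule ccontr)
  assume nt: "\<not> thesis"
  note found = that
  have "\<Psi> (comb_word p K \<theta>) = 0" if \<theta>: "\<theta> permutes {1..K * p + 1}" for \<theta>
    using found[OF \<theta>] nt by blast
  then have "\<Psi> w = 0" if "w \<in> Poly_Mapping.keys v" for w
    using vanish_on_multilinear_words[OF assms(1,2)] assms(4) that by blast
  then have "word_ext \<Psi> v = 0" by (simp add: word_ext_def)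
  then show False using assms(3) by simp
qed

section \<open>Polytabloids and column stabilizers\<close>

lemma tabloid_comp: "tabloid lam (\<sigma> \<circ> T) = map ((`) \<sigma>) (tabloid lam T)"
  by (auto simp: tabloid_def)

lemma finite_column_stabilizer [simp]: "finite (column_stabilizer lam T)"
  by (rule finite_subset[OF _ finite_permutations[of "{1..sum_list lam}"]]) (auto simp: column_stabilizer_def)

lemma id_column_stabilizer: "id \<in> column_stabilizer lam T"
  by (auto simp: column_stabilizer_def permutes_id)

lemma column_stabilizer_permutes: "\<sigma> \<in> column_stabilizer lam T \<Longrightarrow> \<sigma> permutes {1..sum_list lam}"
  by (simp add: column_stabilizer_def)

lemma column_stabilizer_comp:
  assumes "\<sigma> \<in> column_stabilizer lam T" "\<tau> \<in> column_stabilizer lam T"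
  shows "\<sigma> \<circ> \<tau> \<in> column_stabilizer lam T"
  unfolding column_stabilizer_def
proof (intro CollectI conjI ballI)
  show "\<sigma> \<circ> \<tau> permutes {1..sum_list lam}" using assms column_stabilizer_permutes by (blast intro: permutes_compose)
  fix x assume "x \<in> diagram lam"
  then obtain i j where x: "x = (i, j)" "(i, j) \<in> diagram lam" by (cases x) auto
  then obtain i' where i': "(i', j) \<in> diagram lam" "\<tau> (T (i, j)) = T (i', j)"
    using assms(2) unfolding column_stabilizer_def by blast
  then obtain i'' where "(i'', j) \<in> diagram lam" "\<sigma> (T (i', j)) = T (i'', j)"
    using assms(1) unfolding column_stabilizer_def by blast
  then show "case x of (i, j) \<Rightarrow> \<exists>i'. (i', j) \<in> diagram lam \<and> (\<sigma> \<circ> \<tau>) (T (i, j)) = T (i', j)"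
    using x i' by auto
qed

lemma pushforward_polytabloid:
  "pushforward (map ((`) \<sigma>)) (polytabloid lam T) =
    (\<Sum>\<tau>\<in>column_stabilizer lam T. Poly_Mapping.single (tabloid lam (\<sigma> \<circ> \<tau> \<circ> T)) (of_int (sign \<tau>)))"
  unfolding polytabloid_def pushforward_sum pushforward_single by (simp add: comp_assoc tabloid_comp)

lemma column_stabilizer_act:
  assumes \<sigma>: "\<sigma> \<in> column_stabilizer lam T"
  shows "pushforward (map ((`) \<sigma>)) (polytabloid lam T) = cscale (of_int (sign \<sigma>)) (polytabloid lam T)"
proof -
  let ?C = "column_stabilizer lam T"
  have per: "\<sigma> permutes {1..sum_list lam}" using \<sigma> by (rule column_stabilizer_permutes)
  have "inj_on (\<lambda>h. \<sigma> \<circ> h) ?C"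
    using permutes_inj[OF per] by (auto intro!: inj_onI simp: fun_eq_iff inj_eq)
  moreover have "(\<lambda>h. \<sigma> \<circ> h) ` ?C \<subseteq> ?C" using column_stabilizer_comp \<sigma> by auto
  ultimately have bij: "bij_betw (\<lambda>h. \<sigma> \<circ> h) ?C ?C"
    using endo_inj_surj[OF finite_column_stabilizer] by (simp add: bij_betw_def)
  have "cscale (of_int (sign \<sigma>)) (polytabloid lam T) =
    (\<Sum>\<tau>\<in>?C. Poly_Mapping.single (tabloid lam (\<tau> \<circ> T)) (of_int (sign \<sigma>) * of_int (sign \<tau>)))"
    unfolding polytabloid_def cvs.scale_sum_right cscale_single ..
  also have "\<dots> = (\<Sum>\<tau>\<in>?C. Poly_Mapping.single (tabloid lam (\<sigma> \<circ> \<tau> \<circ> T)) (of_int (sign \<sigma>) * of_int (sign (\<sigma> \<circ> \<tau>))))"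
    by (rule sum.reindex_bij_betw[OF bij, symmetric])
  also have "\<dots> = (\<Sum>\<tau>\<in>?C. Poly_Mapping.single (tabloid lam (\<sigma> \<circ> \<tau> \<circ> T)) (of_int (sign \<tau>)))"
  proof (rule sum.cong[OF refl])
    fix \<tau> assume "\<tau> \<in> ?C"
    then have "sign (\<sigma> \<circ> \<tau>) = sign \<sigma> * sign \<tau>"
      using per column_stabilizer_permutes by (intro permutes_sign_compose) auto
    then show "Poly_Mapping.single (tabloid lam (\<sigma> \<circ> \<tau> \<circ> T)) (of_int (sign \<sigma>) * of_int (sign (\<sigma> \<circ> \<tau>)) :: complex) =
        Poly_Mapping.single (tabloid lam (\<sigma> \<circ> \<tau> \<circ> T)) (of_int (sign \<tau>))"
      by (simp add: sign_def)
  qed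
  finally show ?thesis unfolding pushforward_polytabloid by simp
qed

lemma column_stabilizer_conj:
  assumes r: "r permutes {1..sum_list lam}" and \<sigma>: "\<sigma> \<in> column_stabilizer lam T"
  shows "r \<circ> \<sigma> \<circ> Hilbert_Choice.inv r \<in> column_stabilizer lam (r \<circ> T)"
proof -
  have "r \<circ> \<sigma> \<circ> Hilbert_Choice.inv r permutes {1..sum_list lam}"
    using r column_stabilizer_permutes[OF \<sigma>] permutes_inv[OF r] by (intro permutes_compose)
  moreover have "(r \<circ> \<sigma> \<circ> Hilbert_Choice.inv r) ((r \<circ> T) x) = r (\<sigma> (T x))" for x
    using permutes_inverses(2)[OF r] by simp
  ultimately show ?thesis using \<sigma> unfolding column_stabilizer_def by fastforce
qed

lemma pushforward_polytabloid_perm: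
  assumes r: "r permutes {1..sum_list lam}"
  shows "pushforward (map ((`) r)) (polytabloid lam T) = polytabloid lam (r \<circ> T)"
  unfolding pushforward_polytabloid unfolding polytabloid_def
proof (rule sum.reindex_bij_witness[where j = "\<lambda>\<sigma>. r \<circ> \<sigma> \<circ> Hilbert_Choice.inv r" and i = "\<lambda>\<sigma>. Hilbert_Choice.inv r \<circ> \<sigma> \<circ> r"])
  have ri: "Hilbert_Choice.inv r permutes {1..sum_list lam}" using r by (rule permutes_inv)
  have o: "r \<circ> Hilbert_Choice.inv r = id" "Hilbert_Choice.inv r \<circ> r = id" using permutes_inv_o[OF r] by auto
  {
    fix \<sigma> assume \<sigma>: "\<sigma> \<in> column_stabilizer lam T"
    show "Hilbert_Choice.inv r \<circ> (r \<circ> \<sigma> \<circ> Hilbert_Choice.inv r) \<circ> r = \<sigma>"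
      using permutes_inverses(2)[OF r] by (simp add: fun_eq_iff)
    show "r \<circ> \<sigma> \<circ> Hilbert_Choice.inv r \<in> column_stabilizer lam (r \<circ> T)" using r \<sigma> by (rule column_stabilizer_conj)
    have "r \<circ> \<sigma> \<circ> Hilbert_Choice.inv r \<circ> (r \<circ> T) = r \<circ> \<sigma> \<circ> T"
      using permutes_inverses(2)[OF r] by (simp add: fun_eq_iff)
    moreover have "sign (r \<circ> \<sigma> \<circ> Hilbert_Choice.inv r) = sign \<sigma>"
    proof -
      have s: "\<sigma> permutes {1..sum_list lam}" using \<sigma> by (rule column_stabilizer_permutes)
      have "sign (r \<circ> \<sigma> \<circ> Hilbert_Choice.inv r) = sign (r \<circ> \<sigma>) * sign (Hilbert_Choice.inv r)"
        using permutes_compose[OF s r] ri by (intro permutes_sign_compose) auto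
      also have "sign (r \<circ> \<sigma>) = sign r * sign \<sigma>" using r s by (intro permutes_sign_compose) auto
      also have "sign (Hilbert_Choice.inv r) = sign r"
        using r by (intro sign_inverse) (auto simp: permutation_permutes)
      also have "sign r * sign \<sigma> * sign r = sign \<sigma>" by (cases rule: sign_cases[of r]) simp_all
      finally show ?thesis .
    qed
    ultimately show "Poly_Mapping.single (tabloid lam (r \<circ> \<sigma> \<circ> Hilbert_Choice.inv r \<circ> (r \<circ> T))) (of_int (sign (r \<circ> \<sigma> \<circ> Hilbert_Choice.inv r)) :: complex) =
       Poly_Mapping.single (tabloid lam (r \<circ> \<sigma> \<circ> T)) (of_int (sign \<sigma>))" by simp
  next
    fix \<sigma> assume \<sigma>: "\<sigma> \<in> column_stabilizer lam (r \<circ> T)"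
    show "r \<circ> (Hilbert_Choice.inv r \<circ> \<sigma> \<circ> r) \<circ> Hilbert_Choice.inv r = \<sigma>"
      using permutes_inverses(1)[OF r] by (simp add: fun_eq_iff)
    have "Hilbert_Choice.inv (Hilbert_Choice.inv r) = r" using permutes_bij[OF r] by (rule inv_inv_eq)
    moreover have "Hilbert_Choice.inv r \<circ> (r \<circ> T) = T" using permutes_inverses(2)[OF r] by (simp add: fun_eq_iff)
    ultimately show "Hilbert_Choice.inv r \<circ> \<sigma> \<circ> r \<in> column_stabilizer lam T"
      using column_stabilizer_conj[OF ri \<sigma>] by simp
  }
qed

text \<open>Each entry must stay in its column by the stabilizer and in its row by the
  tabloid.\<close>

lemma tabloid_eq_imp_id:
  assumes T: "T \<in> tableaux lam" and \<sigma>: "\<sigma> \<in> column_stabilizer lam T" and eq: "tabloid lam (\<sigma> \<circ> T) = tabloid lam T"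
  shows "\<sigma> = id"
proof
  have bij: "bij_betw T (diagram lam) {1..sum_list lam}" using T by (simp add: tableaux_def)
  fix l
  show "\<sigma> l = id l"
  proof (cases "l \<in> {1..sum_list lam}")
    case True
    then obtain i j where ij: "(i, j) \<in> diagram lam" "l = T (i, j)"
      using bij unfolding bij_betw_def by (metis imageE surj_pair)
    then obtain i' where i': "(i', j) \<in> diagram lam" "\<sigma> l = T (i', j)"
      using \<sigma> unfolding column_stabilizer_def by blast
    have i: "i < length lam" "j < lam ! i" using ij by (auto simp: diagram_def)
    have "tabloid lam (\<sigma> \<circ> T) ! i = tabloid lam T ! i" by (simp only: eq)
    then have "{(\<sigma> \<circ> T) (i, j) | j. j < lam ! i} = {T (i, j) | j. j < lam ! i}" using i by (simp add: tabloid_def)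
    moreover have "\<sigma> l \<in> {(\<sigma> \<circ> T) (i, j) | j. j < lam ! i}" using i ij(2) by auto
    ultimately obtain j' where j': "j' < lam ! i" "\<sigma> l = T (i, j')" by auto
    then have "(i, j') \<in> diagram lam" using i by (simp add: diagram_def)
    then have "(i', j) = (i, j')" using i' j' bij unfolding bij_betw_def by (metis inj_onD)
    then show ?thesis using i' ij by simp
  next
    case False
    then show ?thesis using permutes_not_in[OF column_stabilizer_permutes[OF \<sigma>]] by simp
  qed
qed

text \<open>Only the identity of the column stabilizer contributes to this coefficient. With
  \<open>r = id\<close> it shows that polytabloids are nonzero; for permutations of the first row it
  excludes cancellation in their sum.\<close>

lemma lookup_pushforward_polytabloid:
  assumes T: "T \<in> tableaux lam" and r: "r permutes {1..sum_list lam}" "tabloid lam (r \<circ> T) = tabloid lam T"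
  shows "Poly_Mapping.lookup (pushforward (map ((`) r)) (polytabloid lam T)) (tabloid lam T) = 1"
proof -
  let ?C = "column_stabilizer lam T"
  have inj: "inj (map ((`) r))"
    using permutes_inj[OF r(1)] by (intro inj_mapI) (simp add: inj_on_def inj_image_eq_iff)
  have iff: "tabloid lam (r \<circ> \<sigma> \<circ> T) = tabloid lam T \<longleftrightarrow> \<sigma> = id" if "\<sigma> \<in> ?C" for \<sigma>
  proof
    assume "tabloid lam (r \<circ> \<sigma> \<circ> T) = tabloid lam T"
    then have "map ((`) r) (tabloid lam (\<sigma> \<circ> T)) = map ((`) r) (tabloid lam T)"
      using r(2) by (simp only: comp_assoc tabloid_comp)
    then have "tabloid lam (\<sigma> \<circ> T) = tabloid lam T" using inj by (simp only: inj_eq)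
    then show "\<sigma> = id" using tabloid_eq_imp_id[OF T that] by simp
  qed (use r(2) in simp)
  have "Poly_Mapping.lookup (pushforward (map ((`) r)) (polytabloid lam T)) (tabloid lam T) =
      (\<Sum>\<sigma>\<in>?C. if \<sigma> = id then 1 else 0)"
    unfolding pushforward_polytabloid lookup_sum
    by (intro sum.cong) (auto simp: lookup_single when_def iff)
  also have "\<dots> = 1" using id_column_stabilizer by (simp add: sum.delta)
  finally show ?thesis .
qed

lemma map_image_id: "map ((`) id) = id"
  by (simp add: fun_eq_iff)

lemma pushforward_id: "pushforward id p = p"
  unfolding pushforward_def
  by (rule poly_mapping_eqI) (simp add: lookup_sum lookup_single when_def in_keys_iff)

lemma polytabloid_nonzero:
  assumes "T \<in> tableaux lam"
  shows "polytabloid lam T \<noteq> 0"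
  using lookup_pushforward_polytabloid[OF assms permutes_id] by (auto simp: map_image_id pushforward_id)

lemma tableaux_nonempty: "tableaux lam \<noteq> {}"
proof -
  have diag: "diagram lam = Sigma {..<length lam} (\<lambda>i. {..<lam ! i})" by (auto simp: diagram_def)
  have "card (diagram lam) = sum_list lam"
    unfolding diag by (simp add: sum_list_sum_nth atLeast0LessThan)
  moreover have "finite (diagram lam)" unfolding diag by simp
  ultimately obtain T where "bij_betw T (diagram lam) {1..sum_list lam}"
    using finite_same_card_bij[of "diagram lam" "{1..sum_list lam}"] by auto
  then show ?thesis by (auto simp: tableaux_def)
qed

section \<open>The two bounds on the length of the first row\<close>

lemma first_row_upper_bound:
  assumes n: "n \<ge> 2" and lam: "is_partition lam (k * (n - 1) + 1)" and k: "k \<ge> 1"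
    and occ: "occurs_in (sym_group (k * (n - 1) + 1)) (specht lam) (rho n k)"
  shows "lam ! 0 \<le> k"
proof (rule ccontr)
  assume "\<not> ?thesis"
  define p where "p = n - 1"
  define N where "N = k * p + 1"
  have pn: "p \<ge> 1" "n = Suc p" using n by (simp_all add: p_def)
  have N_sum: "sum_list lam = N" using lam by (simp add: is_partition_def N_def p_def)
  obtain f where f: "f \<in> intertwiners (sym_group N) (specht lam) (rho n k)" "inj_on f (carrier (specht lam))"
    using occ by (auto simp: occurs_in_def N_def p_def)
  obtain T where T: "T \<in> tableaux lam" using tableaux_nonempty by blast
  have bijT: "bij_betw T (diagram lam) {1..N}" using T N_sum by (simp add: tableaux_def)
  have lam0: "lam \<noteq> []" using N_sum by (auto simp: N_def)
  define R where "R = (\<lambda>j. T (0, j)) ` {..<lam ! 0}"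
  have row0: "(0, j) \<in> diagram lam" if "j < lam ! 0" for j using that lam0 by (simp add: diagram_def)
  have RN: "R \<subseteq> {1..N}" using bijT row0 by (auto simp: R_def bij_betw_def)
  have "inj_on (\<lambda>j. T (0, j)) {..<lam ! 0}"
    using bijT row0 by (auto simp: bij_betw_def inj_on_def)
  then have cardR: "card R > k" using \<open>\<not> lam ! 0 \<le> k\<close> by (simp add: R_def card_image)
  define H where "H = {r. r permutes R}"
  have finR: "finite R" by (simp add: R_def)
  have H: "finite H" "id \<in> H" "\<And>r. r \<in> H \<Longrightarrow> r permutes {1..N}"
    using finR RN by (auto simp: H_def permutes_id intro: finite_permutations permutes_subset)
  have Hcomp: "r \<circ> s \<in> H" if "r \<in> H" "s \<in> H" for r s using that by (auto simp: H_def intro: permutes_compose)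
  have tab: "tabloid lam (r \<circ> T) = tabloid lam T" if r: "r \<in> H" for r
    unfolding tabloid_def
  proof (rule map_cong[OF refl])
    fix i assume i: "i \<in> set [0..<length lam]"
    show "{(r \<circ> T) (i, j) | j. j < lam ! i} = {T (i, j) | j. j < lam ! i}"
    proof (cases "i = 0")
      case True
      have "r ` R = R" using r by (simp add: H_def permutes_image)
      moreover have "{T (0, j) | j. j < lam ! 0} = R" by (auto simp: R_def)
      moreover have "{(r \<circ> T) (0, j) | j. j < lam ! 0} = r ` R" by (auto simp: R_def)
      ultimately show ?thesis using True by simp
    next
      case False
      have same: "(r \<circ> T) (i, j) = T (i, j)" if "j < lam ! i" for j
      proof -
        have "(i, j) \<in> diagram lam" using i that by (simp add: diagram_def)
        then have "T (i, j) \<notin> R"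
          using False row0 bijT unfolding R_def bij_betw_def by (auto dest: inj_onD)
        then show ?thesis using r by (simp add: H_def permutes_not_in)
      qed
      have "{F (i, j) | j. j < lam ! i} = (\<lambda>j. F (i, j)) ` {..<lam ! i}" for F :: "nat \<times> nat \<Rightarrow> nat" by auto
      then show ?thesis using same by (simp only:) (intro image_cong, auto)
    qed
  qed
  \<comment> \<open>An \<open>H\<close>-invariant vector of the Specht module; it is nonzero because
    the tabloid of \<open>T\<close> has coefficient \<open>card H\<close> in it.\<close>
  define e where "e = (\<Sum>r\<in>H. pushforward (map ((`) r)) (polytabloid lam T))"
  have "Poly_Mapping.lookup e (tabloid lam T) = (\<Sum>r\<in>H. 1)"
    unfolding e_def lookup_sum
    by (intro sum.cong refl lookup_pushforward_polytabloid[OF T]) (use H tab N_sum in auto)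
  then have "Poly_Mapping.lookup e (tabloid lam T) \<noteq> 0" using H by auto
  then have e0: "e \<noteq> 0" by auto
  have e1: "e \<in> carrier (specht lam)"
    unfolding e_def specht_simps
  proof (intro cvs.span_sum cvs.span_base imageI)
    fix r assume r: "r \<in> H"
    have "r \<circ> T \<in> tableaux lam"
      using bij_betw_trans[OF bijT permutes_imp_bij[OF H(3)[OF r]]] N_sum by (simp add: tableaux_def)
    then show "pushforward (map ((`) r)) (polytabloid lam T) \<in> polytabloid lam ` tableaux lam"
      using pushforward_polytabloid_perm[of r lam T] H(3)[OF r] N_sum by auto
  qed
  have inv: "pushforward (map ((`) s)) e = cscale 1 e" if s: "s \<in> H" for s
  proof -
    have "inj_on (\<lambda>r. s \<circ> r) H"
      using permutes_inj[OF H(3)[OF s]] by (auto intro!: inj_onI simp: fun_eq_iff inj_eq)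
    moreover have "(\<lambda>r. s \<circ> r) ` H \<subseteq> H" using Hcomp s by auto
    ultimately have bij: "bij_betw (\<lambda>r. s \<circ> r) H H" using endo_inj_surj[OF H(1)] by (simp add: bij_betw_def)
    have "map ((`) s) \<circ> map ((`) r) = map ((`) (s \<circ> r))" for r :: "nat \<Rightarrow> nat"
      by (auto simp: fun_eq_iff image_comp)
    then have "pushforward (map ((`) s)) e = (\<Sum>r\<in>H. pushforward (map ((`) (s \<circ> r))) (polytabloid lam T))"
      unfolding e_def pushforward_sum pushforward_comp by simp
    also have "\<dots> = e" unfolding e_def by (rule sum.reindex_bij_betw[OF bij])
    finally show ?thesis by simp
  qed
  obtain v where v: "Poly_Mapping.keys v \<subseteq> multilinear_words n N" "v \<notin> filippov_ideal n {1..N}"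
    "\<And>\<sigma> c. \<sigma> permutes {1..N} \<Longrightarrow> pushforward (map ((`) \<sigma>)) e = cscale c e \<Longrightarrow>
       pushforward (map_word \<sigma>) v - cscale c v \<in> filippov_ideal n {1..N}"
    using intertwiner_image[OF f _ e1 e0] by (auto simp: N_def p_def)
  obtain \<Psi> where \<Psi>: "filippov_functional p {1..N} \<Psi>" "word_ext \<Psi> v \<noteq> 0" "\<And>\<sigma> w. \<sigma> \<in> H \<Longrightarrow> \<Psi> (map_word \<sigma> w) = 1 * \<Psi> w"
  proof (rule symmetrized_functional[where c = "\<lambda>_. 1" and H = H and v = v and p = p and X = "{1..N}"])
    show "v \<notin> filippov_ideal (Suc p) {1..N}" using v(2) pn(2) by simp
    show "pushforward (map_word \<sigma>) v - cscale 1 v \<in> filippov_ideal (Suc p) {1..N}" if "\<sigma> \<in> H" for \<sigma>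
      using v(3)[OF H(3)[OF that] inv[OF that]] pn(2) by simp
  qed (use H Hcomp in auto)
  interpret comb_functional p k \<Psi>
    using pn k \<Psi>(1) by unfold_locales (simp_all add: N_def)
  obtain \<theta> where \<theta>: "\<theta> permutes S" "\<Psi> (comb_word p k \<theta>) \<noteq> 0"
    using functional_comb_nonzero[OF functional pn(1) \<Psi>(2)] v(1) pn(2) by (auto simp: N_def)
  \<comment> \<open>\<open>?b l\<close> is the block that contains the letter \<open>l\<close>. More
    than \<open>k\<close> letters of the first row meet only \<open>k\<close> blocks, and exchanging
    two of them in one block multiplies the value by -1 through the bracket but by 1 through
    \<open>H\<close>.\<close>
  let ?b = "\<lambda>l. pos_block p (Hilbert_Choice.inv \<theta> l)"
  have inv_in: "Hilbert_Choice.inv \<theta> l \<in> S" if "l \<in> S" for l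
    using that permutes_in_image[OF permutes_inv[OF \<theta>(1)]] by blast
  have "?b ` R \<subseteq> {..<k}"
    using RN inv_in pos_block_less[OF pn(1) k] unfolding N_def by blast
  then have "card (?b ` R) \<le> k" using card_mono[of "{..<k}" "?b ` R"] by simp
  then have "\<not> inj_on ?b R" using cardR by (intro pigeonhole) simp
  then obtain l l' where l: "l \<in> R" "l' \<in> R" "l \<noteq> l'" "?b l = ?b l'" by (auto simp: inj_on_def)
  define P where "P = Hilbert_Choice.inv \<theta> l"
  define Q where "Q = Hilbert_Choice.inv \<theta> l'"
  have PQ: "P \<in> S" "Q \<in> S" "\<theta> P = l" "\<theta> Q = l'" "pos_block p P = pos_block p Q"
    using l RN inv_in permutes_inverses(1)[OF \<theta>(1)] unfolding P_def Q_def N_def by auto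
  have "P \<noteq> Q" using PQ l by auto
  have "phi (\<theta> \<circ> transpose P Q) = - phi \<theta>"
  proof (cases "P < Q")
    case True
    then show ?thesis using phi_antisymmetric[OF \<theta>(1)] PQ by blast
  next
    case False
    then have "Q < P" using \<open>P \<noteq> Q\<close> by simp
    then show ?thesis using phi_antisymmetric[OF \<theta>(1) PQ(2,1)] PQ(5) by (simp add: transpose_commute)
  qed
  moreover have "phi (\<theta> \<circ> transpose P Q) = phi \<theta>"
  proof -
    have "transpose l l' \<in> H" using l by (simp add: H_def permutes_swap_id)
    then have "\<Psi> (map_word (transpose l l') (comb_word p k \<theta>)) = \<Psi> (comb_word p k \<theta>)" using \<Psi>(3) by simp
    then show ?thesis
      unfolding permutes_comp_transpose[OF \<theta>(1)] PQ phi_def by (simp add: map_word_comb_word)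
  qed
  ultimately show False using \<theta>(2) by (simp add: phi_def)
qed

lemma first_row_lower_bound:
  assumes n: "n \<ge> 2" "n \<ge> k" and lam: "is_partition lam (k * (n - 1) + 1)" and k: "k \<ge> 1"
    and occ: "occurs_in (sym_group (k * (n - 1) + 1)) (specht lam) (rho n k)"
  shows "k \<le> lam ! 0"
proof (rule ccontr)
  assume less: "\<not> ?thesis"
  define p where "p = n - 1"
  define N where "N = k * p + 1"
  have pn: "p \<ge> 1" "n = Suc p" using n by (simp_all add: p_def)
  have N_sum: "sum_list lam = N" using lam by (simp add: is_partition_def N_def p_def)
  obtain f where f: "f \<in> intertwiners (sym_group N) (specht lam) (rho n k)" "inj_on f (carrier (specht lam))"
    using occ by (auto simp: occurs_in_def N_def p_def)
  obtain T where T: "T \<in> tableaux lam" using tableaux_nonempty by blast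
  have bijT: "bij_betw T (diagram lam) {1..N}" using T N_sum by (simp add: tableaux_def)
  let ?C = "column_stabilizer lam T"
  have per: "\<sigma> permutes {1..N}" if "\<sigma> \<in> ?C" for \<sigma> using column_stabilizer_permutes[OF that] N_sum by simp
  have e1: "polytabloid lam T \<in> carrier (specht lam)"
    unfolding specht_simps using T by (intro cvs.span_base imageI)
  obtain v where v: "Poly_Mapping.keys v \<subseteq> multilinear_words n N" "v \<notin> filippov_ideal n {1..N}"
    "\<And>\<sigma> c. \<sigma> permutes {1..N} \<Longrightarrow> pushforward (map ((`) \<sigma>)) (polytabloid lam T) = cscale c (polytabloid lam T) \<Longrightarrow>
       pushforward (map_word \<sigma>) v - cscale c v \<in> filippov_ideal n {1..N}"
    using intertwiner_image[OF f _ e1 polytabloid_nonzero[OF T]] by (auto simp: N_def p_def)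
  obtain \<Psi> where \<Psi>: "filippov_functional p {1..N} \<Psi>" "word_ext \<Psi> v \<noteq> 0"
    "\<And>\<sigma> w. \<sigma> \<in> ?C \<Longrightarrow> \<Psi> (map_word \<sigma> w) = of_int (sign \<sigma>) * \<Psi> w"
  proof (rule symmetrized_functional[where c = "\<lambda>\<sigma>. of_int (sign \<sigma>)" and H = ?C and v = v and p = p and X = "{1..N}"])
    show "v \<notin> filippov_ideal (Suc p) {1..N}" using v(2) pn(2) by simp
    show "pushforward (map_word \<sigma>) v - cscale (of_int (sign \<sigma>)) v \<in> filippov_ideal (Suc p) {1..N}" if "\<sigma> \<in> ?C" for \<sigma>
      using v(3)[OF per[OF that] column_stabilizer_act[OF that]] pn(2) by simp
    show "of_int (sign \<sigma>) * of_int (sign \<sigma>) = (1::complex)" for \<sigma> :: "nat \<Rightarrow> nat" by (simp add: sign_def)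
    show "of_int (sign (\<sigma> \<circ> \<tau>)) = (of_int (sign \<sigma>) * of_int (sign \<tau>) :: complex)" if "\<sigma> \<in> ?C" "\<tau> \<in> ?C" for \<sigma> \<tau>
      using permutes_sign_compose[OF _ per[OF that(1)] per[OF that(2)]] by simp
    show "?C \<noteq> {}" using id_column_stabilizer[of lam T] by blast
    show "\<sigma> \<circ> \<tau> \<in> ?C" if "\<sigma> \<in> ?C" "\<tau> \<in> ?C" for \<sigma> \<tau> using that by (rule column_stabilizer_comp)
  qed (use per in auto)
  interpret comb_functional p k \<Psi>
    using pn k \<Psi>(1) by unfold_locales (simp_all add: N_def)
  obtain \<theta> where \<theta>: "\<theta> permutes S" "\<Psi> (comb_word p k \<theta>) \<noteq> 0"
    using functional_comb_nonzero[OF functional pn(1) \<Psi>(2)] v(1) pn(2) by (auto simp: N_def)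
  define pos where "pos = inv_into (diagram lam) T"
  have pos: "pos l \<in> diagram lam" "T (pos l) = l" if "l \<in> {1..N}" for l
    using that bijT unfolding pos_def bij_betw_def by (auto intro: inv_into_into f_inv_into_f)
  have pos_T: "pos (T x) = x" if "x \<in> diagram lam" for x
    using that bijT unfolding pos_def bij_betw_def by (auto intro: inv_into_f_f)
  \<comment> \<open>Letters are coloured by their columns. At most \<open>k - 1\<close> colours
    occur, and the permutations preserving them form the column stabilizer, under which \<Psi>
    changes by the sign.\<close>
  define \<gamma> where "\<gamma> l = snd (pos l)" for l
  have "phi \<theta> = 0"
  proof (rule phi_eq_zero[OF _ _ _ \<theta>(1)])
    show "k \<le> Suc p" using n pn by simp
    fix l assume "l \<in> S"
    then have "pos l \<in> diagram lam" using pos by (simp add: N_def)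
    then obtain i j where ij: "pos l = (i, j)" "i < length lam" "j < lam ! i" by (auto simp: diagram_def)
    have "lam ! i \<le> lam ! 0"
      using lam ij by (cases "i = 0") (auto simp: is_partition_def sorted_wrt_iff_nth_less)
    then show "\<gamma> l < k - 1" using ij less by (simp add: \<gamma>_def)
  next
    fix \<sigma> \<theta>' assume \<sigma>: "\<sigma> permutes S" "\<And>l. l \<in> S \<Longrightarrow> \<gamma> (\<sigma> l) = \<gamma> l" and \<theta>': "\<theta>' permutes S"
    have "\<sigma> \<in> ?C"
      unfolding column_stabilizer_def
    proof (intro CollectI conjI ballI)
      show "\<sigma> permutes {1..sum_list lam}" using \<sigma>(1) N_sum by (simp add: N_def)
      fix x assume x: "x \<in> diagram lam"
      obtain i j where ij: "x = (i, j)" by (cases x)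
      have "T x \<in> S" using x bijT unfolding bij_betw_def N_def by blast
      then have sT: "\<sigma> (T x) \<in> {1..N}" using permutes_in_image[OF \<sigma>(1)] unfolding N_def by blast
      have "snd (pos (\<sigma> (T x))) = j" using \<sigma>(2)[OF \<open>T x \<in> S\<close>] pos_T[OF x] ij by (simp add: \<gamma>_def)
      then obtain i' where "pos (\<sigma> (T x)) = (i', j)" by (cases "pos (\<sigma> (T x))") auto
      then have "(i', j) \<in> diagram lam" "\<sigma> (T x) = T (i', j)" using pos[OF sT] by auto
      then show "case x of (i, j) \<Rightarrow> \<exists>i'. (i', j) \<in> diagram lam \<and> \<sigma> (T (i, j)) = T (i', j)"
        using ij by auto
    qed
    then show "phi (\<sigma> \<circ> \<theta>') = of_int (sign \<sigma>) * phi \<theta>'"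
      unfolding phi_def map_word_comb_word[symmetric] by (rule \<Psi>(3))
  qed
  then show False using \<theta>(2) by (simp add: phi_def)
qed

theorem theorem5p6:
  fixes n k :: nat and lam :: "nat list"
  assumes "n \<ge> k" and "k \<ge> 1"
    and "is_partition lam (k * (n - 1) + 1)"
    and "specht_occurs_in_rho lam n k"
  shows "lam ! 0 = k"
proof (cases "n = 1")
  case True
  then have k: "k = 1" using assms by simp
  then have "sum_list lam = 1" "0 \<notin> set lam" using assms(3) True by (auto simp: is_partition_def)
  then show ?thesis using k by (cases lam) auto
next
  case False
  then have n: "n \<ge> 2" using assms by simp
  have "occurs_in (sym_group (k * (n - 1) + 1)) (specht lam) (rho n k)"
    using assms(4) False by (simp add: specht_occurs_in_rho_def)
  then show ?thesis
    using first_row_upper_bound[OF n assms(3,2)] first_row_lower_bound[OF n assms(1,3,2)] by (intro antisym)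
qed

end
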